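(* Let $f,g_1,\ldots,g_m\in\mathbb{R}[x]=\mathbb{R}[x_1,\ldots,x_n]$ and let $K=\{x\in\mathbb{R}^n : g_j(x)\ge 0,\ j=1,\ldots,m\}$ be compact with nonempty interior. Assume that $g_j(x)\le 1$ for all $x\in K$ and all $j=1,\ldots,m$, that the family $\{1,g_1,\ldots,g_m\}$ generates $\mathbb{R}[x]$ as an $\mathbb{R}$-algebra, and that there exists $x_0\in K$ such that $0<g_j(x_0)<1$ for all $j=1,\ldots,m$. Let $k\in\mathbb{N}$ be fixed, and let $f^*=\min\{f(x):x\in K\}$; call this optimization problem $(P)$. With the semidefinite programs $(\mathrm{A}_d)$, $(\mathrm{B}_d)$, $(\mathrm{D}_d)$, the value $\tilde q^k_d$, the integers $s,r$ and the matrices $\mathbf{M}_\ell(\mathbf{y})$, $\mathbf{M}_\ell(g_j\,\mathbf{y})$ as defined in the context, the following hold. (a) There exists $d_0$ such that for every $d\ge d_0$ the semidefinite program $(\mathrm{A}_d)$ has an optimal solution. Hence, for each fixed $d\ge d_0$, with probability one (with respect to the random choice of the points $x^{(1)},\ldots,x^{(L)}$) the semidefinite program $(\mathrm{B}_d)$ also has an optimal solution. (b) Let $d\ge 1$ be fixed. With probability one with respect to the random choice of the points $x^{(1)},\ldots,x^{(L)}$, the following holds. Let $\theta^*\in\mathbb{R}^L$ be an optimal solution of $(\mathrm{D}_d)$ (whenever one exists), and let $\mathbf{y}^*=(y^*_\alpha)$, $\alpha\in\mathbb{N}^n_{2s}$, be given by $$y^*_\alpha:=\sum_{p=1}^L\theta^*_p\,(x^{(p)})^\alpha,\qquad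 \alpha\in\mathbb{N}^n_{2s}.$$ (b1) If $\operatorname{rank}\mathbf{M}_s(\mathbf{y}^* )=1$, then $\tilde q^k_d=f^*$ and the point $x^*=(y^*_\alpha)_{|\alpha|=1}$, i.e. $x^*=\sum_{p=1}^L\theta^*_p\,x^{(p)}$, is an optimal solution of $(P)$. (b2) If $\mathbf{M}_s(\mathbf{y}^* )\succeq 0$, $\mathbf{M}_{s-r}(g_j\,\mathbf{y}^* )\succeq 0$ for $j=1,\ldots,m$, and $\operatorname{rank}\mathbf{M}_s(\mathbf{y}^* )=\operatorname{rank}\mathbf{M}_{s-r}(\mathbf{y}^* )$, then $\tilde q^k_d=f^*$ and $(P)$ has (at least) $\operatorname{rank}\mathbf{M}_s(\mathbf{y}^* )$ distinct global minimizers, which can be extracted by a linear algebra procedure.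
   Context: Notation. $\mathbb{N}=\{0,1,2,\ldots\}$; $\mathbb{N}^n_\ell=\{\alpha\in\mathbb{N}^n:|\alpha|=\sum_i\alpha_i\le \ell\}$; $\mathbb{N}^{2m}_d=\{(\alpha,\beta)\in\mathbb{N}^m\times\mathbb{N}^m: |\alpha|+|\beta|\le d\}$; $x^\alpha=x_1^{\alpha_1}\cdots x_n^{\alpha_n}$. $\mathcal{S}^N_+$ is the cone of $N\times N$ real symmetric positive semidefinite matrices, $\langle A,B\rangle=\mathrm{trace}(AB)$, and $A\succeq 0$ means $A$ is positive semidefinite. Write $s(k)=\binom{n+k}{k}$ and let $v_k(x)$ be a vector whose $s(k)$ entries form a basis (e.g. the monomials) of the space $\mathbb{R}[x]_k$ of polynomials of degree at most $k$. For $(\alpha,\beta)\in\mathbb{N}^{2m}_d$ set $$h_{\alpha\beta}(x)=\prod_{j=1}^m g_j(x)^{\alpha_j}(1-g_j(x))^{\beta_j}.$$ Program $(\mathrm{A}_d)$: maximize $t$ over $t\in\mathbb{R}$, $\lambda=(\lambda_{\alpha\beta})_{(\alpha,\beta)\in\mathbb{N}^{2m}_d}\ge 0$ and $Q\in\mathcal{S}^{s(k)}_+$, subject to the polynomial identity $$f(x)-t-\sum_{(\alpha,\beta)\in\mathbb{N}^{2m}_d}\lambda_{\alpha\beta}\,h_{\alpha\beta}(x)=\langle Q,v_k(x)v_k(x)^T\rangle .$$ Let $\tau=\max\{\deg f,\,2k,\,d\max_j\deg g_j\}$ and $L=\binom{n+\tau}{n}$, and let $x^{(1)},\ldots,x^{(L)}$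 be points selected at random (independently, uniformly) in $[-1,1]^n$. Program $(\mathrm{B}_d)$: maximize $t$ over $t\in\mathbb{R}$, $\lambda\ge 0$, $Q\in\mathcal{S}^{s(k)}_+$, subject to $$f(x^{(p)})=t+\sum_{(\alpha,\beta)\in\mathbb{N}^{2m}_d}\lambda_{\alpha\beta}\,h_{\alpha\beta}(x^{(p)})+\langle Q,v_k(x^{(p)})v_k(x^{(p)})^T\rangle,\qquad p=1,\ldots,L.$$ Program $(\mathrm{D}_d)$ (the dual of $(\mathrm{B}_d)$), with optimal value $\tilde q^k_d$: $$\tilde q^k_d=\inf_{\theta\in\mathbb{R}^L}\Big\{\sum_{p=1}^L\theta_p f(x^{(p)})\;:\;\sum_{p=1}^L\theta_p\,v_k(x^{(p)})v_k(x^{(p)})^T\succeq 0;\ \sum_{p=1}^L\theta_p\,h_{\alpha\beta}(x^{(p)})\ge 0\ \ \forall(\alpha,\beta)\in\mathbb{N}^{2m}_d;\ \sum_{p=1}^L\theta_p=1\Big\}.$$ The weights $\theta_p$ are not required to be nonnegative. An optimal solution of a program is a feasible point at which its supremum (resp. infimum) is attained. Let $s\in\mathbb{N}$ be the smallest integer such that $2s\ge\max\{\deg f,\deg g_1,\ldots,\deg g_m\}$ and let $r=\max_j\lceil\deg(g_j)/2\rceil$. For a real sequence $\mathbf{y}=(y_\alpha)$, the moment matrix $\mathbf{M}_\ell(\mathbf{y})$ is the real symmetric matrix with rows and columns indexed by $\mathbb{N}^n_\ell$ and entries $\mathbf{M}_\ell(\mathbf{y})(\alpha,\beta)=y_{\alpha+\beta}$.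 For $g_j(x)=\sum_\gamma g_{j\gamma}x^\gamma$, the localizing matrix $\mathbf{M}_\ell(g_j\,\mathbf{y})$ has rows and columns indexed by $\mathbb{N}^n_\ell$ and entries $\mathbf{M}_\ell(g_j\,\mathbf{y})(\alpha,\beta)=\sum_\gamma g_{j\gamma}\,y_{\alpha+\beta+\gamma}$. *)

theory Defs
  imports
    "HOL-Probability.Probability"
    "HOL-Library.Poly_Mapping"
    "HOL-Library.Function_Algebras"
begin
text \<open>The variables are indexed by the finite type \<open>'n\<close>, so that points are elements of
  \<open>real^'n\<close> and \<open>n = CARD('n)\<close>. A polynomial maps exponent vectors to coefficients.\<close>

type_synonym 'n mpoly = "('n \<Rightarrow>\<^sub>0 nat) \<Rightarrow>\<^sub>0 real"

definition mdeg :: "('n::finite \<Rightarrow>\<^sub>0 nat) \<Rightarrow> nat" where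
  "mdeg \<alpha> = (\<Sum>i\<in>UNIV. Poly_Mapping.lookup \<alpha> i)"

definition expo :: "nat \<Rightarrow> ('n::finite \<Rightarrow>\<^sub>0 nat) set" where
  "expo l = {\<alpha>. mdeg \<alpha> \<le> l}"

definition meval :: "('n::finite \<Rightarrow>\<^sub>0 nat) \<Rightarrow> real^'n \<Rightarrow> real" where
  "meval \<alpha> x = (\<Prod>i\<in>UNIV. x $ i ^ Poly_Mapping.lookup \<alpha> i)"

definition peval :: "'n::finite mpoly \<Rightarrow> real^'n \<Rightarrow> real" where
  "peval p x = (\<Sum>\<alpha>\<in>Poly_Mapping.keys p. Poly_Mapping.lookup p \<alpha> * meval \<alpha> x)"

text \<open>The zero polynomial gets degree 0.\<close>

definition pdeg :: "'n::finite mpoly \<Rightarrow> nat" where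
  "pdeg p = Max (insert 0 (mdeg ` Poly_Mapping.keys p))"

definition pconst :: "real \<Rightarrow> 'n mpoly" where
  "pconst c = Poly_Mapping.single 0 c"

definition pscale :: "real \<Rightarrow> 'n mpoly \<Rightarrow> 'n mpoly" where
  "pscale c p = pconst c * p"

global_interpretation poly_vs: vector_space "pscale :: real \<Rightarrow> 'n mpoly \<Rightarrow> 'n mpoly"
  by unfold_locales
    (simp_all add: pscale_def pconst_def distrib_left distrib_right single_add mult_single
      mult.assoc[symmetric])

definition polys_upto :: "nat \<Rightarrow> 'n::finite mpoly set" where
  "polys_upto k = {p. pdeg p \<le> k}"

definition sdim :: "nat \<Rightarrow> nat \<Rightarrow> nat" where
  "sdim n k = (n + k) choose k"

definition basis_vec :: "nat \<Rightarrow> (nat \<Rightarrow> 'n::finite mpoly) \<Rightarrow> bool" where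
  "basis_vec k v \<longleftrightarrow>
     inj_on v {..<sdim CARD('n) k} \<and>
     poly_vs.independent (v ` {..<sdim CARD('n) k}) \<and>
     poly_vs.span (v ` {..<sdim CARD('n) k}) = polys_upto k"

inductive_set generated_algebra :: "'n mpoly set \<Rightarrow> 'n mpoly set" for G where
  gen: "p \<in> G \<Longrightarrow> p \<in> generated_algebra G"
| scale: "p \<in> generated_algebra G \<Longrightarrow> pscale c p \<in> generated_algebra G"
| add: "p \<in> generated_algebra G \<Longrightarrow> q \<in> generated_algebra G \<Longrightarrow> p + q \<in> generated_algebra G"
| mult: "p \<in> generated_algebra G \<Longrightarrow> q \<in> generated_algebra G \<Longrightarrow> p * q \<in> generated_algebra G"

text \<open>A matrix with rows and columns indexed by the finite set \<open>I\<close> is a function whose values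
  outside \<open>I \<times> I\<close> are ignored.\<close>

definition psd_on :: "'i set \<Rightarrow> ('i \<Rightarrow> 'i \<Rightarrow> real) \<Rightarrow> bool" where
  "psd_on I A \<longleftrightarrow>
     (\<forall>i\<in>I. \<forall>j\<in>I. A i j = A j i) \<and>
     (\<forall>c. 0 \<le> (\<Sum>i\<in>I. \<Sum>j\<in>I. c i * A i j * c j))"

definition trace_prod :: "'i set \<Rightarrow> ('i \<Rightarrow> 'i \<Rightarrow> real) \<Rightarrow> ('i \<Rightarrow> 'i \<Rightarrow> real) \<Rightarrow> real" where
  "trace_prod I A B = (\<Sum>i\<in>I. \<Sum>j\<in>I. A i j * B j i)"

definition trace_prod_poly ::
    "'i set \<Rightarrow> ('i \<Rightarrow> 'i \<Rightarrow> real) \<Rightarrow> ('i \<Rightarrow> 'i \<Rightarrow> 'n mpoly) \<Rightarrow> 'n mpoly" where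
  "trace_prod_poly I A B = (\<Sum>i\<in>I. \<Sum>j\<in>I. pscale (A i j) (B j i))"

definition fscale :: "real \<Rightarrow> ('i \<Rightarrow> real) \<Rightarrow> 'i \<Rightarrow> real" where
  "fscale c u = (\<lambda>i. c * u i)"

global_interpretation fun_vs: vector_space "fscale :: real \<Rightarrow> ('i \<Rightarrow> real) \<Rightarrow> 'i \<Rightarrow> real"
  by unfold_locales (auto simp: fscale_def algebra_simps)

definition column_on :: "'i set \<Rightarrow> ('i \<Rightarrow> 'i \<Rightarrow> real) \<Rightarrow> 'i \<Rightarrow> 'i \<Rightarrow> real" where
  "column_on I A j = (\<lambda>i. if i \<in> I then A i j else 0)"

definition rank_on :: "'i set \<Rightarrow> ('i \<Rightarrow> 'i \<Rightarrow> real) \<Rightarrow> nat" where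
  "rank_on I A = fun_vs.dim (column_on I A ` I)"

definition feasible_set :: "('m \<Rightarrow> 'n::finite mpoly) \<Rightarrow> (real^'n) set" where
  "feasible_set g = {x. \<forall>j. 0 \<le> peval (g j) x}"

definition f_star :: "'n::finite mpoly \<Rightarrow> ('m \<Rightarrow> 'n mpoly) \<Rightarrow> real" where
  "f_star f g = (INF x\<in>feasible_set g. peval f x)"

definition minimizer :: "'n::finite mpoly \<Rightarrow> ('m \<Rightarrow> 'n mpoly) \<Rightarrow> real^'n \<Rightarrow> bool" where
  "minimizer f g x \<longleftrightarrow> is_arg_min (peval f) (\<lambda>x. x \<in> feasible_set g) x"

definition expo_pairs :: "nat \<Rightarrow> (('m::finite \<Rightarrow> nat) \<times> ('m \<Rightarrow> nat)) set" where
  "expo_pairs d = {(\<alpha>, \<beta>). (\<Sum>j\<in>UNIV. \<alpha> j) + (\<Sum>j\<in>UNIV. \<beta> j) \<le> d}"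

definition hpoly ::
    "('m::finite \<Rightarrow> 'n mpoly) \<Rightarrow> ('m \<Rightarrow> nat) \<times> ('m \<Rightarrow> nat) \<Rightarrow> 'n mpoly" where
  "hpoly g = (\<lambda>(\<alpha>, \<beta>). \<Prod>j\<in>UNIV. g j ^ \<alpha> j * (1 - g j) ^ \<beta> j)"

definition tau :: "'n::finite mpoly \<Rightarrow> ('m::finite \<Rightarrow> 'n mpoly) \<Rightarrow> nat \<Rightarrow> nat \<Rightarrow> nat" where
  "tau f g k d = Max {pdeg f, 2 * k, d * Max (range (\<lambda>j. pdeg (g j)))}"

definition npts :: "'n::finite mpoly \<Rightarrow> ('m::finite \<Rightarrow> 'n mpoly) \<Rightarrow> nat \<Rightarrow> nat \<Rightarrow> nat" where
  "npts f g k d = (CARD('n) + tau f g k d) choose CARD('n)"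

text \<open>The law of \<open>L\<close> independent uniformly distributed points of the cube \<open>[-1,1]^n\<close>;
  the points are numbered from \<open>0\<close> to \<open>L - 1\<close>.\<close>

definition random_points :: "nat \<Rightarrow> (nat \<Rightarrow> real^'n::finite) measure" where
  "random_points L = PiM {..<L} (\<lambda>_. uniform_measure lborel {x. \<forall>i. -1 \<le> x $ i \<and> x $ i \<le> 1})"

text \<open>Candidate solutions of the programs \<open>A\<close> and \<open>B\<close> are triples of \<open>t\<close>, the weights \<open>\<lambda>\<close> and
  the Gram matrix \<open>Q\<close>; the objective is \<open>fst\<close>.\<close>

type_synonym 'm candidate =
  "real \<times> (('m \<Rightarrow> nat) \<times> ('m \<Rightarrow> nat) \<Rightarrow> real) \<times> (nat \<Rightarrow> nat \<Rightarrow> real)"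

definition A_feasible ::
    "'n::finite mpoly \<Rightarrow> ('m::finite \<Rightarrow> 'n mpoly) \<Rightarrow> (nat \<Rightarrow> 'n mpoly) \<Rightarrow> nat \<Rightarrow> nat
      \<Rightarrow> 'm candidate \<Rightarrow> bool" where
  "A_feasible f g v k d = (\<lambda>(t, \<Lambda>, Q).
     (\<forall>c\<in>expo_pairs d. 0 \<le> \<Lambda> c) \<and>
     psd_on {..<sdim CARD('n) k} Q \<and>
     f - pconst t - (\<Sum>c\<in>expo_pairs d. pscale (\<Lambda> c) (hpoly g c))
       = trace_prod_poly {..<sdim CARD('n) k} Q (\<lambda>i j. v i * v j))"

definition A_optimal ::
    "'n::finite mpoly \<Rightarrow> ('m::finite \<Rightarrow> 'n mpoly) \<Rightarrow> (nat \<Rightarrow> 'n mpoly) \<Rightarrow> nat \<Rightarrow> nat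
      \<Rightarrow> 'm candidate \<Rightarrow> bool" where
  "A_optimal f g v k d z \<longleftrightarrow> is_arg_max fst (A_feasible f g v k d) z"

definition B_feasible ::
    "'n::finite mpoly \<Rightarrow> ('m::finite \<Rightarrow> 'n mpoly) \<Rightarrow> (nat \<Rightarrow> 'n mpoly) \<Rightarrow> nat \<Rightarrow> nat
      \<Rightarrow> (nat \<Rightarrow> real^'n) \<Rightarrow> 'm candidate \<Rightarrow> bool" where
  "B_feasible f g v k d X = (\<lambda>(t, \<Lambda>, Q).
     (\<forall>c\<in>expo_pairs d. 0 \<le> \<Lambda> c) \<and>
     psd_on {..<sdim CARD('n) k} Q \<and>
     (\<forall>p<npts f g k d.
        peval f (X p) = t + (\<Sum>c\<in>expo_pairs d. \<Lambda> c * peval (hpoly g c) (X p))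
          + trace_prod {..<sdim CARD('n) k} Q (\<lambda>i j. peval (v i) (X p) * peval (v j) (X p))))"

definition B_optimal ::
    "'n::finite mpoly \<Rightarrow> ('m::finite \<Rightarrow> 'n mpoly) \<Rightarrow> (nat \<Rightarrow> 'n mpoly) \<Rightarrow> nat \<Rightarrow> nat
      \<Rightarrow> (nat \<Rightarrow> real^'n) \<Rightarrow> 'm candidate \<Rightarrow> bool" where
  "B_optimal f g v k d X z \<longleftrightarrow> is_arg_max fst (B_feasible f g v k d X) z"

definition D_objective ::
    "'n::finite mpoly \<Rightarrow> ('m::finite \<Rightarrow> 'n mpoly) \<Rightarrow> nat \<Rightarrow> nat \<Rightarrow> (nat \<Rightarrow> real^'n)
      \<Rightarrow> (nat \<Rightarrow> real) \<Rightarrow> real" where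
  "D_objective f g k d X \<theta> = (\<Sum>p<npts f g k d. \<theta> p * peval f (X p))"

definition D_feasible ::
    "'n::finite mpoly \<Rightarrow> ('m::finite \<Rightarrow> 'n mpoly) \<Rightarrow> (nat \<Rightarrow> 'n mpoly) \<Rightarrow> nat \<Rightarrow> nat
      \<Rightarrow> (nat \<Rightarrow> real^'n) \<Rightarrow> (nat \<Rightarrow> real) \<Rightarrow> bool" where
  "D_feasible f g v k d X \<theta> \<longleftrightarrow>
     psd_on {..<sdim CARD('n) k}
       (\<lambda>i j. \<Sum>p<npts f g k d. \<theta> p * (peval (v i) (X p) * peval (v j) (X p))) \<and>
     (\<forall>c\<in>expo_pairs d. 0 \<le> (\<Sum>p<npts f g k d. \<theta> p * peval (hpoly g c) (X p))) \<and>
     (\<Sum>p<npts f g k d. \<theta> p) = 1"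

definition D_value ::
    "'n::finite mpoly \<Rightarrow> ('m::finite \<Rightarrow> 'n mpoly) \<Rightarrow> (nat \<Rightarrow> 'n mpoly) \<Rightarrow> nat \<Rightarrow> nat
      \<Rightarrow> (nat \<Rightarrow> real^'n) \<Rightarrow> ereal" where
  "D_value f g v k d X =
     (INF \<theta>\<in>Collect (D_feasible f g v k d X). ereal (D_objective f g k d X \<theta>))"

definition D_optimal ::
    "'n::finite mpoly \<Rightarrow> ('m::finite \<Rightarrow> 'n mpoly) \<Rightarrow> (nat \<Rightarrow> 'n mpoly) \<Rightarrow> nat \<Rightarrow> nat
      \<Rightarrow> (nat \<Rightarrow> real^'n) \<Rightarrow> (nat \<Rightarrow> real) \<Rightarrow> bool" where
  "D_optimal f g v k d X \<theta> \<longleftrightarrow>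
     is_arg_min (D_objective f g k d X) (D_feasible f g v k d X) \<theta>"

definition s_order :: "'n::finite mpoly \<Rightarrow> ('m::finite \<Rightarrow> 'n mpoly) \<Rightarrow> nat" where
  "s_order f g = (LEAST s. Max (insert (pdeg f) (range (\<lambda>j. pdeg (g j)))) \<le> 2 * s)"

definition r_order :: "('m::finite \<Rightarrow> 'n::finite mpoly) \<Rightarrow> nat" where
  "r_order g = Max (range (\<lambda>j. nat \<lceil>real (pdeg (g j)) / 2\<rceil>))"

definition moment_matrix ::
    "(('n \<Rightarrow>\<^sub>0 nat) \<Rightarrow> real) \<Rightarrow> ('n \<Rightarrow>\<^sub>0 nat) \<Rightarrow> ('n \<Rightarrow>\<^sub>0 nat) \<Rightarrow> real" where
  "moment_matrix y \<alpha> \<beta> = y (\<alpha> + \<beta>)"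

definition localizing_matrix ::
    "'n mpoly \<Rightarrow> (('n \<Rightarrow>\<^sub>0 nat) \<Rightarrow> real) \<Rightarrow> ('n \<Rightarrow>\<^sub>0 nat) \<Rightarrow> ('n \<Rightarrow>\<^sub>0 nat) \<Rightarrow> real" where
  "localizing_matrix q y \<alpha> \<beta> =
     (\<Sum>\<gamma>\<in>Poly_Mapping.keys q. Poly_Mapping.lookup q \<gamma> * y (\<alpha> + \<beta> + \<gamma>))"

definition theta_moments ::
    "nat \<Rightarrow> (nat \<Rightarrow> real^'n::finite) \<Rightarrow> (nat \<Rightarrow> real) \<Rightarrow> ('n \<Rightarrow>\<^sub>0 nat) \<Rightarrow> real" where
  "theta_moments L X \<theta> \<alpha> = (\<Sum>p<L. \<theta> p * meval \<alpha> (X p))"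

text \<open>This is the standard extraction procedure of Henrion and Lasserre. Given that
  \<open>moment_matrix y\<close> on \<open>expo s\<close> has the same rank as on \<open>expo l\<close>, with \<open>l < s\<close>:

  \<^item> choose monomials \<open>B\<close> of degree at most \<open>l\<close> whose columns are a basis of the column space of
    the large matrix;
  \<^item> for each variable \<open>i\<close>, solve the linear system expressing the column of each \<open>x_i x^\<beta>\<close>,
    \<open>\<beta>\<close> in \<open>B\<close>, in this basis; the coefficients form the multiplication matrix \<open>N i\<close>;
  \<^item> read off the points as the joint eigenvalues of the matrices \<open>N i\<close>; a point \<open>x\<close> has the left
    joint eigenvector of entries \<open>x^\<gamma>\<close>, \<open>\<gamma>\<close> in \<open>B\<close>.\<close>

definition column_basis ::
    "(('n::finite \<Rightarrow>\<^sub>0 nat) \<Rightarrow> real) \<Rightarrow> nat \<Rightarrow> nat \<Rightarrow> ('n \<Rightarrow>\<^sub>0 nat) set \<Rightarrow> bool" where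
  "column_basis y l s B \<longleftrightarrow>
     B \<subseteq> expo l \<and>
     inj_on (column_on (expo s) (moment_matrix y)) B \<and>
     fun_vs.independent (column_on (expo s) (moment_matrix y) ` B) \<and>
     fun_vs.span (column_on (expo s) (moment_matrix y) ` B)
       = fun_vs.span (column_on (expo s) (moment_matrix y) ` expo s)"

definition multiplication_matrices ::
    "(('n::finite \<Rightarrow>\<^sub>0 nat) \<Rightarrow> real) \<Rightarrow> nat \<Rightarrow> ('n \<Rightarrow>\<^sub>0 nat) set
      \<Rightarrow> ('n \<Rightarrow> ('n \<Rightarrow>\<^sub>0 nat) \<Rightarrow> ('n \<Rightarrow>\<^sub>0 nat) \<Rightarrow> real) \<Rightarrow> bool" where
  "multiplication_matrices y s B N \<longleftrightarrow>
     (\<forall>i. \<forall>\<beta>\<in>B.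
        column_on (expo s) (moment_matrix y) (\<beta> + Poly_Mapping.single i 1)
          = (\<Sum>\<gamma>\<in>B. fscale (N i \<gamma> \<beta>) (column_on (expo s) (moment_matrix y) \<gamma>)))"

definition joint_eigenvalues ::
    "'i set \<Rightarrow> ('n::finite \<Rightarrow> 'i \<Rightarrow> 'i \<Rightarrow> real) \<Rightarrow> (real^'n) set" where
  "joint_eigenvalues B N =
     {x. \<exists>w. (\<exists>\<beta>\<in>B. w \<beta> \<noteq> 0) \<and>
             (\<forall>i. \<forall>\<beta>\<in>B. (\<Sum>\<gamma>\<in>B. w \<gamma> * N i \<gamma> \<beta>) = x $ i * w \<beta>)}"

definition extracted_by_linear_algebra ::
    "(('n::finite \<Rightarrow>\<^sub>0 nat) \<Rightarrow> real) \<Rightarrow> nat \<Rightarrow> nat \<Rightarrow> (real^'n) set \<Rightarrow> bool" where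
  "extracted_by_linear_algebra y l s Z \<longleftrightarrow>
     (\<exists>B. column_basis y l s B) \<and>
     (\<forall>B. column_basis y l s B \<longrightarrow>
        (\<exists>N. multiplication_matrices y s B N) \<and>
        (\<forall>N. multiplication_matrices y s B N \<longrightarrow> joint_eigenvalues B N = Z))"

end

theory Submission
  imports Defs
begin

text \<open>
  Everything that involves the random points rests on one fact: the \<open>L\<close> points are almost surely
  unisolvent for the polynomials of degree at most \<open>\<tau>\<close>, where \<open>L\<close> is the dimension of that space
  (\<open>AE_unisolvent\<close>). A nonzero polynomial vanishes only on a null set, so in an elimination on the
  monomials each new random point almost surely gives a nonzero pivot. Two consequences follow. A
  polynomial identity of degree at most \<open>\<tau>\<close> may be tested at the points, so the programs \<open>B\<close> and \<open>A\<close> have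
  the same feasible candidates (\<open>B_feasible_iff_A_feasible\<close>). And the evaluation at any point is a
  combination of the evaluations at the random points (\<open>unisolvent_interpolation\<close>), so each \<open>x\<close> in the
  feasible set yields a feasible \<open>\<theta>\<close> for the program \<open>D\<close> with objective \<open>f x\<close>, and the dual value is a lower
  bound for \<open>f\<close> there (\<open>D_optimal_le\<close>).

  Part (a). The nonnegative combinations of the \<open>h\<^sub>\<alpha>\<^sub>\<beta>\<close> are closed under products, and they contain
  \<open>1 - g j\<close> and \<open>1 + g j\<close>. Hence the polynomials \<open>p\<close> for which \<open>M - p\<close> and \<open>M + p\<close> are such combinations,
  for some constant \<open>M\<close>, form an algebra, and this algebra contains all \<open>g j\<close>, so it contains \<open>f\<close>
  (\<open>generated_algebra_bounded\<close>). That makes \<open>A\<close> feasible from some degree on. Near \<open>x0\<close> all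
  \<open>h\<^sub>\<alpha>\<^sub>\<beta>\<close> are positive. Evaluating the identity there bounds the weights and the Gram matrix, so the
  candidates above a given level are compact and the supremum is attained
  (\<open>A_optimal_if_feasible\<close>).

  Part (b). Suppose that the moments of an optimal \<open>\<theta>\<close> up to degree \<open>2 s\<close> are those of a positive measure
  on finitely many feasible points. Then the dual value is an average of the values of \<open>f\<close> at these points,
  and it bounds \<open>f\<close> from below on the feasible set. So all these points are minimizers
  (\<open>atoms_are_minimizers\<close>). It remains to produce the measure.

  If the moment matrix has rank 1, then \<open>y\<close> is multiplicative and is the evaluation at one point
  (\<open>rank_one_point_moments\<close>); the constraints of \<open>D\<close> contain \<open>g j\<close> itself, so this point is feasible.

  In the flat case the moment matrix is an inner product on the polynomials of degree at most \<open>s\<close> modulo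
  its kernel. Flatness provides each class with a representative of degree at most \<open>l = s - r < s\<close>, so
  multiplication by each variable is a well defined operator, given by a multiplication matrix. These
  operators are symmetric and commute, so there is an orthogonal basis of joint eigenvectors
  (\<open>joint_eigenvectors_complete\<close>). Expanding \<open>y (\<alpha> + \<beta>)\<close>, the inner product of the classes of \<open>x\<^sup>\<alpha>\<close> and
  \<open>x\<^sup>\<beta>\<close>, in this basis represents \<open>y\<close> by atoms at the joint eigenvalues (\<open>atomic_representation\<close>).
  The eigenvectors, read as polynomials of degree at most \<open>l\<close>, vanish at all atoms but one, and the
  localizing matrices tested on them show that the atoms are feasible (\<open>localizing_nonneg\<close>). Finally
  the atoms are the common zeros of the kernel of the moment matrix, a description in which no basis
  occurs. Therefore the extraction procedure finds them from every column basis
  (\<open>joint_eigenvalues_eq\<close>, \<open>Z_eq_kernel_variety\<close>).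
\<close>

section \<open>Polynomials as functions\<close>

abbreviation (input) lookup where "lookup \<equiv> Poly_Mapping.lookup"

lemma meval_add: "meval (\<alpha> + \<beta>) x = meval \<alpha> x * meval \<beta> x"
  by (simp add: meval_def lookup_add power_add prod.distrib)

lemma meval_0 [simp]: "meval 0 x = 1"
  by (simp add: meval_def)

lemma meval_single [simp]: "meval (Poly_Mapping.single i 1) x = x $ i"
proof -
  have "meval (Poly_Mapping.single i 1) x = (\<Prod>j\<in>UNIV. if j = i then x $ i else 1)"
    unfolding meval_def by (intro prod.cong) (auto simp: lookup_single when_def)
  then show ?thesis by simp
qed

lemma peval_superset:
  assumes "finite A" "Poly_Mapping.keys p \<subseteq> A"
  shows "peval p x = (\<Sum>\<alpha>\<in>A. Poly_Mapping.lookup p \<alpha> * meval \<alpha> x)"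
  unfolding peval_def using assms by (intro sum.mono_neutral_left) (auto simp: in_keys_iff)

lemma peval_single: "peval (Poly_Mapping.single \<alpha> c) x = c * meval \<alpha> x"
  by (simp add: peval_superset[of "{\<alpha>}"])

lemma peval_0 [simp]: "peval 0 x = 0"
  by (simp add: peval_def)

lemma peval_add: "peval (p + q) x = peval p x + peval q x"
proof -
  let ?A = "Poly_Mapping.keys p \<union> Poly_Mapping.keys q"
  have "Poly_Mapping.keys (p + q) \<subseteq> ?A" by (rule keys_add)
  then show ?thesis
    by (simp add: peval_superset[of ?A] lookup_add distrib_right sum.distrib)
qed

lemma peval_uminus: "peval (- p) x = - peval p x"
  by (simp add: peval_superset[of "Poly_Mapping.keys p"] sum_negf in_keys_iff subset_iff)

lemma peval_diff: "peval (p - q) x = peval p x - peval q x"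
  using peval_add[of p "- q" x] by (simp add: peval_uminus)

lemma peval_sum: "peval (\<Sum>i\<in>I. p i) x = (\<Sum>i\<in>I. peval (p i) x)"
  by (induction I rule: infinite_finite_induct) (simp_all add: peval_add)

lemma poly_mapping_monomials:
  "p = (\<Sum>\<alpha>\<in>Poly_Mapping.keys p. Poly_Mapping.single \<alpha> (Poly_Mapping.lookup p \<alpha>))"
  by (rule poly_mapping_eqI) (auto simp: lookup_sum lookup_single when_def in_keys_iff)

lemma peval_mult: "peval (p * q) x = peval p x * peval q x"
proof -
  have "peval (p * q) x = peval ((\<Sum>\<alpha>\<in>Poly_Mapping.keys p. Poly_Mapping.single \<alpha> (lookup p \<alpha>)) *
      (\<Sum>\<beta>\<in>Poly_Mapping.keys q. Poly_Mapping.single \<beta> (lookup q \<beta>))) x"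
    using poly_mapping_monomials[of p] poly_mapping_monomials[of q] by simp
  also have "\<dots> = (\<Sum>\<alpha>\<in>Poly_Mapping.keys p. \<Sum>\<beta>\<in>Poly_Mapping.keys q.
      (lookup p \<alpha> * meval \<alpha> x) * (lookup q \<beta> * meval \<beta> x))"
    by (simp add: sum_product peval_sum mult_single peval_single meval_add ac_simps)
  also have "\<dots> = peval p x * peval q x"
    by (simp add: sum_product peval_def)
  finally show ?thesis .
qed

lemma peval_pconst [simp]: "peval (pconst c) x = c"
  by (simp add: pconst_def peval_single)

lemma peval_1 [simp]: "peval 1 x = 1"
  using peval_pconst[of 1 x] by (simp add: pconst_def)

lemma peval_pscale: "peval (pscale c p) x = c * peval p x"
  by (simp add: pscale_def peval_mult)

lemma peval_power: "peval (p ^ k) x = peval p x ^ k"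
  by (induction k) (simp_all add: peval_mult)

lemma peval_prod: "peval (\<Prod>i\<in>I. p i) x = (\<Prod>i\<in>I. peval (p i) x)"
  by (induction I rule: infinite_finite_induct) (simp_all add: peval_mult)

lemmas peval_simps = peval_add peval_uminus peval_diff peval_sum peval_mult peval_pscale
  peval_power peval_prod

lemma lookup_pscale: "Poly_Mapping.lookup (pscale c p) \<alpha> = c * Poly_Mapping.lookup p \<alpha>"
proof -
  have "pscale c p = Poly_Mapping.map ((*) c) p"
    by (simp add: pscale_def pconst_def mult_map_scale_conv_mult)
  then show ?thesis by (simp add: Poly_Mapping.map.rep_eq when_def)
qed

lemma continuous_on_meval [continuous_intros]:
  "continuous_on S h \<Longrightarrow> continuous_on S (\<lambda>x. meval \<alpha> (h x))"
  unfolding meval_def by (intro continuous_intros)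

lemma continuous_on_peval [continuous_intros]:
  "continuous_on S h \<Longrightarrow> continuous_on S (\<lambda>x. peval p (h x))"
  unfolding peval_def by (intro continuous_intros)

lemma peval_borel [measurable]: "peval p \<in> borel_measurable borel"
  by (intro borel_measurable_continuous_onI continuous_intros)


section \<open>Degrees\<close>

lemma mdeg_add: "mdeg (\<alpha> + \<beta>) = mdeg \<alpha> + mdeg \<beta>"
  by (simp add: mdeg_def lookup_add sum.distrib)

lemma mdeg_0 [simp]: "mdeg 0 = 0"
  by (simp add: mdeg_def)

lemma mdeg_single [simp]: "mdeg (Poly_Mapping.single i k) = k"
  by (simp add: mdeg_def lookup_single when_def)

lemma mdeg_eq_0_iff: "mdeg \<alpha> = 0 \<longleftrightarrow> \<alpha> = 0"
  by (auto simp: mdeg_def intro: poly_mapping_eqI)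

lemma zero_in_expo [simp]: "0 \<in> expo l"
  by (simp add: expo_def)

lemma expo_mono: "l \<le> s \<Longrightarrow> expo l \<subseteq> expo s"
  by (auto simp: expo_def)

text \<open>Padding an exponent vector with the slack \<open>l - |\<alpha>|\<close> turns it into a list of fixed sum,
  and such lists are counted by stars and bars.\<close>

lemma finite_expo [simp]: "finite (expo l :: ('n::finite \<Rightarrow>\<^sub>0 nat) set)"
  and card_expo: "card (expo l :: ('n \<Rightarrow>\<^sub>0 nat) set) = (CARD('n) + l) choose CARD('n)"
proof -
  obtain us :: "'n list" where us: "set us = UNIV" "distinct us"
    using finite_distinct_list[OF finite] by metis
  have len: "length us = CARD('n)"
    using us distinct_card by fastforce
  have sum_us: "sum_list (map h us) = (\<Sum>i\<in>UNIV. h i)" for h :: "'n \<Rightarrow> nat"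
    using us sum_list_distinct_conv_sum_set by fastforce
  define enc where "enc \<alpha> = (l - mdeg \<alpha>) # map (Poly_Mapping.lookup \<alpha>) us"
    for \<alpha> :: "'n \<Rightarrow>\<^sub>0 nat"
  let ?L = "{xs :: nat list. size xs = Suc CARD('n) \<and> sum_list xs = l}"
  have "bij_betw enc (expo l) ?L"
  proof (rule bij_betwI')
    fix \<alpha> \<beta> :: "'n \<Rightarrow>\<^sub>0 nat"
    show "enc \<alpha> = enc \<beta> \<longleftrightarrow> \<alpha> = \<beta>"
      using us by (auto simp: enc_def intro!: poly_mapping_eqI)
  next
    fix \<alpha> :: "'n \<Rightarrow>\<^sub>0 nat" assume "\<alpha> \<in> expo l"
    then show "enc \<alpha> \<in> ?L"
      by (auto simp: enc_def len sum_us expo_def mdeg_def)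
  next
    fix xs assume "xs \<in> ?L"
    then obtain a ys where xs: "xs = a # ys" "length ys = CARD('n)" "a + sum_list ys = l"
      by (cases xs) auto
    define \<alpha> where "\<alpha> = Poly_Mapping.Abs_poly_mapping (\<lambda>i. the (map_of (zip us ys) i))"
    have lookup\<alpha>: "lookup \<alpha> = (\<lambda>i. the (map_of (zip us ys) i))"
      unfolding \<alpha>_def by (rule Abs_poly_mapping_inverse) simp
    have "map (lookup \<alpha>) us = ys"
      unfolding lookup\<alpha> using us xs len
      by (intro nth_equalityI) (auto simp: map_of_zip_nth)
    moreover from this have "mdeg \<alpha> = sum_list ys"
      unfolding mdeg_def using sum_us by metis
    ultimately show "\<exists>\<alpha>\<in>expo l. xs = enc \<alpha>"
      using xs by (intro bexI[of _ \<alpha>]) (auto simp: enc_def expo_def)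
  qed
  moreover have "finite ?L"
  proof (rule finite_subset)
    show "?L \<subseteq> {xs. set xs \<subseteq> {..l} \<and> length xs = Suc CARD('n)}"
      using member_le_sum_list by fastforce
  qed (rule finite_lists_length_eq, simp)
  ultimately show "finite (expo l :: ('n \<Rightarrow>\<^sub>0 nat) set)"
    and "card (expo l :: ('n \<Rightarrow>\<^sub>0 nat) set) = (CARD('n) + l) choose CARD('n)"
    using bij_betw_finite bij_betw_same_card card_length_sum_list[of "Suc CARD('n)" l]
      binomial_symmetric[of l "l + CARD('n)"]
    by (metis, simp add: bij_betw_same_card card_length_sum_list add.commute)
qed

lemma polys_upto_iff: "p \<in> polys_upto k \<longleftrightarrow> Poly_Mapping.keys p \<subseteq> expo k"
  by (auto simp: polys_upto_def pdeg_def expo_def)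

lemma polys_upto_pdeg: "pdeg p \<le> k \<Longrightarrow> p \<in> polys_upto k"
  by (simp add: polys_upto_def)

lemma polys_upto_mono: "p \<in> polys_upto k \<Longrightarrow> k \<le> l \<Longrightarrow> p \<in> polys_upto l"
  by (simp add: polys_upto_def)

lemma polys_upto_pconst [simp]: "pconst c \<in> polys_upto k"
  by (auto simp: polys_upto_iff pconst_def expo_def)

lemma polys_upto_1 [simp]: "1 \<in> polys_upto k"
  by (auto simp: polys_upto_iff expo_def)

lemma polys_upto_0 [simp]: "0 \<in> polys_upto k"
  by (auto simp: polys_upto_iff expo_def)

lemma polys_upto_add: "p \<in> polys_upto k \<Longrightarrow> q \<in> polys_upto k \<Longrightarrow> p + q \<in> polys_upto k"
  unfolding polys_upto_iff using keys_add[of p q] by blast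

lemma polys_upto_mult:
  assumes "p \<in> polys_upto k" "q \<in> polys_upto l"
  shows "p * q \<in> polys_upto (k + l)"
  unfolding polys_upto_iff
proof
  fix \<gamma> assume "\<gamma> \<in> Poly_Mapping.keys (p * q)"
  then obtain \<alpha> \<beta> where "\<gamma> = \<alpha> + \<beta>" "\<alpha> \<in> Poly_Mapping.keys p" "\<beta> \<in> Poly_Mapping.keys q"
    using keys_mult[of p q] by blast
  then show "\<gamma> \<in> expo (k + l)"
    using assms by (auto simp: polys_upto_iff expo_def mdeg_add subset_iff intro: add_mono)
qed

lemma polys_upto_pscale: "p \<in> polys_upto k \<Longrightarrow> pscale c p \<in> polys_upto k"
  unfolding pscale_def using polys_upto_mult[of "pconst c" 0 p k] by simp

lemma polys_upto_diff: "p \<in> polys_upto k \<Longrightarrow> q \<in> polys_upto k \<Longrightarrow> p - q \<in> polys_upto k"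
  unfolding polys_upto_iff using keys_diff[of p q]
  by (auto simp: in_keys_iff lookup_minus subset_iff) metis

lemma polys_upto_sum: "(\<And>i. i \<in> I \<Longrightarrow> p i \<in> polys_upto k) \<Longrightarrow> (\<Sum>i\<in>I. p i) \<in> polys_upto k"
  by (induction I rule: infinite_finite_induct) (simp_all add: polys_upto_add)

lemma polys_upto_power: "p \<in> polys_upto k \<Longrightarrow> p ^ n \<in> polys_upto (n * k)"
proof (induction n)
  case (Suc n)
  then show ?case using polys_upto_mult[of p k "p ^ n" "n * k"] by simp
qed simp

lemma polys_upto_prod:
  "(\<And>i. i \<in> I \<Longrightarrow> p i \<in> polys_upto (k i)) \<Longrightarrow> (\<Prod>i\<in>I. p i) \<in> polys_upto (\<Sum>i\<in>I. k i)"
  by (induction I rule: infinite_finite_induct) (simp_all add: polys_upto_mult)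

lemma hpoly_degree:
  fixes g :: "'m::finite \<Rightarrow> 'n::finite mpoly"
  assumes "c \<in> expo_pairs d"
  shows "hpoly g c \<in> polys_upto (d * Max (range (\<lambda>j. pdeg (g j))))"
proof -
  obtain \<alpha> \<beta> where c: "c = (\<alpha>, \<beta>)" by fastforce
  let ?D = "Max (range (\<lambda>j. pdeg (g j)))"
  have "g j \<in> polys_upto ?D" for j
    by (auto intro!: polys_upto_pdeg Max_ge)
  then have "g j ^ \<alpha> j * (1 - g j) ^ \<beta> j \<in> polys_upto (\<alpha> j * ?D + \<beta> j * ?D)" for j
    by (intro polys_upto_mult polys_upto_power polys_upto_diff) auto
  then have "hpoly g c \<in> polys_upto (\<Sum>j\<in>UNIV. \<alpha> j * ?D + \<beta> j * ?D)"
    unfolding hpoly_def c by (auto intro: polys_upto_prod)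
  moreover have "(\<Sum>j\<in>UNIV. \<alpha> j * ?D + \<beta> j * ?D) = (sum \<alpha> UNIV + sum \<beta> UNIV) * ?D"
    by (simp add: sum.distrib sum_distrib_right distrib_right)
  ultimately show ?thesis
    using assms c by (auto simp: expo_pairs_def intro: polys_upto_mono mult_le_mono1)
qed

lemma finite_expo_pairs [simp]: "finite (expo_pairs d :: (('m::finite \<Rightarrow> nat) \<times> _) set)"
proof (rule finite_subset)
  show "expo_pairs d \<subseteq> (UNIV \<rightarrow>\<^sub>E {..d}) \<times> (UNIV \<rightarrow>\<^sub>E {..d} :: ('m \<Rightarrow> nat) set)"
  proof
    fix c :: "('m \<Rightarrow> nat) \<times> ('m \<Rightarrow> nat)" assume "c \<in> expo_pairs d"
    then obtain \<alpha> \<beta> where c: "c = (\<alpha>, \<beta>)" "sum \<alpha> UNIV + sum \<beta> UNIV \<le> d"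
      by (auto simp: expo_pairs_def)
    have "\<alpha> j \<le> sum \<alpha> UNIV" "\<beta> j \<le> sum \<beta> UNIV" for j
      by (auto intro: member_le_sum)
    then show "c \<in> (UNIV \<rightarrow>\<^sub>E {..d}) \<times> (UNIV \<rightarrow>\<^sub>E {..d})"
      using c by (auto simp: PiE_UNIV_domain) (meson add_leE order_trans)+
  qed
qed (auto intro!: finite_PiE)


section \<open>Zero sets of polynomials\<close>

lemma meval_exp:
  fixes w :: "real^'n::finite"
  shows "meval \<alpha> (\<chi> i. exp (t * w $ i)) = exp (t * (w \<bullet> (\<chi> i. real (lookup \<alpha> i))))"
  by (simp add: meval_def inner_vec_def exp_sum exp_of_nat_mult[symmetric] sum_distrib_left ac_simps)

text \<open>Along a curve \<open>t \<mapsto> (exp (t w\<^sub>1), \<dots>, exp (t w\<^sub>n))\<close> the monomials become exponentials; for a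
  generic direction \<open>w\<close> their rates differ, so the fastest of them dominates.\<close>

lemma peval_eq_0_imp_eq_0:
  fixes p :: "'n::finite mpoly"
  assumes "\<And>x. peval p x = 0"
  shows "p = 0"
proof (rule ccontr)
  assume "p \<noteq> 0"
  let ?A = "Poly_Mapping.keys p"
  let ?v = "\<lambda>\<alpha>. (\<chi> i. real (lookup \<alpha> i)) :: real^'n"
  let ?P = "{(\<alpha>, \<beta>) \<in> ?A \<times> ?A. \<alpha> \<noteq> \<beta>}"
  have inj: "?v \<alpha> \<noteq> ?v \<beta>" if "\<alpha> \<noteq> \<beta>" for \<alpha> \<beta>
    using that by (auto simp: vec_eq_iff intro: poly_mapping_eqI)
  have "negligible (\<Union>(\<alpha>, \<beta>)\<in>?P. {w. (?v \<alpha> - ?v \<beta>) \<bullet> w = 0})"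
  proof (rule negligible_Union)
    have "finite ?P"
      by (rule finite_subset[of _ "?A \<times> ?A"]) auto
    then show "finite ((\<lambda>(\<alpha>, \<beta>). {w. (?v \<alpha> - ?v \<beta>) \<bullet> w = 0}) ` ?P)" by simp
    fix S assume "S \<in> (\<lambda>(\<alpha>, \<beta>). {w. (?v \<alpha> - ?v \<beta>) \<bullet> w = 0}) ` ?P"
    then obtain \<alpha> \<beta> where "\<alpha> \<noteq> \<beta>" and S: "S = {w. (?v \<alpha> - ?v \<beta>) \<bullet> w = 0}" by auto
    then have "?v \<alpha> - ?v \<beta> \<noteq> 0" using inj by auto
    then show "negligible S" unfolding S by (intro negligible_hyperplane) auto
  qed
  then have "(\<Union>(\<alpha>, \<beta>)\<in>?P. {w. (?v \<alpha> - ?v \<beta>) \<bullet> w = 0}) \<noteq> UNIV"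
    using non_negligible_UNIV by metis
  then obtain w where w: "\<And>\<alpha> \<beta>. \<alpha> \<in> ?A \<Longrightarrow> \<beta> \<in> ?A \<Longrightarrow> \<alpha> \<noteq> \<beta> \<Longrightarrow> (?v \<alpha> - ?v \<beta>) \<bullet> w \<noteq> 0"
    by auto
  let ?r = "\<lambda>\<alpha>. w \<bullet> ?v \<alpha>"
  have "?A \<noteq> {}" using \<open>p \<noteq> 0\<close> by (metis poly_mapping_monomials sum.empty)
  then obtain \<mu> where \<mu>: "\<mu> \<in> ?A" "?r \<mu> = Max (?r ` ?A)"
    using Max_in[of "?r ` ?A"] by (auto simp del: Max_in)
  then have \<mu>_max: "?r \<alpha> \<le> ?r \<mu>" if "\<alpha> \<in> ?A" for \<alpha>
    using that by simp
  let ?h = "\<lambda>t. \<Sum>\<alpha>\<in>?A. lookup p \<alpha> * exp (t * (?r \<alpha> - ?r \<mu>))"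
  have "?h t = 0" for t
  proof -
    have "?h t = (\<Sum>\<alpha>\<in>?A. lookup p \<alpha> * exp (t * ?r \<alpha>)) * exp (- t * ?r \<mu>)"
      by (simp add: sum_distrib_right right_diff_distrib exp_diff exp_minus divide_inverse mult.assoc)
    also have "(\<Sum>\<alpha>\<in>?A. lookup p \<alpha> * exp (t * ?r \<alpha>)) = peval p (\<chi> i. exp (t * w $ i))"
      by (simp add: peval_def meval_exp)
    finally show ?thesis using assms by simp
  qed
  moreover have "(?h \<longlongrightarrow> (\<Sum>\<alpha>\<in>?A. lookup p \<alpha> * (if \<alpha> = \<mu> then 1 else 0))) at_top"
  proof (intro tendsto_sum tendsto_mult tendsto_const)
    fix \<alpha> assume \<alpha>: "\<alpha> \<in> ?A"
    show "((\<lambda>t. exp (t * (?r \<alpha> - ?r \<mu>))) \<longlongrightarrow> (if \<alpha> = \<mu> then 1 else 0)) at_top"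
    proof (cases "\<alpha> = \<mu>")
      case False
      with w[OF \<alpha> \<mu>(1)] \<mu>_max[OF \<alpha>] have "?r \<alpha> - ?r \<mu> < 0"
        by (auto simp: inner_diff_left inner_commute[of w])
      then have "((\<lambda>t. exp (t * (?r \<alpha> - ?r \<mu>))) \<longlongrightarrow> 0) at_top"
        by (intro filterlim_compose[OF exp_at_bot] filterlim_tendsto_neg_mult_at_bot[OF tendsto_const _ filterlim_ident, THEN filterlim_cong[THEN iffD1, rotated -1]])
           (auto simp: mult.commute)
      then show ?thesis using False by simp
    qed simp
  qed
  ultimately have "((\<lambda>t::real. 0) \<longlongrightarrow> lookup p \<mu>) at_top"
    using \<mu>(1) by (simp add: if_distrib cong: if_cong)
  then have "lookup p \<mu> = 0" by (simp add: tendsto_const_iff)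
  then show False using \<mu>(1) by (simp add: in_keys_iff)
qed

lemma peval_ext: "(\<And>x. peval p x = peval q x) \<Longrightarrow> p = q"
  using peval_eq_0_imp_eq_0[of "p - q"] by (simp add: peval_diff)

text \<open>In a direction \<open>u\<close> on which the leading form of \<open>p\<close> does not vanish, \<open>p\<close> restricted to any line
  has the same degree as \<open>p\<close>. Substituting \<open>t = 1/s\<close> turns this into a nonzero value at \<open>s = 0\<close>.\<close>

lemma finite_zeros_on_lines:
  fixes p :: "'n::finite mpoly"
  assumes "p \<noteq> 0"
  obtains u where "\<And>x. finite {t. peval p (x + t *\<^sub>R u) = 0}"
proof -
  let ?A = "Poly_Mapping.keys p"
  define D where "D = Max (mdeg ` ?A)"
  have ne: "?A \<noteq> {}" using \<open>p \<noteq> 0\<close> by (metis poly_mapping_monomials sum.empty)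
  have le: "mdeg \<alpha> \<le> D" if "\<alpha> \<in> ?A" for \<alpha>
    unfolding D_def using that by auto
  have "D \<in> mdeg ` ?A"
    unfolding D_def using ne by (intro Max_in) auto
  then obtain \<mu> where \<mu>: "\<mu> \<in> ?A" "mdeg \<mu> = D" by auto
  define q where "q = (\<Sum>\<alpha>\<in>{\<alpha>\<in>?A. mdeg \<alpha> = D}. Poly_Mapping.single \<alpha> (lookup p \<alpha>))"
  have "lookup q \<mu> = lookup p \<mu>"
    using \<mu> by (simp add: q_def lookup_sum lookup_single when_def)
  then have "q \<noteq> 0" using \<mu>(1) by (auto simp: in_keys_iff)
  then obtain u where u: "peval q u \<noteq> 0" using peval_eq_0_imp_eq_0 by blast
  have "finite {t. peval p (x + t *\<^sub>R u) = 0}" for x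
  proof -
    define R where "R = (\<Sum>\<alpha>\<in>?A. Polynomial.smult (lookup p \<alpha>)
        ([:0, 1:] ^ (D - mdeg \<alpha>) * (\<Prod>i\<in>UNIV. [:u $ i, x $ i:] ^ lookup \<alpha> i)))"
    have R: "poly R t = (\<Sum>\<alpha>\<in>?A. lookup p \<alpha> * (t ^ (D - mdeg \<alpha>) * (\<Prod>i\<in>UNIV. (u $ i + t * x $ i) ^ lookup \<alpha> i)))"
      for t by (simp add: R_def poly_sum poly_prod)
    have "poly R 0 = (\<Sum>\<alpha>\<in>?A. if mdeg \<alpha> = D then lookup p \<alpha> * meval \<alpha> u else 0)"
      unfolding R meval_def using le
      by (intro sum.cong) (auto simp: power_0_left le_antisym)
    also have "\<dots> = peval q u"
      by (simp add: q_def peval_sum peval_single sum.inter_filter[symmetric])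
    finally have "R \<noteq> 0" using u by auto
    have key: "peval p (x + t *\<^sub>R u) = t ^ D * poly R (1 / t)" if t: "t \<noteq> 0" for t
    proof -
      have "meval \<alpha> (x + t *\<^sub>R u)
          = t ^ D * ((1 / t) ^ (D - mdeg \<alpha>) * (\<Prod>i\<in>UNIV. (u $ i + (1 / t) * x $ i) ^ lookup \<alpha> i))"
        if "\<alpha> \<in> ?A" for \<alpha>
      proof -
        have "(x + t *\<^sub>R u) $ i = t * (u $ i + (1 / t) * x $ i)" for i
          using t by (simp add: field_simps)
        then have "meval \<alpha> (x + t *\<^sub>R u) = (\<Prod>i\<in>UNIV. (t * (u $ i + (1 / t) * x $ i)) ^ lookup \<alpha> i)"
          unfolding meval_def by simp
        also have "\<dots> = t ^ mdeg \<alpha> * (\<Prod>i\<in>UNIV. (u $ i + (1 / t) * x $ i) ^ lookup \<alpha> i)"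
          by (simp add: power_mult_distrib prod.distrib mdeg_def power_sum)
        also have "t ^ mdeg \<alpha> = t ^ D * (1 / t) ^ (D - mdeg \<alpha>)"
          using t le[OF that] by (simp add: power_diff power_one_over)
        finally show ?thesis by (simp add: mult.assoc)
      qed
      then show ?thesis
        unfolding R peval_def sum_distrib_left by (intro sum.cong) (auto simp: ac_simps)
    qed
    have "{t. peval p (x + t *\<^sub>R u) = 0} \<subseteq> insert 0 ((\<lambda>s. 1 / s) ` {s. poly R s = 0})"
    proof
      fix t assume "t \<in> {t. peval p (x + t *\<^sub>R u) = 0}"
      then have "t \<noteq> 0 \<Longrightarrow> poly R (1 / t) = 0" using key by auto
      then show "t \<in> insert 0 ((\<lambda>s. 1 / s) ` {s. poly R s = 0})"
        by (cases "t = 0") (auto intro!: image_eqI[of _ _ "1 / t"])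
    qed
    then show ?thesis
      using poly_roots_finite[OF \<open>R \<noteq> 0\<close>] finite_subset by blast
  qed
  then show ?thesis using that by blast
qed

text \<open>By Fubini, almost every translate \<open>x + t u\<close> avoids the zero set, and Lebesgue measure is
  translation invariant.\<close>

lemma AE_peval_nonzero:
  fixes p :: "'n::finite mpoly"
  assumes "p \<noteq> 0"
  shows "AE x in lborel. peval p x \<noteq> 0"
proof -
  obtain u where u: "\<And>x. finite {t. peval p (x + t *\<^sub>R u) = 0}"
    using finite_zeros_on_lines[OF assms] by blast
  have "AE t in lborel. peval p (x + t *\<^sub>R u) \<noteq> 0" for x
    using AE_not_in[OF finite_imp_null_set_lborel[OF u[of x]]] by simp
  then have "AE x in lborel. AE t in lborel. peval p (x + t *\<^sub>R u) \<noteq> 0" by simp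
  then have "AE t in lborel. AE x in lborel. peval p (x + t *\<^sub>R u) \<noteq> 0"
    by (subst (asm) lborel_pair.AE_commute) measurable
  then obtain t :: real where "AE x in lborel. peval p (x + t *\<^sub>R u) \<noteq> 0"
    using eventually_happens by (fastforce simp: ae_filter_eq_bot_iff)
  then have "AE x in distr lborel borel ((+) (t *\<^sub>R u)). peval p x \<noteq> 0"
    by (subst AE_distr_iff) (simp_all add: add.commute)
  then show ?thesis unfolding lborel_distr_plus .
qed


section \<open>Random points are unisolvent\<close>

text \<open>Fraction-free Gaussian elimination on functions: \<open>elim e X N i\<close> is a combination of
  \<open>e 0, \<dots>, e (N - 1), e i\<close> that vanishes at the first \<open>N\<close> points. Its value \<open>elim e X N N (X N)\<close> is
  the next pivot. Unlike unisolvence itself, nonvanishing of the pivots is visibly a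
  measurable condition on \<open>X\<close>.\<close>

fun elim :: "(nat \<Rightarrow> 'a \<Rightarrow> real) \<Rightarrow> (nat \<Rightarrow> 'a) \<Rightarrow> nat \<Rightarrow> nat \<Rightarrow> 'a \<Rightarrow> real" where
  "elim e X 0 i = e i"
| "elim e X (Suc N) i = (\<lambda>x. elim e X N i x * elim e X N N (X N) - elim e X N i (X N) * elim e X N N x)"

definition pivots_nonzero :: "(nat \<Rightarrow> 'a \<Rightarrow> real) \<Rightarrow> nat \<Rightarrow> (nat \<Rightarrow> 'a) \<Rightarrow> bool" where
  "pivots_nonzero e N X \<longleftrightarrow> (\<forall>p<N. elim e X p p (X p) \<noteq> 0)"

lemma elim_cong: "(\<And>q. q < N \<Longrightarrow> X q = Y q) \<Longrightarrow> elim e X N i = elim e Y N i"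
  by (induction N arbitrary: i) simp_all

lemma elim_vanishes: "p < N \<Longrightarrow> elim e X N i (X p) = 0"
  by (induction N arbitrary: i) (auto simp: less_Suc_eq)

lemma elim_expansion:
  "N \<le> i \<Longrightarrow> \<exists>c. \<forall>x. elim e X N i x = (\<Sum>j<N. c j * e j x) + (\<Prod>m<N. elim e X m m (X m)) * e i x"
proof (induction N arbitrary: i)
  case 0
  then show ?case by simp
next
  case (Suc N)
  let ?D = "\<Prod>m<N. elim e X m m (X m)"
  obtain c where c: "\<And>x. elim e X N i x = (\<Sum>j<N. c j * e j x) + ?D * e i x"
    using Suc.IH[of i] Suc.prems by (meson Suc_leD)
  obtain b where b: "\<And>x. elim e X N N x = (\<Sum>j<N. b j * e j x) + ?D * e N x"
    using Suc.IH[of N] by blast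
  define P where "P = elim e X N N (X N)"
  define a where "a = elim e X N i (X N)"
  define c' where "c' j = (if j < N then c j * P - a * b j else - a * ?D)" for j
  have "elim e X (Suc N) i x = (\<Sum>j<Suc N. c' j * e j x) + (?D * P) * e i x" for x
  proof -
    have "(\<Sum>j<N. c' j * e j x) = (\<Sum>j<N. (c j * e j x) * P - a * (b j * e j x))"
      by (intro sum.cong) (auto simp: c'_def algebra_simps)
    then have sum: "(\<Sum>j<N. c' j * e j x) = (\<Sum>j<N. c j * e j x) * P - a * (\<Sum>j<N. b j * e j x)"
      by (simp add: sum_subtractf sum_distrib_left sum_distrib_right)
    have "elim e X (Suc N) i x = elim e X N i x * P - a * elim e X N N x"
      by (simp add: P_def a_def)
    also have "\<dots> = ((\<Sum>j<N. c j * e j x) + ?D * e i x) * P - a * ((\<Sum>j<N. b j * e j x) + ?D * e N x)"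
      by (simp only: c b)
    also have "\<dots> = ((\<Sum>j<N. c' j * e j x) + - a * ?D * e N x) + (?D * P) * e i x"
      unfolding sum by algebra
    also have "(\<Sum>j<N. c' j * e j x) + - a * ?D * e N x = (\<Sum>j<Suc N. c' j * e j x)"
      by (simp add: c'_def)
    finally show ?thesis .
  qed
  note expansion = this
  have prod: "(\<Prod>m<Suc N. elim e X m m (X m)) = ?D * P"
    unfolding prod.lessThan_Suc P_def ..
  show ?case
    unfolding prod by (rule exI[of _ c'], rule allI, rule expansion)
qed

lemma pivots_nonzero_unisolvent:
  assumes "pivots_nonzero e N X" "\<And>p. p < N \<Longrightarrow> (\<Sum>i<N. c i * e i (X p)) = 0" "i < N"
  shows "c i = 0"
  using assms
proof (induction N arbitrary: c i)
  case (Suc N)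
  let ?D = "\<Prod>m<N. elim e X m m (X m)"
  have piv: "pivots_nonzero e N X" "elim e X N N (X N) \<noteq> 0" and D: "?D \<noteq> 0"
    using Suc.prems(1) by (auto simp: pivots_nonzero_def)
  obtain b where b: "\<And>x. elim e X N N x = (\<Sum>j<N. b j * e j x) + ?D * e N x"
    using elim_expansion[of N N e X] by blast
  have comb: "(\<Sum>j<N. (?D * c j - c N * b j) * e j x)
      = ?D * (\<Sum>j<Suc N. c j * e j x) - c N * elim e X N N x" for x
  proof -
    have "(\<Sum>j<N. (?D * c j - c N * b j) * e j x)
        = (\<Sum>j<N. ?D * (c j * e j x) - c N * (b j * e j x))"
      by (simp add: algebra_simps)
    then show ?thesis
      by (simp add: b sum_subtractf sum_distrib_left[symmetric]) (simp add: algebra_simps)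
  qed
  have small: "?D * c j - c N * b j = 0" if "j < N" for j
    using that
  proof (rule Suc.IH[OF piv(1), rotated])
    fix p assume "p < N"
    then show "(\<Sum>j<N. (?D * c j - c N * b j) * e j (X p)) = 0"
      unfolding comb using Suc.prems(2)[of p] elim_vanishes[of p N e X N] by (simp del: sum.lessThan_Suc)
  qed
  have "c N * elim e X N N (X N) = 0"
    using comb[of "X N"] Suc.prems(2)[of N] small by (simp del: sum.lessThan_Suc)
  then have "c N = 0" using piv by simp
  moreover have "c j = 0" if "j < N" for j
    using small[OF that] \<open>c N = 0\<close> D by simp
  ultimately show ?case using Suc.prems(3) by (auto simp: less_Suc_eq)
qed simp

lemma measurable_elim:
  assumes e: "\<And>i. e i \<in> borel_measurable M"
    and "{..<N} \<subseteq> I" "h \<in> measurable (PiM I (\<lambda>_. M)) M"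
  shows "(\<lambda>X. elim e X N i (h X)) \<in> borel_measurable (PiM I (\<lambda>_. M))"
  using assms(2,3)
proof (induction N arbitrary: i h)
  case 0
  show ?case unfolding elim.simps by (rule measurable_compose[OF 0(2) e])
next
  case (Suc N)
  have N: "(\<lambda>X. X N) \<in> measurable (PiM I (\<lambda>_. M)) M"
    using Suc.prems(1) by (intro measurable_component_singleton) auto
  have "{..<N} \<subseteq> I" using Suc.prems(1) by auto
  note IH = Suc.IH[OF this]
  show ?case
    unfolding elim.simps
    by (intro borel_measurable_diff borel_measurable_times IH[OF N] IH[OF Suc.prems(2)])
qed

lemma pivots_nonzero_Suc:
  "pivots_nonzero e (Suc N) X \<longleftrightarrow> pivots_nonzero e N X \<and> elim e X N N (X N) \<noteq> 0"
  by (auto simp: pivots_nonzero_def less_Suc_eq)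

lemma pivots_nonzero_upd [simp]: "pivots_nonzero e N (X(N := x)) \<longleftrightarrow> pivots_nonzero e N X"
proof -
  have "elim e (X(N := x)) p p (X p) = elim e X p p (X p)" if "p < N" for p
    by (rule fun_cong[OF elim_cong]) (use that in auto)
  then show ?thesis by (auto simp: pivots_nonzero_def)
qed

lemma measurable_pivots_nonzero:
  assumes "\<And>i. e i \<in> borel_measurable M" "{..<N} \<subseteq> I"
  shows "Measurable.pred (PiM I (\<lambda>_. M)) (pivots_nonzero e N)"
proof -
  have "Measurable.pred (PiM I (\<lambda>_. M)) (\<lambda>X. \<forall>p\<in>{..<N}. elim e X p p (X p) \<noteq> 0)"
  proof (rule pred_intros_finite)
    fix p assume p: "p \<in> {..<N}"
    have "(\<lambda>X. X p) \<in> measurable (PiM I (\<lambda>_. M)) M"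
      using assms(2) p by (intro measurable_component_singleton) auto
    then have [measurable]: "(\<lambda>X. elim e X p p (X p)) \<in> borel_measurable (PiM I (\<lambda>_. M))"
      using assms p by (intro measurable_elim[where h = "\<lambda>X. X p"]) auto
    show "Measurable.pred (PiM I (\<lambda>_. M)) (\<lambda>X. elim e X p p (X p) \<noteq> 0)" by measurable
  qed simp
  then show ?thesis unfolding pivots_nonzero_def[abs_def] Ball_def lessThan_iff .
qed

text \<open>Given points with nonzero pivots, the next pivot is a nontrivial combination of the \<open>e j\<close>
  evaluated at an independent new point.\<close>

lemma (in prob_space) AE_pivots_nonzero:
  assumes e: "\<And>i. e i \<in> borel_measurable M"
    and gen: "\<And>c. \<exists>i<L. c i \<noteq> 0 \<Longrightarrow> AE x in M. (\<Sum>i<L. c i * e i x) \<noteq> 0"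
    and "N \<le> L"
  shows "AE X in PiM {..<N} (\<lambda>_. M). pivots_nonzero e N X"
  using \<open>N \<le> L\<close>
proof (induction N)
  case 0
  then show ?case by (simp add: pivots_nonzero_def)
next
  case (Suc N)
  let ?P = "PiM {..<N} (\<lambda>_. M)" and ?S = "PiM {..<Suc N} (\<lambda>_. M)"
  interpret P: prob_space ?P by (intro prob_space_PiM prob_space_axioms)
  interpret PP: pair_prob_space M ?P by unfold_locales
  have distr: "distr (M \<Otimes>\<^sub>M ?P) ?S (\<lambda>z. (snd z)(N := fst z)) = ?S"
    using distr_pair_PiM_eq_PiM[of "{..<N}" "\<lambda>_. M" N] prob_space_axioms
    by (simp add: lessThan_Suc case_prod_beta')
  let ?u = "\<lambda>z. (snd z)(N := fst z)" and ?Q = "pivots_nonzero e (Suc N)"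
  have upd: "?u \<in> measurable (M \<Otimes>\<^sub>M ?P) ?S"
    by (rule measurable_fun_upd[of _ "{..<N}"]) auto
  have meas: "Measurable.pred ?S ?Q"
    by (intro measurable_pivots_nonzero e) auto
  have meas2: "{z \<in> space (M \<Otimes>\<^sub>M ?P). ?Q (?u z)} \<in> sets (M \<Otimes>\<^sub>M ?P)"
    using measurable_compose[OF upd meas] unfolding pred_def .
  have "AE X in ?P. AE x in M. pivots_nonzero e (Suc N) (X(N := x))"
  proof (rule AE_mp[OF Suc.IH AE_I2], use Suc.prems in simp, intro impI)
    fix X assume X: "pivots_nonzero e N X"
    let ?D = "\<Prod>m<N. elim e X m m (X m)"
    obtain b where b: "\<And>x. elim e X N N x = (\<Sum>j<N. b j * e j x) + ?D * e N x"
      using elim_expansion[of N N e X] by blast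
    let ?c = "\<lambda>j. if j < N then b j else if j = N then ?D else 0"
    have "?D \<noteq> 0" using X by (auto simp: pivots_nonzero_def)
    then have "AE x in M. (\<Sum>j<L. ?c j * e j x) \<noteq> 0"
      using Suc.prems by (intro gen) (auto intro!: exI[of _ N])
    moreover have "(\<Sum>j<L. ?c j * e j x) = elim e X N N x" for x
    proof -
      have "(\<Sum>j<L. ?c j * e j x) = (\<Sum>j<Suc N. ?c j * e j x)"
        using Suc.prems by (intro sum.mono_neutral_right) auto
      then show ?thesis by (simp add: b)
    qed
    moreover have "elim e (X(N := x)) N N = elim e X N N" for x
      by (rule elim_cong) simp
    ultimately show "AE x in M. pivots_nonzero e (Suc N) (X(N := x))"
      using X by (simp add: pivots_nonzero_Suc)
  qed
  then have "AE x in M. AE X in ?P. ?Q (X(N := x))"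
    using PP.AE_commute[OF meas2] by blast
  then have "AE z in M \<Otimes>\<^sub>M ?P. ?Q (?u z)"
    using PP.AE_pair_measure[OF meas2] by simp
  then have "AE X in distr (M \<Otimes>\<^sub>M ?P) ?S ?u. ?Q X"
    using AE_distr_iff[OF upd meas[unfolded pred_def]] by blast
  then show ?case by (simp only: distr)
qed

text \<open>The number of points is the dimension of the space of polynomials of degree at most \<open>k\<close>, the least
  number that can determine them.\<close>

definition unisolvent :: "nat \<Rightarrow> (nat \<Rightarrow> real^'n::finite) \<Rightarrow> bool" where
  "unisolvent k X \<longleftrightarrow>
     (\<forall>p\<in>polys_upto k. (\<forall>i<sdim CARD('n) k. peval p (X i) = 0) \<longrightarrow> p = 0)"

text \<open>In terms of the monomial basis, a nontrivial combination is a nonzero polynomial, which vanishes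
  only on a null set.\<close>

lemma AE_unisolvent:
  fixes S :: "(real^'n::finite) set"
  assumes S: "S \<in> sets borel" "emeasure lborel S \<noteq> 0" "emeasure lborel S \<noteq> \<infinity>"
  shows "AE X in PiM {..<sdim CARD('n) k} (\<lambda>_. uniform_measure lborel S). unisolvent k X"
proof -
  let ?L = "sdim CARD('n) k" and ?M = "uniform_measure lborel S"
  interpret prob_space ?M by (rule prob_space_uniform_measure[OF S(2,3)])
  have "card (expo k :: ('n \<Rightarrow>\<^sub>0 nat) set) = ?L"
    by (simp add: card_expo sdim_def binomial_symmetric[of "CARD('n)"])
  then obtain \<epsilon> :: "nat \<Rightarrow> 'n \<Rightarrow>\<^sub>0 nat" where \<epsilon>: "bij_betw \<epsilon> {..<?L} (expo k)"
    using ex_bij_betw_nat_finite[OF finite_expo[of k]] by (metis atLeast0LessThan)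
  have rep: "peval p x = (\<Sum>i<?L. lookup p (\<epsilon> i) * meval (\<epsilon> i) x)" if "p \<in> polys_upto k" for p x
    using that sum.reindex_bij_betw[OF \<epsilon>, of "\<lambda>\<alpha>. lookup p \<alpha> * meval \<alpha> x"]
    by (simp add: peval_superset[OF finite_expo] polys_upto_iff)
  have "AE X in PiM {..<?L} (\<lambda>_. ?M). pivots_nonzero (\<lambda>i. meval (\<epsilon> i)) ?L X"
  proof (rule AE_pivots_nonzero[OF _ _ order_refl])
    fix i
    have "meval (\<epsilon> i) \<in> borel_measurable borel"
      by (intro borel_measurable_continuous_onI continuous_intros)
    then show "meval (\<epsilon> i) \<in> borel_measurable ?M" by (simp add: measurable_def)
  next
    fix c :: "nat \<Rightarrow> real" assume "\<exists>i<?L. c i \<noteq> 0"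
    then obtain j where j: "j < ?L" "c j \<noteq> 0" by blast
    define p where "p = (\<Sum>i<?L. Poly_Mapping.single (\<epsilon> i) (c i))"
    have "lookup p (\<epsilon> j) = (\<Sum>i<?L. if i = j then c j else 0)"
      unfolding p_def lookup_sum using bij_betw_imp_inj_on[OF \<epsilon>] j
      by (intro sum.cong) (auto simp: lookup_single when_def inj_on_def)
    then have "p \<noteq> 0" using j by auto
    then have "AE x in ?M. peval p x \<noteq> 0"
      using AE_peval_nonzero[of p] S by (intro AE_uniform_measureI) auto
    then show "AE x in ?M. (\<Sum>i<?L. c i * meval (\<epsilon> i) x) \<noteq> 0"
      by (simp add: p_def peval_sum peval_single)
  qed
  then show ?thesis
  proof (rule AE_mp, intro AE_I2 impI)
    fix X assume piv: "pivots_nonzero (\<lambda>i. meval (\<epsilon> i)) ?L X"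
    show "unisolvent k X"
      unfolding unisolvent_def
    proof (intro ballI impI)
      fix p :: "'n mpoly" assume p: "p \<in> polys_upto k" and van: "\<forall>i<?L. peval p (X i) = 0"
      have "lookup p (\<epsilon> i) = 0" if "i < ?L" for i
        by (rule pivots_nonzero_unisolvent[where c = "\<lambda>i. lookup p (\<epsilon> i)", OF piv _ that])
          (use van rep[OF p] in simp)
      then have "lookup p \<alpha> = 0" if "\<alpha> \<in> expo k" for \<alpha>
        using that \<epsilon> by (metis bij_betw_imp_surj_on imageE lessThan_iff)
      then show "p = 0"
        using p by (intro poly_mapping_eqI) (auto simp: polys_upto_iff in_keys_iff subset_iff)
    qed
  qed
qed

lemma sum_fun_apply: "(\<Sum>i\<in>I. F i) x = (\<Sum>i\<in>I. F i x :: real)"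
  by (induction I rule: infinite_finite_induct) simp_all

text \<open>The evaluations at \<open>L\<close> unisolvent points form an injective map between spaces of the same
  dimension \<open>L\<close>, so Lagrange polynomials exist.\<close>

lemma unisolvent_interpolation:
  fixes X :: "nat \<Rightarrow> real^'n::finite"
  assumes uni: "unisolvent k X"
  obtains l where "\<And>i. i < sdim CARD('n) k \<Longrightarrow> l i \<in> polys_upto k"
    and "\<And>q x. q \<in> polys_upto k \<Longrightarrow> peval q x = (\<Sum>i<sdim CARD('n) k. peval (l i) x * peval q (X i))"
proof -
  let ?L = "sdim CARD('n) k"
  define ev where "ev p = (\<lambda>i. if i < ?L then peval p (X i) else 0)" for p
  define \<delta> where "\<delta> i = (\<lambda>j. if j = i then 1 else 0 :: real)" for i :: nat
  have lin: "Vector_Spaces.linear pscale fscale ev"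
    by (unfold_locales) (auto simp: ev_def peval_simps fscale_def)
  interpret ev: Vector_Spaces.linear pscale fscale ev by (rule lin)
  have inj: "p = q" if "p \<in> polys_upto k" "q \<in> polys_upto k" "ev p = ev q" for p q
  proof -
    have "\<forall>i<?L. peval (p - q) (X i) = 0"
      using that(3) by (auto simp: ev_def peval_diff fun_eq_iff) metis
    then have "p - q = 0"
      using uni polys_upto_diff[OF that(1,2)] by (auto simp: unisolvent_def)
    then show ?thesis by simp
  qed
  let ?m = "\<lambda>\<alpha>. Poly_Mapping.single \<alpha> 1 :: 'n mpoly"
  have comb: "(\<Sum>\<alpha>\<in>expo k. pscale (c \<alpha>) (?m \<alpha>)) \<in> polys_upto k" for c
    by (intro polys_upto_sum polys_upto_pscale) (auto simp: polys_upto_iff)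
  have lkcomb: "lookup (\<Sum>\<alpha>\<in>expo k. pscale (c \<alpha>) (?m \<alpha>)) \<beta> = c \<beta>" if "\<beta> \<in> expo k" for c and \<beta> :: "'n \<Rightarrow>\<^sub>0 nat"
    using that by (simp add: lookup_sum lookup_pscale lookup_single when_def if_distrib cong: if_cong)
  let ?E = "ev ` ?m ` expo k"
  have injm: "inj_on (ev \<circ> ?m) (expo k)"
  proof (rule inj_onI)
    fix \<alpha> \<beta> :: "'n \<Rightarrow>\<^sub>0 nat" assume "\<alpha> \<in> expo k" "\<beta> \<in> expo k" "(ev \<circ> ?m) \<alpha> = (ev \<circ> ?m) \<beta>"
    then have "?m \<alpha> = ?m \<beta>" by (intro inj) (auto simp: polys_upto_iff)
    then show "\<alpha> = \<beta>" by (metis lookup_single_eq lookup_single_not_eq zero_neq_one)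
  qed
  have cardE: "card ?E = ?L"
    using card_image[OF injm] by (simp add: image_image card_expo sdim_def binomial_symmetric[of "CARD('n)"])
  have indE: "fun_vs.independent ?E"
  proof (rule fun_vs.independent_if_scalars_zero)
    fix h w assume h: "(\<Sum>x\<in>?E. fscale (h x) x) = 0" and "w \<in> ?E"
    then obtain \<beta> where \<beta>: "\<beta> \<in> expo k" "w = ev (?m \<beta>)" by auto
    let ?p = "\<Sum>\<alpha>\<in>expo k. pscale (h (ev (?m \<alpha>))) (?m \<alpha>)"
    have "ev ?p = (\<Sum>x\<in>?E. fscale (h x) x)"
      unfolding image_image using injm
      by (subst sum.reindex) (auto simp: ev.sum ev.scale o_def)
    then have "ev ?p = ev 0" using h ev.zero by simp
    then have "?p = 0" by (intro inj comb) auto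
    then have "lookup ?p \<beta> = 0" by simp
    then show "h w = 0" using lkcomb[OF \<beta>(1), of "\<lambda>\<alpha>. h (ev (?m \<alpha>))"] \<beta>(2) by simp
  qed simp
  have subE: "?E \<subseteq> fun_vs.span (\<delta> ` {..<?L})" 
  proof -
    have "ev p = (\<Sum>i<?L. fscale (peval p (X i)) (\<delta> i))" for p
      by (rule ext) (simp add: ev_def \<delta>_def fscale_def if_distrib sum_fun_apply cong: if_cong)
    moreover have "(\<Sum>i<?L. fscale (c i) (\<delta> i)) \<in> fun_vs.span (\<delta> ` {..<?L})" for c
      by (intro fun_vs.span_sum fun_vs.span_scale) (auto intro: fun_vs.span_base)
    ultimately show ?thesis by auto
  qed
  have "\<exists>p\<in>polys_upto k. ev p = \<delta> i" if "i < ?L" for i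
  proof -
    have "\<delta> i \<in> fun_vs.span ?E"
    proof (rule ccontr)
      assume notin: "\<delta> i \<notin> fun_vs.span ?E"
      then have "fun_vs.independent (insert (\<delta> i) ?E)"
        using indE by (simp add: fun_vs.independent_insert)
      moreover have "insert (\<delta> i) ?E \<subseteq> fun_vs.span (\<delta> ` {..<?L})"
        using subE that by (auto intro: fun_vs.span_base)
      ultimately have "card (insert (\<delta> i) ?E) \<le> card (\<delta> ` {..<?L})"
        using fun_vs.independent_span_bound[of "\<delta> ` {..<?L}"] by blast
      also have "\<dots> \<le> ?L" using card_image_le[of "{..<?L}" \<delta>] by simp
      finally show False
        using notin cardE fun_vs.span_superset[of ?E] by (subst (asm) card_insert_disjoint) auto
    qed
    then have "\<delta> i \<in> ev ` poly_vs.span (?m ` expo k)"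
      by (simp add: ev.span_image)
    then obtain p where p: "p \<in> poly_vs.span (?m ` expo k)" "ev p = \<delta> i" by auto
    have "poly_vs.span (?m ` expo k) \<subseteq> polys_upto k"
      by (intro poly_vs.span_minimal poly_vs.subspaceI)
        (auto simp: polys_upto_iff[of "Poly_Mapping.single _ _"] intro: polys_upto_add polys_upto_pscale)
    then show ?thesis using p by blast
  qed
  then obtain l where l: "\<And>i. i < ?L \<Longrightarrow> l i \<in> polys_upto k" "\<And>i. i < ?L \<Longrightarrow> ev (l i) = \<delta> i"
    by metis
  show thesis
  proof
    fix q :: "'n mpoly" and x assume q: "q \<in> polys_upto k"
    let ?q = "\<Sum>i<?L. pscale (peval q (X i)) (l i)"
    have "ev ?q = (\<Sum>i<?L. fscale (peval q (X i)) (\<delta> i))"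
      using l(2) by (simp add: ev.sum ev.scale)
    also have "\<dots> = ev q"
      by (rule ext) (simp add: ev_def \<delta>_def fscale_def if_distrib sum_fun_apply cong: if_cong)
    finally have "?q = q"
      using q l(1) by (intro inj polys_upto_sum polys_upto_pscale) auto
    then have "peval q x = peval ?q x" by simp
    then show "peval q x = (\<Sum>i<?L. peval (l i) x * peval q (X i))"
      by (simp add: peval_simps mult.commute)
  qed (rule l(1))
qed


section \<open>The primal programs\<close>

lemma peval_trace_prod_poly:
  "peval (trace_prod_poly I Q (\<lambda>i j. v i * v j)) x = trace_prod I Q (\<lambda>i j. peval (v i) x * peval (v j) x)"
  by (simp add: trace_prod_poly_def trace_prod_def peval_simps)

text \<open>Polynomials are determined by their values, so the identity defining the program \<open>A\<close> can be
  read pointwise.\<close>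

lemma A_feasible_iff:
  fixes f :: "'n::finite mpoly"
  shows "A_feasible f g v k d (t, \<Lambda>, Q) \<longleftrightarrow>
     (\<forall>c\<in>expo_pairs d. 0 \<le> \<Lambda> c) \<and> psd_on {..<sdim CARD('n) k} Q \<and>
     (\<forall>x. peval f x = t + (\<Sum>c\<in>expo_pairs d. \<Lambda> c * peval (hpoly g c) x)
          + trace_prod {..<sdim CARD('n) k} Q (\<lambda>i j. peval (v i) x * peval (v j) x))"
proof -
  have "p = q \<longleftrightarrow> (\<forall>x. peval p x = peval q x)" for p q :: "'n mpoly"
    using peval_ext by blast
  then show ?thesis
    by (simp add: A_feasible_def peval_trace_prod_poly)
      (auto simp: peval_simps algebra_simps)
qed

lemma basis_vec_degree:
  fixes v :: "nat \<Rightarrow> 'n::finite mpoly"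
  assumes "basis_vec k v" "i < sdim CARD('n) k"
  shows "v i \<in> polys_upto k"
  using assms poly_vs.span_base[of "v i" "v ` {..<sdim CARD('n) k}"] by (auto simp: basis_vec_def)

lemma basis_vec_coords:
  fixes v :: "nat \<Rightarrow> 'n::finite mpoly"
  assumes "basis_vec k v" "p \<in> polys_upto k"
  obtains b where "p = (\<Sum>i<sdim CARD('n) k. pscale (b i) (v i))"
proof -
  let ?I = "{..<sdim CARD('n) k}"
  have "p \<in> range (\<lambda>u. \<Sum>w\<in>v ` ?I. pscale (u w) w)"
    using assms poly_vs.span_finite[of "v ` ?I"] by (simp add: basis_vec_def)
  then obtain u where "p = (\<Sum>w\<in>v ` ?I. pscale (u w) w)" by blast
  then have "p = (\<Sum>i\<in>?I. pscale (u (v i)) (v i))"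
    using assms by (simp add: basis_vec_def sum.reindex)
  then show thesis using that[of "\<lambda>i. u (v i)"] by simp
qed

lemma basis_vec_independent:
  fixes v :: "nat \<Rightarrow> 'n::finite mpoly"
  assumes v: "basis_vec k v" and 0: "(\<Sum>i<sdim CARD('n) k. pscale (c i) (v i)) = 0"
    and i: "i < sdim CARD('n) k"
  shows "c i = 0"
proof -
  let ?I = "{..<sdim CARD('n) k}"
  let ?u = "\<lambda>w. c (inv_into ?I v w)"
  have inj: "inj_on v ?I" and ind: "poly_vs.independent (v ` ?I)"
    using v by (auto simp: basis_vec_def)
  have "(\<Sum>w\<in>v ` ?I. pscale (?u w) w) = (\<Sum>i\<in>?I. pscale (c i) (v i))"
    using inj by (simp add: sum.reindex)
  then have "?u (v i) = 0"
    using poly_vs.independentD[OF ind, of "v ` ?I" ?u "v i"] 0 i by simp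
  then show ?thesis using inj i by simp
qed

lemma npts_eq_sdim: "npts (f :: 'n::finite mpoly) g k d = sdim CARD('n) (tau f g k d)"
  by (simp add: npts_def sdim_def binomial_symmetric[of "CARD('n)"])

lemma tau_bounds:
  "pdeg f \<le> tau f g k d" "2 * k \<le> tau f g k d" "d * Max (range (\<lambda>j. pdeg (g j))) \<le> tau f g k d"
  by (simp_all add: tau_def)

lemma hpoly_degree_tau: "c \<in> expo_pairs d \<Longrightarrow> hpoly g c \<in> polys_upto (tau f g k d)"
  by (rule polys_upto_mono[OF hpoly_degree tau_bounds(3)])

text \<open>Both sides of the constraint of the program \<open>B\<close> have degree at most \<open>\<tau>\<close>, and unisolvent points
  make agreement there an identity.\<close>

lemma B_feasible_iff_A_feasible:
  fixes f :: "'n::finite mpoly"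
  assumes X: "unisolvent (tau f g k d) X" and v: "basis_vec k v"
  shows "B_feasible f g v k d X = A_feasible f g v k d"
proof (rule ext, clarify)
  fix t \<Lambda> Q
  let ?I = "{..<sdim CARD('n) k}" and ?\<tau> = "tau f g k d"
  define p where "p = f - pconst t - (\<Sum>c\<in>expo_pairs d. pscale (\<Lambda> c) (hpoly g c))
      - trace_prod_poly ?I Q (\<lambda>i j. v i * v j)"
  have pe: "peval p x = peval f x - (t + (\<Sum>c\<in>expo_pairs d. \<Lambda> c * peval (hpoly g c) x)
          + trace_prod ?I Q (\<lambda>i j. peval (v i) x * peval (v j) x))" for x
    by (simp add: p_def peval_simps peval_trace_prod_poly)
  have "v i * v j \<in> polys_upto ?\<tau>" if "i \<in> ?I" "j \<in> ?I" for i j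
    using polys_upto_mult[of "v i" k "v j" k] basis_vec_degree[OF v] that
    by (intro polys_upto_mono[OF _ tau_bounds(2)]) (auto simp: mult_2)
  then have "p \<in> polys_upto ?\<tau>"
    unfolding p_def trace_prod_poly_def
    by (intro polys_upto_diff polys_upto_sum polys_upto_pscale hpoly_degree_tau
        polys_upto_pconst polys_upto_pdeg[OF tau_bounds(1)]) auto
  then have "(\<forall>i<npts f g k d. peval p (X i) = 0) \<longleftrightarrow> (\<forall>x. peval p x = 0)"
    using X by (auto simp: unisolvent_def npts_eq_sdim)
  then show "B_feasible f g v k d X (t, \<Lambda>, Q) = A_feasible f g v k d (t, \<Lambda>, Q)"
    unfolding A_feasible_iff B_feasible_def pe by auto
qed


section \<open>Feasibility for large degree\<close>

definition krivine_cone :: "('m::finite \<Rightarrow> 'n mpoly) \<Rightarrow> nat \<Rightarrow> 'n mpoly set" where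
  "krivine_cone g d =
     {(\<Sum>c\<in>expo_pairs d. pscale (\<Lambda> c) (hpoly g c)) | \<Lambda>. \<forall>c\<in>expo_pairs d. 0 \<le> \<Lambda> c}"

lemma krivine_cone_mono:
  assumes "d \<le> d'" shows "krivine_cone g d \<subseteq> krivine_cone g d'"
proof
  fix p assume "p \<in> krivine_cone g d"
  then obtain \<Lambda> where p: "p = (\<Sum>c\<in>expo_pairs d. pscale (\<Lambda> c) (hpoly g c))"
    and nn: "\<forall>c\<in>expo_pairs d. 0 \<le> \<Lambda> c"
    by (auto simp: krivine_cone_def)
  let ?\<Lambda> = "\<lambda>c. if c \<in> expo_pairs d then \<Lambda> c else 0"
  have "p = (\<Sum>c\<in>expo_pairs d'. pscale (?\<Lambda> c) (hpoly g c))"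
    unfolding p using assms
    by (intro sum.mono_neutral_cong_left finite_expo_pairs) (auto simp: expo_pairs_def)
  then show "p \<in> krivine_cone g d'"
    using nn by (auto simp: krivine_cone_def)
qed

lemma krivine_cone_add:
  assumes "p \<in> krivine_cone g d" "q \<in> krivine_cone g d"
  shows "p + q \<in> krivine_cone g d"
proof -
  obtain \<Lambda> \<Gamma> where "p = (\<Sum>c\<in>expo_pairs d. pscale (\<Lambda> c) (hpoly g c))"
    "q = (\<Sum>c\<in>expo_pairs d. pscale (\<Gamma> c) (hpoly g c))"
    "\<forall>c\<in>expo_pairs d. 0 \<le> \<Lambda> c" "\<forall>c\<in>expo_pairs d. 0 \<le> \<Gamma> c"
    using assms by (auto simp: krivine_cone_def)
  then show ?thesis
    unfolding krivine_cone_def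
    by (intro CollectI exI[of _ "\<lambda>c. \<Lambda> c + \<Gamma> c"])
      (simp add: poly_vs.scale_left_distrib sum.distrib)
qed

lemma krivine_cone_scale:
  assumes "p \<in> krivine_cone g d" "0 \<le> a"
  shows "pscale a p \<in> krivine_cone g d"
proof -
  obtain \<Lambda> where "p = (\<Sum>c\<in>expo_pairs d. pscale (\<Lambda> c) (hpoly g c))" "\<forall>c\<in>expo_pairs d. 0 \<le> \<Lambda> c"
    using assms by (auto simp: krivine_cone_def)
  then show ?thesis
    using assms(2) unfolding krivine_cone_def
    by (intro CollectI exI[of _ "\<lambda>c. a * \<Lambda> c"]) (simp add: poly_vs.scale_sum_right)
qed

lemma hpoly_in_krivine_cone:
  assumes "c \<in> expo_pairs d" shows "hpoly g c \<in> krivine_cone g d"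
  unfolding krivine_cone_def
proof (intro CollectI exI[of _ "\<lambda>c'. if c' = c then 1 else 0"] conjI ballI)
  have "(\<Sum>c'\<in>expo_pairs d. pscale (if c' = c then 1 else 0) (hpoly g c'))
      = (\<Sum>c'\<in>expo_pairs d. if c' = c then hpoly g c else 0)"
    by (intro sum.cong) auto
  then show "hpoly g c = (\<Sum>c'\<in>expo_pairs d. pscale (if c' = c then 1 else 0) (hpoly g c'))"
    using assms by simp
qed auto

lemma krivine_cone_sum:
  assumes "\<And>i. i \<in> I \<Longrightarrow> p i \<in> krivine_cone g d"
  shows "(\<Sum>i\<in>I. p i) \<in> krivine_cone g d"
proof -
  have "0 \<in> krivine_cone g d"
    unfolding krivine_cone_def by (intro CollectI exI[of _ "\<lambda>_. 0"]) auto
  then show ?thesis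
    using assms by (induction I rule: infinite_finite_induct) (auto intro: krivine_cone_add)
qed

lemma pconst_add: "pconst (a + b) = pconst a + pconst b"
  by (simp add: pconst_def single_add)

lemma pconst_mult: "pconst (a * b) = pconst a * pconst b"
  by (simp add: pconst_def mult_single)

lemma krivine_cone_mult:
  assumes "p \<in> krivine_cone g d" "q \<in> krivine_cone g e"
  shows "p * q \<in> krivine_cone g (d + e)"
proof -
  obtain \<Lambda> \<Gamma> where p: "p = (\<Sum>c\<in>expo_pairs d. pscale (\<Lambda> c) (hpoly g c))"
    and q: "q = (\<Sum>c\<in>expo_pairs e. pscale (\<Gamma> c) (hpoly g c))"
    and nn: "\<forall>c\<in>expo_pairs d. 0 \<le> \<Lambda> c" "\<forall>c\<in>expo_pairs e. 0 \<le> \<Gamma> c"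
    using assms by (auto simp: krivine_cone_def)
  have h: "hpoly g b * hpoly g c \<in> krivine_cone g (d + e)"
    if "b \<in> expo_pairs d" "c \<in> expo_pairs e" for b c
  proof -
    obtain \<alpha> \<beta> \<gamma> \<delta> where b: "b = (\<alpha>, \<beta>)" and c: "c = (\<gamma>, \<delta>)" by (metis surj_pair)
    have "hpoly g b * hpoly g c = hpoly g (\<lambda>j. \<alpha> j + \<gamma> j, \<lambda>j. \<beta> j + \<delta> j)"
      by (simp add: hpoly_def b c power_add prod.distrib[symmetric] ac_simps)
    moreover have "(\<lambda>j. \<alpha> j + \<gamma> j, \<lambda>j. \<beta> j + \<delta> j) \<in> expo_pairs (d + e)"
      using that by (auto simp: b c expo_pairs_def sum.distrib)
    ultimately show ?thesis by (simp add: hpoly_in_krivine_cone)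
  qed
  have "p * q = (\<Sum>b\<in>expo_pairs d. \<Sum>c\<in>expo_pairs e. pscale (\<Lambda> b * \<Gamma> c) (hpoly g b * hpoly g c))"
    unfolding p q sum_product
    by (intro sum.cong refl) (simp add: pscale_def pconst_mult ac_simps)
  also have "\<dots> \<in> krivine_cone g (d + e)"
    using nn by (intro krivine_cone_sum krivine_cone_scale h) auto
  finally show ?thesis .
qed

lemma krivine_cone_pconst:
  assumes "0 \<le> a" shows "pconst a \<in> krivine_cone g d"
proof -
  have "pscale a (hpoly g (\<lambda>_. 0, \<lambda>_. 0)) \<in> krivine_cone g d"
    using assms by (intro krivine_cone_scale hpoly_in_krivine_cone) (auto simp: expo_pairs_def)
  then show ?thesis by (simp add: hpoly_def pscale_def)
qed

lemma hpoly_single: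
  fixes g :: "'m::finite \<Rightarrow> 'n mpoly"
  shows "hpoly g (\<lambda>i. if i = j then 1 else 0, \<lambda>_. 0) = g j"
    and "hpoly g (\<lambda>_. 0, \<lambda>i. if i = j then 1 else 0) = 1 - g j"
proof -
  have "(\<Prod>i\<in>UNIV. h i ^ (if i = j then 1 else 0)) = h j" for h :: "'m \<Rightarrow> 'n mpoly"
    by (simp add: if_distrib cong: if_cong)
  from this[of g] this[of "\<lambda>i. 1 - g i"]
  show "hpoly g (\<lambda>i. if i = j then 1 else 0, \<lambda>_. 0) = g j"
    and "hpoly g (\<lambda>_. 0, \<lambda>i. if i = j then 1 else 0) = 1 - g j"
    by (simp_all add: hpoly_def)
qed

text \<open>The cone is archimedean. The elements bounded by constants form an algebra because of the identity
  \<open>2 (M N - p q) = (M + p) (N - q) + (M - p) (N + q)\<close>, and this algebra contains each \<open>g j\<close> since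
  \<open>1 - g j\<close> and \<open>1 + g j\<close> belong to the cone.\<close>

lemma generated_algebra_bounded:
  fixes g :: "'m::finite \<Rightarrow> 'n mpoly"
  assumes "p \<in> generated_algebra (insert 1 (range g))"
  shows "\<exists>M d. pconst M - p \<in> krivine_cone g d \<and> pconst M + p \<in> krivine_cone g d"
  using assms
proof induction
  case (gen p)
  then show ?case
  proof
    assume "p = 1"
    then have "pconst 1 - p = pconst 0" "pconst 1 + p = pconst 2"
      using pconst_add[of 1 1] by (simp_all add: pconst_def)
    then show ?thesis
      by (intro exI[of _ 1] exI[of _ 0]) (simp add: krivine_cone_pconst)
  next
    assume "p \<in> range g"
    then obtain j where p: "p = g j" by blast
    let ?e = "\<lambda>i. if i = j then 1 else 0 :: nat"
    have "hpoly g (?e, \<lambda>_. 0) = p" "hpoly g (\<lambda>_. 0, ?e) = 1 - p"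
      by (simp_all add: p hpoly_single)
    moreover have "(?e, \<lambda>_. 0) \<in> expo_pairs 1" "(\<lambda>_. 0, ?e) \<in> expo_pairs 1"
      by (auto simp: expo_pairs_def)
    ultimately have "p \<in> krivine_cone g 1" "1 - p \<in> krivine_cone g 1"
      using hpoly_in_krivine_cone by metis+
    moreover have "pconst 1 = (1 :: 'n mpoly)" by (simp add: pconst_def)
    ultimately show ?thesis
      using krivine_cone_pconst[of 1 g 1] by (intro exI[of _ 1]) (auto intro: krivine_cone_add)
  qed
next
  case (scale p c)
  then obtain M d where M: "pconst M - p \<in> krivine_cone g d" "pconst M + p \<in> krivine_cone g d" by blast
  have eq: "pconst (\<bar>c\<bar> * M) - pscale c p = pscale \<bar>c\<bar> (pconst M - p)"
    "pconst (\<bar>c\<bar> * M) + pscale c p = pscale \<bar>c\<bar> (pconst M + p)" if "0 \<le> c"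
    using that by (simp_all add: pscale_def pconst_mult algebra_simps)
  have eq': "pconst (\<bar>c\<bar> * M) - pscale c p = pscale \<bar>c\<bar> (pconst M + p)"
    "pconst (\<bar>c\<bar> * M) + pscale c p = pscale \<bar>c\<bar> (pconst M - p)" if "c < 0"
    using that by (simp_all add: pscale_def pconst_mult algebra_simps)
      (simp_all add: pconst_def single_uminus mult_single)
  have "pscale \<bar>c\<bar> (pconst M - p) \<in> krivine_cone g d" "pscale \<bar>c\<bar> (pconst M + p) \<in> krivine_cone g d"
    using M by (auto intro: krivine_cone_scale)
  then have "pconst (\<bar>c\<bar> * M) - pscale c p \<in> krivine_cone g d"
    "pconst (\<bar>c\<bar> * M) + pscale c p \<in> krivine_cone g d"
    using eq eq' by (metis not_less)+
  then show ?case by blast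
next
  case (add p q)
  then obtain M d N e where M: "pconst M - p \<in> krivine_cone g d" "pconst M + p \<in> krivine_cone g d"
    and N: "pconst N - q \<in> krivine_cone g e" "pconst N + q \<in> krivine_cone g e" by blast
  have sub: "krivine_cone g d \<subseteq> krivine_cone g (max d e)" "krivine_cone g e \<subseteq> krivine_cone g (max d e)"
    by (simp_all add: krivine_cone_mono)
  have "(pconst M - p) + (pconst N - q) \<in> krivine_cone g (max d e)"
    by (rule krivine_cone_add[OF subsetD[OF sub(1) M(1)] subsetD[OF sub(2) N(1)]])
  moreover have "(pconst M + p) + (pconst N + q) \<in> krivine_cone g (max d e)"
    by (rule krivine_cone_add[OF subsetD[OF sub(1) M(2)] subsetD[OF sub(2) N(2)]])
  ultimately show ?case
    by (intro exI[of _ "M + N"] exI[of _ "max d e"]) (simp add: pconst_add algebra_simps)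
next
  case (mult p q)
  then obtain M d N e where M: "pconst M - p \<in> krivine_cone g d" "pconst M + p \<in> krivine_cone g d"
    and N: "pconst N - q \<in> krivine_cone g e" "pconst N + q \<in> krivine_cone g e" by blast
  let ?h = "pconst (1/2) :: 'n mpoly"
  have "pconst 1 = ?h + ?h" by (simp only: pconst_add[symmetric]) simp
  then have "?h + ?h = 1" by (simp only: pconst_def single_one)
  then have two: "?h * (x + x) = x" for x
    by (simp only: distrib_left distrib_right[symmetric] mult_1_left)
  have "pconst (M * N) - p * q
      = pscale (1/2) ((pconst M + p) * (pconst N - q) + (pconst M - p) * (pconst N + q))"
    unfolding pscale_def by (subst two[symmetric], rule arg_cong[of _ _ "(*) ?h"])
      (simp add: pconst_mult algebra_simps)
  moreover have "pconst (M * N) + p * q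
      = pscale (1/2) ((pconst M + p) * (pconst N + q) + (pconst M - p) * (pconst N - q))"
    unfolding pscale_def by (subst two[symmetric], rule arg_cong[of _ _ "(*) ?h"])
      (simp add: pconst_mult algebra_simps)
  moreover have "(pconst M + p) * (pconst N - q) + (pconst M - p) * (pconst N + q) \<in> krivine_cone g (d + e)"
    by (rule krivine_cone_add[OF krivine_cone_mult[OF M(2) N(1)] krivine_cone_mult[OF M(1) N(2)]])
  moreover have "(pconst M + p) * (pconst N + q) + (pconst M - p) * (pconst N - q) \<in> krivine_cone g (d + e)"
    by (rule krivine_cone_add[OF krivine_cone_mult[OF M(2) N(2)] krivine_cone_mult[OF M(1) N(1)]])
  ultimately have "pconst (M * N) - p * q \<in> krivine_cone g (d + e)"
    "pconst (M * N) + p * q \<in> krivine_cone g (d + e)"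
    by (simp_all only: krivine_cone_scale zero_le_divide_1_iff zero_le_numeral)
  then show ?case by blast
qed

lemma A_feasible_eventually:
  fixes f :: "'n::finite mpoly"
  assumes "generated_algebra (insert 1 (range g)) = UNIV"
  shows "\<exists>d0. \<forall>d\<ge>d0. \<exists>z. A_feasible f g v k d z"
proof -
  obtain M d0 where M: "pconst M + f \<in> krivine_cone g d0"
    using generated_algebra_bounded[of f g] assms by auto
  have "\<exists>z. A_feasible f g v k d z" if "d0 \<le> d" for d
  proof -
    have "pconst M + f \<in> krivine_cone g d" using M krivine_cone_mono[OF that] by blast
    then obtain \<Lambda> where "pconst M + f = (\<Sum>c\<in>expo_pairs d. pscale (\<Lambda> c) (hpoly g c))"
      "\<forall>c\<in>expo_pairs d. 0 \<le> \<Lambda> c" by (auto simp: krivine_cone_def)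
    moreover have "pconst (- M) = (- pconst M :: 'n mpoly)"
      by (simp add: pconst_def single_uminus)
    ultimately have "A_feasible f g v k d (- M, \<Lambda>, \<lambda>_ _. 0)"
      by (simp add: A_feasible_def psd_on_def trace_prod_poly_def add.commute)
    then show ?thesis by blast
  qed
  then show ?thesis by blast
qed


section \<open>Attainment in the primal program\<close>

definition quad :: "'i set \<Rightarrow> ('i \<Rightarrow> 'i \<Rightarrow> real) \<Rightarrow> ('i \<Rightarrow> real) \<Rightarrow> real" where
  "quad I A u = (\<Sum>i\<in>I. \<Sum>j\<in>I. u i * A i j * u j)"

lemma quad_nonneg: "psd_on I A \<Longrightarrow> 0 \<le> quad I A u"
  by (simp add: psd_on_def quad_def)

lemma quad_scale: "quad I A (\<lambda>i. a * u i) = a\<^sup>2 * quad I A u"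
  by (simp add: quad_def sum_distrib_left power2_eq_square ac_simps)

lemma quad_add_le:
  assumes "psd_on I A"
  shows "quad I A (\<lambda>i. u i + w i) \<le> 2 * quad I A u + 2 * quad I A w"
proof -
  have "quad I A (\<lambda>i. u i + w i) + quad I A (\<lambda>i. u i - w i) = 2 * quad I A u + 2 * quad I A w"
    unfolding quad_def sum_distrib_left sum.distrib[symmetric]
    by (intro sum.cong refl) (simp add: algebra_simps)
  then show ?thesis using quad_nonneg[OF assms, of "\<lambda>i. u i - w i"] by linarith
qed

lemma psd_entry_le:
  assumes A: "psd_on I A" and ij: "i \<in> I" "j \<in> I" "finite I"
  shows "2 * \<bar>A i j\<bar> \<le> A i i + A j j"
proof -
  let ?u = "\<lambda>a b k. a * (if k = i then 1 else 0) + b * (if k = j then 1 else 0) :: real"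
  have "quad I A (?u a b) = a\<^sup>2 * A i i + a * b * A i j + a * b * A j i + b\<^sup>2 * A j j" for a b
  proof -
    have 1: "quad I A (?u a b) = (\<Sum>k\<in>I. ?u a b k * (\<Sum>l\<in>I. A k l * ?u a b l))"
      by (simp add: quad_def sum_distrib_left mult.assoc)
    have 2: "(\<Sum>l\<in>I. A k l * ?u a b l) = a * A k i + b * A k j" for k
    proof -
      have "(\<Sum>l\<in>I. A k l * ?u a b l)
          = (\<Sum>l\<in>I. if l = i then a * A k l else 0) + (\<Sum>l\<in>I. if l = j then b * A k l else 0)"
        unfolding sum.distrib[symmetric] by (intro sum.cong) (auto simp: algebra_simps)
      then show ?thesis using ij by simp
    qed
    have 3: "(\<Sum>k\<in>I. ?u a b k * (a * A k i + b * A k j))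
        = (\<Sum>k\<in>I. if k = i then a * (a * A k i + b * A k j) else 0)
        + (\<Sum>k\<in>I. if k = j then b * (a * A k i + b * A k j) else 0)"
      unfolding sum.distrib[symmetric] by (intro sum.cong) (auto simp: algebra_simps)
    show ?thesis unfolding 1 2 3 using ij by (simp add: algebra_simps power2_eq_square)
  qed
  from this[of 1 1] this[of 1 "-1"] quad_nonneg[OF A, of "?u 1 1"] quad_nonneg[OF A, of "?u 1 (-1)"]
  show ?thesis using A ij by (simp add: psd_on_def)
qed

text \<open>The vectors on which a family of semidefinite forms is bounded form a subspace, so it suffices
  to bound the forms on a spanning set.\<close>

lemma quad_bounded_sum:
  assumes "\<And>A. A \<in> F \<Longrightarrow> psd_on I A"
    and "\<And>p. p \<in> P \<Longrightarrow> \<exists>C. \<forall>A\<in>F. quad I A (u p) \<le> C"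
  shows "\<exists>C. \<forall>A\<in>F. quad I A (\<lambda>i. \<Sum>p\<in>P. b p * u p i) \<le> C"
proof -
  have zero: "\<exists>C. \<forall>A\<in>F. quad I A (\<lambda>i. 0) \<le> C"
    by (intro exI[of _ 0]) (simp add: quad_def)
  show ?thesis
    using assms(2)
  proof (induction P rule: infinite_finite_induct)
    case (insert p P)
    then obtain C D where "\<forall>A\<in>F. quad I A (u p) \<le> C"
      and "\<forall>A\<in>F. quad I A (\<lambda>i. \<Sum>p\<in>P. b p * u p i) \<le> D" by blast
    then have "quad I A (\<lambda>i. \<Sum>p\<in>insert p P. b p * u p i) \<le> 2 * ((b p)\<^sup>2 * C) + 2 * D" if "A \<in> F" for A
      using quad_add_le[OF assms(1)[OF that], of "\<lambda>i. b p * u p i" "\<lambda>i. \<Sum>p\<in>P. b p * u p i"]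
        insert.hyps that quad_scale[of I A "b p" "u p"]
        mult_left_mono[of "quad I A (u p)" C "(b p)\<^sup>2"]
      by fastforce
    then show ?case by blast
  qed (simp_all add: zero)
qed

lemma compact_fun_box:
  fixes K :: "'a \<Rightarrow> 'b::topological_space set"
  assumes "\<And>i. compact (K i)"
  shows "compact {h. \<forall>i. h i \<in> K i}"
proof -
  have "compactin (product_topology (\<lambda>_. euclidean) UNIV) (PiE UNIV K)"
    using assms by (subst compactin_PiE) simp
  then show ?thesis
    by (simp add: euclidean_product_topology PiE_UNIV_domain Pi_def)
qed

lemma continuous_on_entry:
  "continuous_on S h \<Longrightarrow> continuous_on S (\<lambda>x. h x i :: 'b::topological_space)"
  using continuous_on_compose2[OF continuous_on_product_coordinates, of S h i] by simp

lemma emeasure_lborel_ball_pos: "0 < r \<Longrightarrow> emeasure lborel (ball (c :: real^'n) r) \<noteq> 0"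
  using unit_ball_vol_pos[of "real CARD('n)", THEN less_imp_neq] by (simp add: emeasure_ball)

text \<open>A feasible candidate is bounded in terms of \<open>t\<close>: evaluating the identity at points of a ball around
  \<open>x0\<close>, where all \<open>h\<^sub>\<alpha>\<^sub>\<beta>\<close> are positive, bounds the weights and the form \<open>Q\<close> on the vectors \<open>v(x)\<close>,
  and these vectors span. So the feasible candidates above a given level form a compact set.\<close>

lemma A_optimal_if_feasible:
  fixes f :: "'n::finite mpoly" and g :: "'m::finite \<Rightarrow> 'n mpoly"
  assumes v: "basis_vec k v"
    and x0: "\<And>j. 0 < peval (g j) x0" "\<And>j. peval (g j) x0 < 1"
    and z0: "A_feasible f g v k d z0"
  shows "\<exists>z. A_optimal f g v k d z"
proof -
  let ?I = "{..<sdim CARD('n) k}"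
  define E where "E = (expo_pairs d :: (('m \<Rightarrow> nat) \<times> ('m \<Rightarrow> nat)) set)"
  have finE [simp]: "finite E" by (simp add: E_def)
  define t0 where "t0 = fst z0"
  define U where "U = (\<Inter>j. {x. 0 < peval (g j) x} \<inter> {x. peval (g j) x < 1})"
  have "open U"
    unfolding U_def by (intro open_INT ballI open_Int open_Collect_less continuous_intros) auto
  moreover have "x0 \<in> U" using x0 by (auto simp: U_def)
  ultimately obtain e where e: "0 < e" "ball x0 e \<subseteq> U"
    using open_contains_ball by blast
  have hpos: "0 < peval (hpoly g c) x" if "x \<in> U" for c x
    using that by (auto simp: hpoly_def U_def peval_simps split: prod.splits intro!: prod_pos mult_pos_pos)

  have "AE X in PiM {..<sdim CARD('n) k} (\<lambda>_. uniform_measure lborel (ball x0 e)).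
      unisolvent k X \<and> (\<forall>i\<in>?I. X i \<in> U)"
  proof (intro AE_conjI AE_unisolvent)
    have S: "emeasure lborel (ball x0 e) \<noteq> 0" "emeasure lborel (ball x0 e) \<noteq> \<infinity>"
      using emeasure_lborel_ball_pos[of e x0] emeasure_lborel_ball_finite[of x0 e] e by auto
    then show "emeasure lborel (ball x0 e) \<noteq> 0" "emeasure lborel (ball x0 e) \<noteq> \<infinity>" by auto
    have P: "prob_space (uniform_measure lborel (ball x0 e))"
      by (rule prob_space_uniform_measure[OF S])
    have "AE x in uniform_measure lborel (ball x0 e). x \<in> U"
      using e by (intro AE_uniform_measureI AE_I2) auto
    then show "AE X in PiM ?I (\<lambda>_. uniform_measure lborel (ball x0 e)). \<forall>i\<in>?I. X i \<in> U"
      using P by (intro AE_finite_allI AE_PiM_component) auto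
  qed simp
  moreover have "prob_space (PiM ?I (\<lambda>_. uniform_measure lborel (ball x0 e)))"
    using emeasure_lborel_ball_pos[of e x0] emeasure_lborel_ball_finite[of x0 e] e
    by (intro prob_space_PiM prob_space_uniform_measure) auto
  ultimately have "\<exists>X. unisolvent k X \<and> (\<forall>i\<in>?I. X i \<in> U)"
    by (intro eventually_happens'[OF prob_space.ae_filter_bot])
  then obtain X where X: "unisolvent k X" "\<And>i. i \<in> ?I \<Longrightarrow> X i \<in> U" by blast
  obtain l where l: "\<And>i. i < sdim CARD('n) k \<Longrightarrow> l i \<in> polys_upto k"
    and interp: "\<And>q x. q \<in> polys_upto k \<Longrightarrow> peval q x = (\<Sum>i\<in>?I. peval (l i) x * peval q (X i))"
    by (rule unisolvent_interpolation[OF X(1)]) blast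
  have "\<forall>p\<in>?I. \<exists>b. l p = (\<Sum>j\<in>?I. pscale (b j) (v j))"
    using basis_vec_coords[OF v l] by (metis lessThan_iff)
  from bchoice[OF this] obtain b where b: "\<And>p. p \<in> ?I \<Longrightarrow> l p = (\<Sum>j\<in>?I. pscale (b p j) (v j))"
    by blast
  \<comment> \<open>The Lagrange polynomials express every unit vector through the vectors \<open>v(X p)\<close>.\<close>
  have unit: "(\<Sum>p\<in>?I. b p j * peval (v i) (X p)) = (if i = j then 1 else 0)"
    if ij: "i \<in> ?I" "j \<in> ?I" for i j
  proof -
    let ?c = "\<lambda>j. (\<Sum>p\<in>?I. b p j * peval (v i) (X p)) - (if i = j then 1 else 0)"
    have "peval (\<Sum>j\<in>?I. pscale (?c j) (v j)) x = 0" for x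
    proof -
      have "peval (v i) x = (\<Sum>p\<in>?I. \<Sum>j\<in>?I. b p j * peval (v i) (X p) * peval (v j) x)"
      proof -
        have "peval (v i) x = (\<Sum>p\<in>?I. peval (l p) x * peval (v i) (X p))"
          using interp[OF basis_vec_degree[OF v], of i x] ij by simp
        also have "\<dots> = (\<Sum>p\<in>?I. \<Sum>j\<in>?I. b p j * peval (v i) (X p) * peval (v j) x)"
          by (intro sum.cong refl) (simp add: b peval_sum peval_pscale sum_distrib_right, simp add: ac_simps)
        finally show ?thesis .
      qed
      also have "\<dots> = (\<Sum>j\<in>?I. (\<Sum>p\<in>?I. b p j * peval (v i) (X p)) * peval (v j) x)"
        by (subst sum.swap) (simp add: sum_distrib_right)
      finally have 1: "(\<Sum>j\<in>?I. (\<Sum>p\<in>?I. b p j * peval (v i) (X p)) * peval (v j) x) = peval (v i) x" ..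
      have "(\<Sum>j\<in>?I. (if i = j then 1 else 0) * peval (v j) x) = (\<Sum>j\<in>?I. if j = i then peval (v i) x else 0)"
        by (intro sum.cong) auto
      then have 2: "(\<Sum>j\<in>?I. (if i = j then 1 else 0) * peval (v j) x) = peval (v i) x"
        using ij by simp
      show ?thesis
        unfolding peval_sum peval_pscale left_diff_distrib sum_subtractf 1 2 by simp
    qed
    then have "(\<Sum>j\<in>?I. pscale (?c j) (v j)) = 0" by (intro peval_eq_0_imp_eq_0)
    then show ?thesis using basis_vec_independent[OF v, of ?c j] ij by simp
  qed

  define V where "V = {(t, \<Lambda>, Q). A_feasible f g v k d (t, \<Lambda>, Q) \<and> t0 \<le> t}"
  have feas: "0 \<le> \<Lambda> c" if "(t, \<Lambda>, Q) \<in> V" "c \<in> E" for t \<Lambda> Q c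
    using that by (auto simp: V_def A_feasible_iff E_def)
  have psd: "psd_on ?I Q" if "(t, \<Lambda>, Q) \<in> V" for t \<Lambda> Q
    using that by (auto simp: V_def A_feasible_iff)
  have ident: "peval f x = t + (\<Sum>c\<in>E. \<Lambda> c * peval (hpoly g c) x) + quad ?I Q (\<lambda>i. peval (v i) x)"
    if "(t, \<Lambda>, Q) \<in> V" for t \<Lambda> Q x
  proof -
    have "trace_prod ?I Q (\<lambda>i j. peval (v i) x * peval (v j) x) = quad ?I Q (\<lambda>i. peval (v i) x)"
      by (simp add: trace_prod_def quad_def ac_simps)
    then show ?thesis using that by (simp add: V_def A_feasible_iff E_def)
  qed
  have tle: "t0 \<le> t" if "(t, \<Lambda>, Q) \<in> V" for t \<Lambda> Q
    using that by (auto simp: V_def)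

  have sum_nn: "0 \<le> (\<Sum>c\<in>E. \<Lambda> c * peval (hpoly g c) x)" if "(t, \<Lambda>, Q) \<in> V" "x \<in> U" for t \<Lambda> Q x
    using feas[OF that(1)] hpos[OF that(2)] by (intro sum_nonneg mult_nonneg_nonneg) (auto intro: less_imp_le)
  have t_ub: "t \<le> peval f x0" if "(t, \<Lambda>, Q) \<in> V" for t \<Lambda> Q
    using ident[OF that, of x0] sum_nn[OF that \<open>x0 \<in> U\<close>] quad_nonneg[OF psd[OF that], of "\<lambda>i. peval (v i) x0"] by linarith
  have \<Lambda>_ub: "\<Lambda> c \<le> (peval f x0 - t0) / peval (hpoly g c) x0" if "(t, \<Lambda>, Q) \<in> V" "c \<in> E" for t \<Lambda> Q c
  proof -
    have "\<Lambda> c * peval (hpoly g c) x0 \<le> (\<Sum>c\<in>E. \<Lambda> c * peval (hpoly g c) x0)"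
      using feas[OF that(1)] hpos[OF \<open>x0 \<in> U\<close>] that(2)
      by (intro member_le_sum mult_nonneg_nonneg) (auto intro: less_imp_le)
    also have "\<dots> \<le> peval f x0 - t0"
      using ident[OF that(1), of x0] tle[OF that(1)] quad_nonneg[OF psd[OF that(1)], of "\<lambda>i. peval (v i) x0"] by linarith
    finally show ?thesis using hpos[OF \<open>x0 \<in> U\<close>, of c] by (simp add: pos_le_divide_eq)
  qed
  have "\<exists>C. \<forall>Q\<in>snd ` snd ` V. quad ?I Q (\<lambda>i. \<Sum>p\<in>?I. b p j * peval (v i) (X p)) \<le> C" for j
  proof (rule quad_bounded_sum)
    fix p assume p: "p \<in> ?I"
    show "\<exists>C. \<forall>Q\<in>snd ` snd ` V. quad ?I Q (\<lambda>i. peval (v i) (X p)) \<le> C"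
    proof (intro exI[of _ "peval f (X p) - t0"] ballI)
      fix Q assume "Q \<in> snd ` snd ` V"
      then obtain t \<Lambda> where z: "(t, \<Lambda>, Q) \<in> V" by force
      then show "quad ?I Q (\<lambda>i. peval (v i) (X p)) \<le> peval f (X p) - t0"
        using ident[OF z, of "X p"] tle[OF z] sum_nn[OF z X(2)[OF p]] by linarith
    qed
  qed (use psd in force)
  then have "\<forall>j. \<exists>C. \<forall>Q\<in>snd ` snd ` V. quad ?I Q (\<lambda>i. \<Sum>p\<in>?I. b p j * peval (v i) (X p)) \<le> C"
    by blast
  from choice[OF this] obtain C where C: "\<And>j Q. Q \<in> snd ` snd ` V \<Longrightarrow>
      quad ?I Q (\<lambda>i. \<Sum>p\<in>?I. b p j * peval (v i) (X p)) \<le> C j"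
    by blast
  have diag: "Q j j \<le> C j" if z: "(t, \<Lambda>, Q) \<in> V" and j: "j \<in> ?I" for t \<Lambda> Q j
  proof -
    have "quad ?I Q (\<lambda>i. \<Sum>p\<in>?I. b p j * peval (v i) (X p))
        = (\<Sum>i\<in>?I. \<Sum>i'\<in>?I. (if i = j then 1 else 0) * Q i i' * (if i' = j then 1 else 0))"
      unfolding quad_def using unit j by (intro sum.cong refl) simp
    also have "\<dots> = (\<Sum>i\<in>?I. \<Sum>i'\<in>?I. if i' = j then (if i = j then Q i i' else 0) else 0)"
      by (intro sum.cong refl) simp
    also have "\<dots> = Q j j" using j by simp
    finally show ?thesis using C[of Q j] z by force
  qed

  define W where "W = {z. t0 \<le> fst z \<and> (\<forall>c\<in>E. 0 \<le> fst (snd z) c) \<and> (\<forall>c\<in>- E. fst (snd z) c = 0) \<and>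
      (\<forall>i\<in>?I. \<forall>j\<in>?I. snd (snd z) i j = snd (snd z) j i) \<and> (\<forall>u. 0 \<le> quad ?I (snd (snd z)) u) \<and>
      (\<forall>x. peval f x = fst z + (\<Sum>c\<in>E. fst (snd z) c * peval (hpoly g c) x)
           + quad ?I (snd (snd z)) (\<lambda>i. peval (v i) x)) \<and>
      (\<forall>i j. i \<notin> ?I \<or> j \<notin> ?I \<longrightarrow> snd (snd z) i j = 0)}"
  have W_iff: "(t, \<Lambda>, Q) \<in> W \<longleftrightarrow> (t, \<Lambda>, Q) \<in> V \<and> (\<forall>c\<in>-E. \<Lambda> c = 0) \<and> (\<forall>i j. i \<notin> ?I \<or> j \<notin> ?I \<longrightarrow> Q i j = 0)"
    for t \<Lambda> Q
    by (auto simp: W_def V_def A_feasible_iff E_def[symmetric] psd_on_def quad_def trace_prod_def ac_simps)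
  define \<beta> where "\<beta> c = (if c \<in> E then (peval f x0 - t0) / peval (hpoly g c) x0 else 0)" for c
  define \<kappa> where "\<kappa> i j = (if i \<in> ?I \<and> j \<in> ?I then (C i + C j) / 2 else 0)" for i j
  define Box where "Box = {t0..peval f x0} \<times> {\<Lambda>. \<forall>c. \<Lambda> c \<in> {0..\<beta> c}} \<times>
      {Q. \<forall>i. Q i \<in> {q. \<forall>j. q j \<in> {- \<kappa> i j..\<kappa> i j}}}"
  have "compact Box"
    unfolding Box_def by (intro compact_Times compact_fun_box compact_Icc)
  have "W \<subseteq> Box"
  proof
    fix z assume "z \<in> W"
    moreover obtain t \<Lambda> Q where z: "z = (t, \<Lambda>, Q)" by (metis surj_pair)
    ultimately have zV: "(t, \<Lambda>, Q) \<in> V" and \<Lambda>0: "\<And>c. c \<notin> E \<Longrightarrow> \<Lambda> c = 0"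
      and Q0: "\<And>i j. i \<notin> ?I \<or> j \<notin> ?I \<Longrightarrow> Q i j = 0"
      unfolding z W_iff by auto
    have "\<Lambda> c \<in> {0..\<beta> c}" for c
      using feas[OF zV] \<Lambda>_ub[OF zV] \<Lambda>0 by (auto simp: \<beta>_def)
    moreover have "Q i j \<in> {- \<kappa> i j..\<kappa> i j}" for i j
    proof (cases "i \<in> ?I \<and> j \<in> ?I")
      case True
      then have "2 * \<bar>Q i j\<bar> \<le> C i + C j"
        using psd_entry_le[OF psd[OF zV], of i j] diag[OF zV, of i] diag[OF zV, of j] by auto
      then have "\<bar>Q i j\<bar> \<le> \<kappa> i j" using True by (simp add: \<kappa>_def)
      then show ?thesis by auto
    next
      case False
      then have "Q i j = 0" using Q0 by blast
      then show ?thesis using False by (auto simp: \<kappa>_def)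
    qed
    ultimately show "z \<in> Box"
      using tle[OF zV] t_ub[OF zV] by (auto simp: Box_def z)
  qed
  define L_of where "L_of c z = fst (snd z) c" for c and z :: "'m candidate"
  define Q_of where "Q_of i j z = snd (snd z) i j" for i j and z :: "'m candidate"
  have cont: "continuous_on UNIV (L_of c)" "continuous_on UNIV (Q_of i j)" for c i j
    unfolding L_of_def Q_of_def
    by (rule continuous_on_entry, intro continuous_intros, rule continuous_on_entry,
        rule continuous_on_entry, intro continuous_intros)
  have "closed W"
    unfolding W_def quad_def Ball_def L_of_def[symmetric] Q_of_def[symmetric]
    by (intro closed_Collect_conj closed_Collect_all closed_Collect_imp closed_Collect_le closed_Collect_eq
        open_Collect_const continuous_on_const continuous_on_add continuous_on_mult continuous_on_sum
        continuous_on_fst continuous_on_id cont)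
  then have "compact W"
    using \<open>compact Box\<close> \<open>W \<subseteq> Box\<close> compact_Int_closed[of Box W] by (simp add: Int_absorb1)
  \<comment> \<open>Zeroing the entries outside the index sets moves a candidate into the bounded set without
    changing its level.\<close>
  have norm: "\<exists>z'\<in>W. fst z' = fst z" if "A_feasible f g v k d z" "t0 \<le> fst z" for z
  proof -
    obtain t \<Lambda> Q where z: "z = (t, \<Lambda>, Q)" by (metis surj_pair)
    let ?\<Lambda> = "\<lambda>c. if c \<in> E then \<Lambda> c else 0" and ?Q = "\<lambda>i j. if i \<in> ?I \<and> j \<in> ?I then Q i j else 0"
    have "(\<Sum>i\<in>?I. \<Sum>j\<in>?I. u i * ?Q i j * u j) = (\<Sum>i\<in>?I. \<Sum>j\<in>?I. u i * Q i j * u j)" for u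
      by (intro sum.cong refl) auto
    then have "psd_on ?I ?Q = psd_on ?I Q"
      unfolding psd_on_def by (intro arg_cong2[of _ _ _ _ "(\<and>)"]) (simp, metis)
    moreover have "trace_prod ?I ?Q B = trace_prod ?I Q B" for B
      unfolding trace_prod_def by (intro sum.cong refl) auto
    moreover have "(\<Sum>c\<in>E. ?\<Lambda> c * h c) = (\<Sum>c\<in>E. \<Lambda> c * h c)" for h
      by (intro sum.cong refl) auto
    ultimately have "A_feasible f g v k d (t, ?\<Lambda>, ?Q)"
      using that unfolding z A_feasible_iff E_def[symmetric] by simp
    then have "(t, ?\<Lambda>, ?Q) \<in> W"
      using that by (auto simp: W_iff V_def z)
    then show ?thesis by (intro bexI[of _ "(t, ?\<Lambda>, ?Q)"]) (simp_all add: z)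
  qed
  have "W \<noteq> {}" using norm[OF z0] t0_def by auto
  have "\<exists>z\<in>W. \<forall>y\<in>W. fst y \<le> fst z"
    by (rule continuous_attains_sup[OF \<open>compact W\<close> \<open>W \<noteq> {}\<close> continuous_on_fst[OF continuous_on_id]])
  then obtain z where z: "z \<in> W" "\<And>y. y \<in> W \<Longrightarrow> fst y \<le> fst z" by blast
  have "A_feasible f g v k d z"
    using z(1) by (cases z) (auto simp: W_iff V_def)
  moreover have "fst y \<le> fst z" if y: "A_feasible f g v k d y" for y
  proof (cases "t0 \<le> fst y")
    case True
    then show ?thesis using norm[OF y] z(2) by force
  next
    case False
    then show ?thesis using z(1) by (auto simp: W_def)
  qed
  ultimately have "A_optimal f g v k d z"
    unfolding A_optimal_def is_arg_max_def by (metis not_less)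
  then show ?thesis by blast
qed


section \<open>The dual program and atomic moment sequences\<close>

text \<open>Interpolation weights turn the evaluation at a feasible point \<open>x\<close> into a feasible \<open>\<theta>\<close> of objective
  \<open>f x\<close>, so the dual value is a lower bound for \<open>f\<close> on the feasible set.\<close>

lemma D_optimal_le:
  fixes f :: "'n::finite mpoly" and g :: "'m::finite \<Rightarrow> 'n mpoly"
  assumes X: "unisolvent (tau f g k d) X" and v: "basis_vec k v"
    and g1: "\<And>j x. x \<in> feasible_set g \<Longrightarrow> peval (g j) x \<le> 1"
    and opt: "D_optimal f g v k d X \<theta>" and x: "x \<in> feasible_set g"
  shows "D_objective f g k d X \<theta> \<le> peval f x"
proof -
  let ?\<tau> = "tau f g k d" and ?I = "{..<sdim CARD('n) k}"
  obtain l where interp: "\<And>q x. q \<in> polys_upto ?\<tau> \<Longrightarrow>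
      peval q x = (\<Sum>i<sdim CARD('n) ?\<tau>. peval (l i) x * peval q (X i))"
    by (rule unisolvent_interpolation[OF X]) blast
  define \<eta> where "\<eta> p = peval (l p) x" for p
  have \<eta>: "(\<Sum>p<npts f g k d. \<eta> p * peval q (X p)) = peval q x" if "q \<in> polys_upto ?\<tau>" for q
    using interp[OF that, of x] by (simp add: \<eta>_def npts_eq_sdim)
  have vv: "(\<Sum>p<npts f g k d. \<eta> p * (peval (v i) (X p) * peval (v j) (X p)))
      = peval (v i) x * peval (v j) x" if "i \<in> ?I" "j \<in> ?I" for i j
  proof -
    have "v i * v j \<in> polys_upto ?\<tau>"
      using polys_upto_mult[of "v i" k "v j" k] basis_vec_degree[OF v] that
      by (intro polys_upto_mono[OF _ tau_bounds(2)]) (auto simp: mult_2)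
    from \<eta>[OF this] show ?thesis by (simp add: peval_mult)
  qed
  have "psd_on ?I (\<lambda>i j. \<Sum>p<npts f g k d. \<eta> p * (peval (v i) (X p) * peval (v j) (X p)))"
    unfolding psd_on_def
  proof (intro conjI ballI allI)
    fix c :: "nat \<Rightarrow> real"
    have "(\<Sum>i\<in>?I. \<Sum>j\<in>?I. c i * (\<Sum>p<npts f g k d. \<eta> p * (peval (v i) (X p) * peval (v j) (X p))) * c j)
        = (\<Sum>i\<in>?I. \<Sum>j\<in>?I. (c i * peval (v i) x) * (c j * peval (v j) x))"
      by (intro sum.cong refl) (simp add: vv)
    also have "\<dots> = (\<Sum>i\<in>?I. c i * peval (v i) x)\<^sup>2"
      by (simp add: power2_eq_square sum_product)
    finally show "0 \<le> (\<Sum>i\<in>?I. \<Sum>j\<in>?I.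
        c i * (\<Sum>p<npts f g k d. \<eta> p * (peval (v i) (X p) * peval (v j) (X p))) * c j)" by simp
  qed (simp add: mult.commute)
  moreover have "0 \<le> (\<Sum>p<npts f g k d. \<eta> p * peval (hpoly g c) (X p))" if "c \<in> expo_pairs d" for c
  proof -
    have "0 \<le> peval (hpoly g c) x"
      using x g1[OF x] by (auto simp: hpoly_def feasible_set_def peval_simps split: prod.split
          intro!: prod_nonneg mult_nonneg_nonneg zero_le_power)
    then show ?thesis using \<eta>[OF hpoly_degree_tau[OF that]] by simp
  qed
  moreover have "(\<Sum>p<npts f g k d. \<eta> p) = 1"
    using \<eta>[of 1] by simp
  ultimately have "D_feasible f g v k d X \<eta>"
    by (simp add: D_feasible_def)
  moreover have "D_objective f g k d X \<eta> = peval f x"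
    using \<eta>[OF polys_upto_pdeg[OF tau_bounds(1)]] by (simp add: D_objective_def)
  ultimately show ?thesis
    using opt by (auto simp: D_optimal_def is_arg_min_def not_less)
qed

lemma D_value_eq_objective:
  assumes "D_optimal f g v k d X \<theta>"
  shows "D_value f g v k d X = ereal (D_objective f g k d X \<theta>)"
proof -
  have "D_feasible f g v k d X \<theta>"
    and "\<And>\<eta>. D_feasible f g v k d X \<eta> \<Longrightarrow> D_objective f g k d X \<theta> \<le> D_objective f g k d X \<eta>"
    using assms by (auto simp: D_optimal_def is_arg_min_def not_less)
  then show ?thesis
    unfolding D_value_def by (intro antisym INF_lower INF_greatest) auto
qed

lemma theta_moments_peval:
  assumes "p \<in> polys_upto l"
  shows "(\<Sum>q<L. \<theta> q * peval p (X q)) = (\<Sum>\<alpha>\<in>expo l. lookup p \<alpha> * theta_moments L X \<theta> \<alpha>)"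
proof -
  have "(\<Sum>q<L. \<theta> q * peval p (X q)) = (\<Sum>q<L. \<Sum>\<alpha>\<in>expo l. \<theta> q * (lookup p \<alpha> * meval \<alpha> (X q)))"
    using assms by (simp add: peval_superset[OF finite_expo] polys_upto_iff sum_distrib_left)
  also have "\<dots> = (\<Sum>\<alpha>\<in>expo l. lookup p \<alpha> * theta_moments L X \<theta> \<alpha>)"
    by (subst sum.swap) (simp add: theta_moments_def sum_distrib_left ac_simps)
  finally show ?thesis .
qed

lemma theta_moments_atoms:
  assumes "p \<in> polys_upto l"
    and "\<And>\<alpha>. \<alpha> \<in> expo l \<Longrightarrow> theta_moments L X \<theta> \<alpha> = (\<Sum>\<xi>\<in>Z. w \<xi> * meval \<alpha> \<xi>)"
  shows "(\<Sum>q<L. \<theta> q * peval p (X q)) = (\<Sum>\<xi>\<in>Z. w \<xi> * peval p \<xi>)"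
proof -
  have "(\<Sum>q<L. \<theta> q * peval p (X q)) = (\<Sum>\<alpha>\<in>expo l. \<Sum>\<xi>\<in>Z. w \<xi> * (lookup p \<alpha> * meval \<alpha> \<xi>))"
    unfolding theta_moments_peval[OF assms(1)]
    by (intro sum.cong refl) (simp add: assms(2) sum_distrib_left ac_simps)
  also have "\<dots> = (\<Sum>\<xi>\<in>Z. w \<xi> * peval p \<xi>)"
    using assms(1) by (subst sum.swap) (simp add: peval_superset[OF finite_expo] polys_upto_iff sum_distrib_left)
  finally show ?thesis .
qed

text \<open>If the moments of an optimal \<open>\<theta>\<close> come from a probability measure on finitely many feasible points,
  then the dual value is an average of values of \<open>f\<close> there, and none of them can be larger than the
  minimum.\<close>

lemma atoms_are_minimizers:
  fixes f :: "'n::finite mpoly" and g :: "'m::finite \<Rightarrow> 'n mpoly"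
  assumes X: "unisolvent (tau f g k d) X" and v: "basis_vec k v"
    and g1: "\<And>j x. x \<in> feasible_set g \<Longrightarrow> peval (g j) x \<le> 1"
    and opt: "D_optimal f g v k d X \<theta>"
    and f: "pdeg f \<le> l"
    and Z: "finite Z" "Z \<subseteq> feasible_set g" "\<And>\<xi>. \<xi> \<in> Z \<Longrightarrow> 0 < w \<xi>"
    and mom: "\<And>\<alpha>. \<alpha> \<in> expo l \<Longrightarrow> theta_moments (npts f g k d) X \<theta> \<alpha> = (\<Sum>\<xi>\<in>Z. w \<xi> * meval \<alpha> \<xi>)"
  shows "D_value f g v k d X = ereal (f_star f g)" and "\<forall>x\<in>Z. minimizer f g x"
proof -
  let ?o = "D_objective f g k d X \<theta>"
  have le: "?o \<le> peval f x" if "x \<in> feasible_set g" for x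
    by (rule D_optimal_le[OF X v g1 opt that])
  have "(\<Sum>p<npts f g k d. \<theta> p) = 1"
    using opt by (auto simp: D_optimal_def is_arg_min_def D_feasible_def)
  then have w1: "(\<Sum>\<xi>\<in>Z. w \<xi>) = 1"
    using theta_moments_atoms[of 1 l, OF _ mom] by simp
  have "?o = (\<Sum>\<xi>\<in>Z. w \<xi> * peval f \<xi>)"
    unfolding D_objective_def using f by (intro theta_moments_atoms[OF _ mom] polys_upto_pdeg)
  then have "(\<Sum>\<xi>\<in>Z. w \<xi> * (peval f \<xi> - ?o)) = 0"
    using w1 by (simp add: right_diff_distrib sum_subtractf sum_distrib_right[symmetric])
  moreover have "0 \<le> w \<xi> * (peval f \<xi> - ?o)" if "\<xi> \<in> Z" for \<xi>
    using that Z le[of \<xi>] by (intro mult_nonneg_nonneg) (auto intro: less_imp_le)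
  ultimately have "\<forall>\<xi>\<in>Z. w \<xi> * (peval f \<xi> - ?o) = 0"
    using sum_nonneg_eq_0_iff[OF Z(1), of "\<lambda>\<xi>. w \<xi> * (peval f \<xi> - ?o)"] by simp
  then have eq: "peval f \<xi> = ?o" if "\<xi> \<in> Z" for \<xi>
    using that Z(3)[OF that] by auto
  then show "\<forall>x\<in>Z. minimizer f g x"
    using Z(2) le by (auto simp: minimizer_def is_arg_min_def not_less)
  obtain \<xi> where "\<xi> \<in> Z" using w1 by fastforce
  then have "?o \<in> peval f ` feasible_set g"
    using eq Z(2) by (metis image_eqI subsetD)
  then have "f_star f g = ?o"
    unfolding f_star_def using le by (intro cInf_eq_minimum) auto
  then show "D_value f g v k d X = ereal (f_star f g)"
    using D_value_eq_objective[OF opt] by simp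
qed


section \<open>Moment sequences of rank one\<close>

lemma expo_peel:
  fixes \<alpha> :: "'n::finite \<Rightarrow>\<^sub>0 nat"
  assumes "\<alpha> \<noteq> 0"
  obtains i \<beta> where "\<alpha> = \<beta> + Poly_Mapping.single i 1" "mdeg \<alpha> = Suc (mdeg \<beta>)"
proof -
  obtain i where i: "lookup \<alpha> i \<noteq> 0"
    using assms by (metis lookup_zero poly_mapping_eqI)
  let ?\<beta> = "\<alpha> - Poly_Mapping.single i 1"
  have "\<alpha> = ?\<beta> + Poly_Mapping.single i 1"
    using i by (intro poly_mapping_eqI) (auto simp: lookup_add lookup_minus lookup_single when_def)
  moreover from this have "mdeg \<alpha> = Suc (mdeg ?\<beta>)"
    by (metis mdeg_add mdeg_single Suc_eq_plus1)
  ultimately show thesis by (rule that)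
qed

lemma expo_split:
  fixes \<alpha> :: "'n::finite \<Rightarrow>\<^sub>0 nat"
  assumes "\<alpha> \<in> expo (m + l)"
  obtains \<beta> \<gamma> where "\<alpha> = \<beta> + \<gamma>" "\<beta> \<in> expo m" "\<gamma> \<in> expo l"
proof -
  have "\<exists>\<beta> \<gamma>. \<alpha> = \<beta> + \<gamma> \<and> \<beta> \<in> expo m \<and> \<gamma> \<in> expo l"
    using assms
  proof (induction l arbitrary: \<alpha>)
    case 0
    then show ?case by (intro exI[of _ \<alpha>] exI[of _ 0]) simp
  next
    case (Suc l)
    show ?case
    proof (cases "\<alpha> = 0")
      case True
      then show ?thesis by (intro exI[of _ 0]) simp
    next
      case False
      then obtain i \<beta> where \<beta>: "\<alpha> = \<beta> + Poly_Mapping.single i 1" "mdeg \<alpha> = Suc (mdeg \<beta>)"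
        by (rule expo_peel)
      then obtain \<gamma> \<delta> where "\<beta> = \<gamma> + \<delta>" "\<gamma> \<in> expo m" "\<delta> \<in> expo l"
        using Suc.IH[of \<beta>] Suc.prems by (auto simp: expo_def)
      then show ?thesis
        using \<beta> by (intro exI[of _ \<gamma>] exI[of _ "\<delta> + Poly_Mapping.single i 1"])
          (auto simp: expo_def mdeg_add ac_simps)
    qed
  qed
  then show thesis using that by blast
qed

text \<open>All columns are multiples of the column of \<open>1\<close>, and the first entry of a column is the factor.\<close>

lemma rank_one_multiplicative:
  fixes y :: "('n::finite \<Rightarrow>\<^sub>0 nat) \<Rightarrow> real"
  assumes rank: "rank_on (expo s) (moment_matrix y) = 1" and y0: "y 0 = 1"
    and \<alpha>: "\<alpha> \<in> expo s" and \<beta>: "\<beta> \<in> expo s"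
  shows "y (\<alpha> + \<beta>) = y \<alpha> * y \<beta>"
proof -
  let ?col = "column_on (expo s) (moment_matrix y)"
  obtain C where C: "?col ` expo s \<subseteq> fun_vs.span C" "card C = 1"
    using fun_vs.basis_exists[of "?col ` expo s"] rank unfolding rank_on_def by metis
  then obtain c where "C = {c}" by (auto simp: card_1_singleton_iff)
  then have "\<forall>\<gamma>\<in>expo s. \<exists>a. ?col \<gamma> = fscale a c"
    using C(1) by (auto simp: fun_vs.span_singleton)
  then obtain a where a: "\<And>\<gamma>. \<gamma> \<in> expo s \<Longrightarrow> ?col \<gamma> = fscale (a \<gamma>) c" by metis
  have col: "y (\<delta> + \<gamma>) = a \<gamma> * c \<delta>" if "\<gamma> \<in> expo s" "\<delta> \<in> expo s" for \<gamma> \<delta>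
    using fun_cong[OF a[OF that(1)], of \<delta>] that(2)
    by (simp add: column_on_def moment_matrix_def fscale_def)
  have "a 0 * c 0 = 1" using col[of 0 0] y0 by simp
  have "y (\<alpha> + \<beta>) * (a 0 * c 0) = y \<alpha> * y \<beta>"
    using col[OF \<beta> \<alpha>] col[of 0, OF _ \<alpha>] col[of \<beta> 0, OF \<beta>] by simp
  then show ?thesis using \<open>a 0 * c 0 = 1\<close> by simp
qed

lemma rank_one_point_moments:
  fixes y :: "('n::finite \<Rightarrow>\<^sub>0 nat) \<Rightarrow> real"
  assumes rank: "rank_on (expo s) (moment_matrix y) = 1" and y0: "y 0 = 1" and s: "1 \<le> s"
    and \<alpha>: "\<alpha> \<in> expo (2 * s)"
  shows "y \<alpha> = meval \<alpha> (\<chi> i. y (Poly_Mapping.single i 1))"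
proof -
  let ?x = "(\<chi> i. y (Poly_Mapping.single i 1)) :: real^'n"
  note mult = rank_one_multiplicative[OF rank y0]
  have small: "y \<beta> = meval \<beta> ?x" if "\<beta> \<in> expo s" for \<beta>
    using that
  proof (induction "mdeg \<beta>" arbitrary: \<beta>)
    case 0
    then have "\<beta> = 0" using mdeg_eq_0_iff by metis
    then show ?case using y0 by simp
  next
    case (Suc m)
    then have "\<beta> \<noteq> 0" by auto
    then obtain i \<gamma> where \<gamma>: "\<beta> = \<gamma> + Poly_Mapping.single i 1" "mdeg \<beta> = Suc (mdeg \<gamma>)"
      by (rule expo_peel)
    then have "\<gamma> \<in> expo s" using Suc.prems by (simp add: expo_def)
    moreover have "Poly_Mapping.single i 1 \<in> expo s" using s by (simp add: expo_def)
    ultimately show ?case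
      using mult Suc.hyps(1)[of \<gamma>] Suc.hyps(2) \<gamma> meval_add[of \<gamma> "Poly_Mapping.single i 1" ?x]
        meval_single[of i ?x] by simp
  qed
  obtain \<beta> \<gamma> where "\<alpha> = \<beta> + \<gamma>" "\<beta> \<in> expo s" "\<gamma> \<in> expo s"
    using \<alpha> expo_split[of \<alpha> s s] by (auto simp: mult_2)
  then show ?thesis using mult small by (simp add: meval_add)
qed


section \<open>The relaxation orders\<close>

lemma s_order_bounds:
  fixes f :: "'n::finite mpoly" and g :: "'m::finite \<Rightarrow> 'n mpoly"
  shows "pdeg f \<le> 2 * s_order f g" "pdeg (g j) \<le> 2 * s_order f g"
proof -
  let ?P = "\<lambda>s. Max (insert (pdeg f) (range (\<lambda>j. pdeg (g j)))) \<le> 2 * s"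
  have "?P (Max (insert (pdeg f) (range (\<lambda>j. pdeg (g j)))))"
    by (simp only: mult_2 le_add1)
  then have "?P (s_order f g)" unfolding s_order_def by (rule LeastI)
  then show "pdeg f \<le> 2 * s_order f g" "pdeg (g j) \<le> 2 * s_order f g" by auto
qed

lemma r_order_bounds:
  fixes f :: "'n::finite mpoly" and g :: "'m::finite \<Rightarrow> 'n mpoly"
  shows "pdeg (g j) \<le> 2 * r_order g" "r_order g \<le> s_order f g"
proof -
  have "nat \<lceil>real (pdeg (g j)) / 2\<rceil> \<le> r_order g"
    unfolding r_order_def by (intro Max_ge) auto
  then show "pdeg (g j) \<le> 2 * r_order g" by linarith
  have "nat \<lceil>real (pdeg (g j)) / 2\<rceil> \<le> s_order f g" for j
    using s_order_bounds(2)[of g j f] by linarith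
  then show "r_order g \<le> s_order f g"
    unfolding r_order_def by (subst Max_le_iff) auto
qed

text \<open>Polynomials of degree 0 form a subalgebra, so a generating family contains a nonconstant element.\<close>

lemma r_order_pos:
  fixes g :: "'m::finite \<Rightarrow> 'n::finite mpoly"
  assumes "generated_algebra (insert 1 (range g)) = UNIV"
  shows "1 \<le> r_order g"
proof (rule ccontr)
  assume "\<not> 1 \<le> r_order g"
  then have g0: "g j \<in> polys_upto 0" for j
    using r_order_bounds(1)[of g j] by (intro polys_upto_pdeg) simp
  have "p \<in> polys_upto 0" if "p \<in> generated_algebra (insert 1 (range g))" for p
    using that
  proof (induction rule: generated_algebra.induct)
    case (mult p q)
    then show ?case using polys_upto_mult[of p 0 q 0] by simp
  qed (use g0 in \<open>auto intro: polys_upto_add polys_upto_pscale\<close>)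
  then have "Poly_Mapping.single (Poly_Mapping.single i 1) 1 \<in> polys_upto 0" for i :: 'n
    using assms by simp
  then show False by (auto simp: polys_upto_iff expo_def)
qed


section \<open>Commuting symmetric operators\<close>

lemma linear_part_zero:
  fixes a b :: real
  assumes "\<And>t. 0 \<le> t * a + t\<^sup>2 * b"
  shows "a = 0"
proof (rule ccontr)
  assume "a \<noteq> 0"
  define q where "q = a / (1 + \<bar>b\<bar>)"
  have a: "a = q * (1 + \<bar>b\<bar>)" by (simp add: q_def)
  have "0 \<le> (- q) * a + (- q)\<^sup>2 * b" by (rule assms)
  also have "\<dots> = q\<^sup>2 * (b - (1 + \<bar>b\<bar>))" by (subst a) algebra
  also have "\<dots> < 0" using \<open>a \<noteq> 0\<close> a by (intro mult_pos_neg) auto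
  finally show False by simp
qed

text \<open>The index set of the vectors depends on the data, so the Euclidean space is modelled by the
  functions vanishing outside a finite set, with an inner product given by its Gram matrix.\<close>

locale gram_form =
  fixes I :: "'i set" and G :: "'i \<Rightarrow> 'i \<Rightarrow> real"
  assumes fin: "finite I"
    and G_sym: "i \<in> I \<Longrightarrow> j \<in> I \<Longrightarrow> G i j = G j i"
    and G_nonneg: "0 \<le> (\<Sum>i\<in>I. \<Sum>j\<in>I. c i * G i j * c j)"
    and G_definite: "(\<Sum>i\<in>I. \<Sum>j\<in>I. c i * G i j * c j) = 0 \<Longrightarrow> i \<in> I \<Longrightarrow> c i = 0"
begin

definition ip :: "('i \<Rightarrow> real) \<Rightarrow> ('i \<Rightarrow> real) \<Rightarrow> real" where
  "ip c d = (\<Sum>i\<in>I. \<Sum>j\<in>I. c i * G i j * d j)"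

definition V :: "('i \<Rightarrow> real) set" where
  "V = {c. \<forall>i. i \<notin> I \<longrightarrow> c i = 0}"

definition app :: "('i \<Rightarrow> 'i \<Rightarrow> real) \<Rightarrow> ('i \<Rightarrow> real) \<Rightarrow> 'i \<Rightarrow> real" where
  "app T c = (\<lambda>i. if i \<in> I then \<Sum>j\<in>I. T i j * c j else 0)"

lemma ip_commute: "ip c d = ip d c"
proof -
  have "ip c d = (\<Sum>j\<in>I. \<Sum>i\<in>I. c i * G i j * d j)"
    unfolding ip_def by (rule sum.swap)
  also have "\<dots> = ip d c"
    unfolding ip_def by (intro sum.cong refl) (simp add: G_sym)
  finally show ?thesis .
qed

lemma ip_add_left: "ip (c + c') d = ip c d + ip c' d"
  by (simp add: ip_def sum.distrib distrib_right)

lemma ip_scale_left: "ip (fscale a c) d = a * ip c d"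
  by (simp add: ip_def fscale_def sum_distrib_left mult.assoc)

lemma ip_add_right: "ip d (c + c') = ip d c + ip d c'"
  by (simp add: ip_commute[of d] ip_add_left)

lemma ip_scale_right: "ip d (fscale a c) = a * ip d c"
  by (simp add: ip_commute[of d] ip_scale_left)

lemma ip_diff_left: "ip (c - c') d = ip c d - ip c' d"
  by (simp add: ip_def sum_subtractf left_diff_distrib)

lemma ip_zero_left [simp]: "ip 0 d = 0"
  by (simp add: ip_def)

lemma ip_sum_left: "ip (\<Sum>k\<in>K. c k) d = (\<Sum>k\<in>K. ip (c k) d)"
  by (induction K rule: infinite_finite_induct)
    (simp_all only: sum.infinite sum.empty sum.insert ip_zero_left ip_add_left not_False_eq_True)

lemma ip_nonneg: "0 \<le> ip c c"
  unfolding ip_def by (rule G_nonneg)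

lemma ip_definite: "ip c c = 0 \<Longrightarrow> c \<in> V \<Longrightarrow> c = 0"
  using G_definite by (fastforce simp: ip_def V_def)

lemma ip_pos: "c \<in> V \<Longrightarrow> c \<noteq> 0 \<Longrightarrow> 0 < ip c c"
  using ip_nonneg[of c] ip_definite[of c] by fastforce

lemma subspace_V: "fun_vs.subspace V"
  by (intro fun_vs.subspaceI) (auto simp: V_def fscale_def)

lemma app_in_V [simp]: "app T c \<in> V"
  by (simp add: V_def app_def)

lemma app_add: "app T (c + d) = app T c + app T d"
  by (rule ext) (simp add: app_def sum.distrib distrib_left)

lemma app_scale: "app T (fscale a c) = fscale a (app T c)"
  by (rule ext) (simp add: app_def fscale_def sum_distrib_left ac_simps)

lemma continuous_on_coord: "continuous_on S (\<lambda>c. c i :: real)"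
  by (rule continuous_on_subset[OF continuous_on_product_coordinates]) simp

lemma continuous_on_ip: "continuous_on S (\<lambda>c. ip c d)"
  unfolding ip_def by (intro continuous_on_sum continuous_on_mult continuous_on_const continuous_on_coord)

lemma continuous_on_app: "continuous_on S (\<lambda>c. app T c i)"
  by (cases "i \<in> I") (auto simp: app_def intro!: continuous_on_sum continuous_on_mult continuous_on_const continuous_on_coord)

text \<open>A maximizer of the Rayleigh quotient is an eigenvector.\<close>

lemma eigenvector_exists:
  assumes W: "fun_vs.subspace W" "closed W" "W \<subseteq> V" "W \<noteq> {0}"
    and inv: "\<And>c. c \<in> W \<Longrightarrow> app T c \<in> W"
    and sym: "\<And>c d. c \<in> V \<Longrightarrow> d \<in> V \<Longrightarrow> ip (app T c) d = ip c (app T d)"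
  shows "\<exists>\<mu>. \<exists>v\<in>W. v \<noteq> 0 \<and> app T v = fscale \<mu> v"
proof -
  define nrm where "nrm c = (\<Sum>i\<in>I. (c i)\<^sup>2)" for c :: "'i \<Rightarrow> real"
  define S where "S = W \<inter> {c. nrm c = 1}"
  have nrm_pos: "0 < nrm c" if "c \<in> V" "c \<noteq> 0" for c
  proof -
    obtain i where "i \<in> I" "c i \<noteq> 0" using \<open>c \<in> V\<close> \<open>c \<noteq> 0\<close> by (auto simp: V_def fun_eq_iff)
    then show ?thesis unfolding nrm_def using fin by (intro sum_pos2[of I i]) auto
  qed
  have nrm_scale: "nrm (fscale a c) = a\<^sup>2 * nrm c" for a c
    by (simp add: nrm_def fscale_def power_mult_distrib sum_distrib_left)
  have normalize: "fscale (1 / sqrt (nrm c)) c \<in> S" if "c \<in> W" "c \<noteq> 0" for c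
    using that nrm_pos[of c] W(3) fun_vs.subspace_scale[OF W(1) that(1)]
    by (auto simp: S_def nrm_scale power_divide)
  have "0 \<in> W" using fun_vs.subspace_0[OF W(1)] .
  then obtain c0 where "c0 \<in> W" "c0 \<noteq> 0" using W(4) by blast
  then have "S \<noteq> {}" using normalize by blast
  have "S \<subseteq> {c. \<forall>i. c i \<in> {-1..1}}"
  proof clarify
    fix c i assume c: "c \<in> S"
    have "(c i)\<^sup>2 \<le> 1"
    proof (cases "i \<in> I")
      case True
      then have "(c i)\<^sup>2 \<le> nrm c" unfolding nrm_def using fin by (intro member_le_sum) auto
      then show ?thesis using c by (simp add: S_def)
    next
      case False
      then have "c i = 0" using c W(3) by (auto simp: S_def V_def)
      then show ?thesis by simp
    qed
    then show "c i \<in> {-1..1}" by (simp add: abs_square_le_1 abs_le_iff)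
  qed
  moreover have "closed S"
    unfolding S_def nrm_def using W(2)
    by (intro closed_Int closed_Collect_eq continuous_on_sum continuous_on_power continuous_on_const continuous_on_coord)
  moreover have "compact {c :: 'i \<Rightarrow> real. \<forall>i. c i \<in> {-1..1}}"
    by (intro compact_fun_box compact_Icc)
  ultimately have "compact S"
    using compact_Int_closed by (metis Int_absorb1)
  have pos: "0 < ip c c" if "c \<in> S" for c
  proof -
    have "c \<noteq> 0" using that by (auto simp: S_def nrm_def)
    then show ?thesis using that W(3) by (intro ip_pos) (auto simp: S_def)
  qed
  let ?R = "\<lambda>c. ip (app T c) c / ip c c"
  have "continuous_on S (\<lambda>c. ip (app T c) c)" "continuous_on S (\<lambda>c. ip c c)"
    unfolding ip_def
    by (intro continuous_on_sum continuous_on_mult continuous_on_const continuous_on_coord continuous_on_app)+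
  then have "continuous_on S ?R"
    using pos by (intro continuous_on_divide) fastforce+
  then obtain v where v: "v \<in> S" and max: "\<And>c. c \<in> S \<Longrightarrow> ?R c \<le> ?R v"
    using continuous_attains_sup[OF \<open>compact S\<close> \<open>S \<noteq> {}\<close>, of ?R] by blast
  define \<mu> where "\<mu> = ?R v"
  have vW: "v \<in> W" "v \<in> V" "v \<noteq> 0"
    using v W(3) pos[OF v] by (auto simp: S_def)
  have le: "ip (app T c) c \<le> \<mu> * ip c c" if c: "c \<in> W" for c
  proof (cases "c = 0")
    case True
    then show ?thesis by (simp add: ip_def)
  next
    case False
    let ?a = "1 / sqrt (nrm c)"
    have a: "0 < ?a" using nrm_pos[of c] False c W(3) by auto
    have "?R (fscale ?a c) \<le> \<mu>"
      unfolding \<mu>_def by (rule max[OF normalize[OF c False]])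
    moreover have "?R (fscale ?a c) = ?R c"
      using a by (simp add: app_scale ip_scale_left ip_scale_right)
    ultimately show ?thesis
      using ip_pos[of c] False c W(3) by (auto simp: pos_divide_le_eq)
  qed
  have "ip (fscale \<mu> v - app T v) u = 0" if u: "u \<in> W" for u
  proof -
    have "0 \<le> t * (2 * (\<mu> * ip v u - ip (app T v) u)) + t\<^sup>2 * (\<mu> * ip u u - ip (app T u) u)" for t
    proof -
      let ?c = "v + fscale t u"
      have "?c \<in> W" using W(1) vW u by (intro fun_vs.subspace_add fun_vs.subspace_scale)
      then have "0 \<le> \<mu> * ip ?c ?c - ip (app T ?c) ?c" using le by fastforce
      moreover have "ip (app T u) v = ip (app T v) u"
        using sym[of u v] u vW W(3) ip_commute by (metis subsetD)
      moreover have "ip (app T v) v = \<mu> * ip v v" using pos[OF v] by (simp add: \<mu>_def)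
      ultimately show ?thesis
        by (simp add: app_add app_scale ip_add_left ip_add_right ip_scale_left ip_scale_right
            ip_commute[of u v] power2_eq_square algebra_simps)
    qed
    from linear_part_zero[OF this] show ?thesis
      by (simp add: ip_diff_left ip_scale_left)
  qed
  moreover have "fscale \<mu> v - app T v \<in> W"
    using W(1) vW inv by (intro fun_vs.subspace_diff fun_vs.subspace_scale)
  ultimately have "fscale \<mu> v - app T v = 0"
    using ip_definite W(3) by blast
  then show ?thesis using vW by (intro exI[of _ \<mu>] bexI[of _ v]) auto
qed

definition symmetric_commuting :: "('k \<Rightarrow> 'i \<Rightarrow> 'i \<Rightarrow> real) \<Rightarrow> bool" where
  "symmetric_commuting N \<longleftrightarrow>
     (\<forall>k. \<forall>c\<in>V. \<forall>d\<in>V. ip (app (N k) c) d = ip c (app (N k) d)) \<and>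
     (\<forall>k k'. \<forall>c\<in>V. app (N k) (app (N k') c) = app (N k') (app (N k) c))"

text \<open>An eigenspace of one operator is invariant under the others, so the eigenspaces can be intersected
  one operator at a time.\<close>

lemma joint_eigenvector_exists:
  fixes N :: "'k::finite \<Rightarrow> 'i \<Rightarrow> 'i \<Rightarrow> real"
  assumes N: "symmetric_commuting N"
    and W: "fun_vs.subspace W" "closed W" "W \<subseteq> V" "W \<noteq> {0}"
    and inv: "\<And>k c. c \<in> W \<Longrightarrow> app (N k) c \<in> W"
  shows "\<exists>v\<in>W. v \<noteq> 0 \<and> (\<exists>x. \<forall>k. app (N k) v = fscale (x k) v)"
proof -
  have "\<exists>W' x. fun_vs.subspace W' \<and> closed W' \<and> W' \<subseteq> W \<and> W' \<noteq> {0} \<and>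
      (\<forall>k. \<forall>c\<in>W'. app (N k) c \<in> W') \<and> (\<forall>k\<in>J. \<forall>c\<in>W'. app (N k) c = fscale (x k) c)"
    if "finite J" for J
    using that
  proof (induction J rule: finite_induct)
    case empty
    then show ?case using W inv by blast
  next
    case (insert k J)
    then obtain W' x where W': "fun_vs.subspace W'" "closed W'" "W' \<subseteq> W" "W' \<noteq> {0}"
      and inv': "\<And>k c. c \<in> W' \<Longrightarrow> app (N k) c \<in> W'"
      and eig: "\<And>k c. k \<in> J \<Longrightarrow> c \<in> W' \<Longrightarrow> app (N k) c = fscale (x k) c" by blast
    have "W' \<subseteq> V" using W' W by blast
    then obtain \<mu> v where v: "v \<in> W'" "v \<noteq> 0" "app (N k) v = fscale \<mu> v"
      using eigenvector_exists[OF W'(1,2) _ W'(4), of "N k"] inv' N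
      unfolding symmetric_commuting_def by blast
    let ?W = "{c \<in> W'. \<forall>i. app (N k) c i = \<mu> * c i}"
    have mem: "c \<in> ?W \<longleftrightarrow> c \<in> W' \<and> app (N k) c = fscale \<mu> c" for c
      by (auto simp: fscale_def)
    have 1: "fun_vs.subspace ?W"
    proof (intro fun_vs.subspaceI)
      have "app (N k) 0 = fscale \<mu> 0" by (rule ext) (simp add: app_def fscale_def)
      then show "0 \<in> ?W" unfolding mem using fun_vs.subspace_0[OF W'(1)] by blast
    next
      fix c d assume "c \<in> ?W" "d \<in> ?W"
      then show "c + d \<in> ?W"
        unfolding mem using fun_vs.subspace_add[OF W'(1)]
        by (simp only: app_add fun_vs.scale_right_distrib simp_thms)
    next
      fix a c assume "c \<in> ?W"
      then show "fscale a c \<in> ?W"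
        unfolding mem using fun_vs.subspace_scale[OF W'(1)]
        by (simp only: app_scale fun_vs.scale_left_commute[of \<mu>] simp_thms)
    qed
    have 2: "closed ?W"
      unfolding Collect_conj_eq using W'(2)
      by (intro closed_Int closed_Collect_all closed_Collect_eq continuous_on_app continuous_on_mult
          continuous_on_const continuous_on_coord) simp
    have 3: "?W \<subseteq> W" using W'(3) by blast
    have 4: "?W \<noteq> {0}" using v mem[of v] by (metis singletonD)
    have 5: "app (N k') c \<in> ?W" if "c \<in> ?W" for k' c
    proof -
      have c: "c \<in> W'" "app (N k) c = fscale \<mu> c" using that unfolding mem by auto
      have "app (N k) (app (N k') c) = app (N k') (app (N k) c)"
        using N c(1) \<open>W' \<subseteq> V\<close> unfolding symmetric_commuting_def by blast
      also have "\<dots> = fscale \<mu> (app (N k') c)" by (simp only: c(2) app_scale)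
      finally show ?thesis unfolding mem using inv'[OF c(1)] by blast
    qed
    have 6: "app (N k') c = fscale ((x(k := \<mu>)) k') c" if "k' \<in> insert k J" "c \<in> ?W" for k' c
    proof (cases "k' = k")
      case True
      then show ?thesis using that(2) mem by simp
    next
      case False
      then show ?thesis using that mem eig[of k' c] by simp
    qed
    show ?case
      using 1 2 3 4 by (intro exI[of _ ?W] exI[of _ "x(k := \<mu>)"] conjI allI ballI 5 6)
  qed
  from this[OF finite_class.finite_UNIV] obtain W' x
    where W': "W' \<subseteq> W" "W' \<noteq> {0}" "fun_vs.subspace W'"
      "\<forall>k\<in>UNIV. \<forall>c\<in>W'. app (N k) c = fscale (x k) c" by blast
  obtain v where "v \<in> W'" "v \<noteq> 0"
    using W'(2) fun_vs.subspace_0[OF W'(3)] by blast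
  then show ?thesis using W'(1,4) by blast
qed

text \<open>The orthogonal complement of all joint eigenvectors is invariant, and it contains no joint
  eigenvector.\<close>

lemma joint_eigenvectors_complete:
  fixes N :: "'k::finite \<Rightarrow> 'i \<Rightarrow> 'i \<Rightarrow> real"
  assumes N: "symmetric_commuting N" and c: "c \<in> V"
    and orth: "\<And>v x. v \<in> V \<Longrightarrow> (\<And>k. app (N k) v = fscale (x k) v) \<Longrightarrow> ip c v = 0"
  shows "c = 0"
proof (rule ccontr)
  assume "c \<noteq> 0"
  define E where "E = {v \<in> V. \<exists>x. \<forall>k. app (N k) v = fscale (x k) v}"
  define W where "W = V \<inter> {c. \<forall>v\<in>E. ip c v = 0}"
  have "fun_vs.subspace W"
    unfolding W_def
    by (rule fun_vs.subspace_inter[OF subspace_V], rule fun_vs.subspaceI)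
      (auto simp: ip_add_left ip_scale_left)
  moreover have "closed W"
    unfolding W_def V_def Ball_def
    by (intro closed_Int closed_Collect_all closed_Collect_imp closed_Collect_eq open_Collect_const
        continuous_on_ip continuous_on_const continuous_on_coord)
  moreover have "W \<subseteq> V" by (simp add: W_def)
  moreover have "c \<in> W" using c orth by (auto simp: W_def E_def)
  then have "W \<noteq> {0}" using \<open>c \<noteq> 0\<close> by blast
  moreover have "app (N k) d \<in> W" if d: "d \<in> W" for k d
  proof -
    have "ip (app (N k) d) v = 0" if v: "v \<in> E" for v
    proof -
      obtain x where x: "app (N k) v = fscale x v" using v by (auto simp: E_def)
      have "ip (app (N k) d) v = ip d (app (N k) v)"
        using N d v by (auto simp: symmetric_commuting_def W_def E_def)
      then show ?thesis using d v by (simp add: x ip_scale_right W_def)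
    qed
    then show ?thesis by (simp add: W_def)
  qed
  ultimately have "\<exists>v\<in>W. v \<noteq> 0 \<and> (\<exists>x. \<forall>k. app (N k) v = fscale (x k) v)"
    by (rule joint_eigenvector_exists[OF N])
  then obtain v x where v: "v \<in> W" "v \<noteq> 0" "\<forall>k. app (N k) v = fscale (x k) v" by blast
  then have "v \<in> E" by (auto simp: W_def E_def)
  then have "ip v v = 0" using v(1) by (simp add: W_def)
  then show False using ip_definite v by (auto simp: W_def)
qed

end


section \<open>Flat moment matrices\<close>

text \<open>The form is nonnegative along every line through a zero of it, so it has no linear term there.\<close>

lemma psd_kernel:
  assumes A: "psd_on I A" and fin: "finite I" and 0: "quad I A u = 0" and i: "i \<in> I"
  shows "(\<Sum>j\<in>I. A i j * u j) = 0"
proof -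
  define a where "a k = (\<Sum>l\<in>I. A k l * u l)" for k
  define m where "m = (\<Sum>k\<in>I. a k * a k)"
  have 1: "(\<Sum>k\<in>I. \<Sum>l\<in>I. a k * A k l * u l) = m"
    unfolding m_def by (intro sum.cong refl) (simp add: sum_distrib_left[symmetric] mult.assoc a_def[symmetric])
  have "(\<Sum>k\<in>I. \<Sum>l\<in>I. u k * A k l * a l) = (\<Sum>l\<in>I. \<Sum>k\<in>I. u k * A k l * a l)"
    by (rule sum.swap)
  also have "\<dots> = (\<Sum>l\<in>I. \<Sum>k\<in>I. a l * A l k * u k)"
    using A by (intro sum.cong refl) (simp add: psd_on_def)
  finally have 2: "(\<Sum>k\<in>I. \<Sum>l\<in>I. u k * A k l * a l) = m" using 1 by simp
  have "0 \<le> t * (2 * m) + t\<^sup>2 * quad I A a" for t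
  proof -
    have "0 \<le> quad I A (\<lambda>k. u k + t * a k)" by (rule quad_nonneg[OF A])
    also have "\<dots> = (\<Sum>k\<in>I. \<Sum>l\<in>I. u k * A k l * u l + t * (a k * A k l * u l)
        + t * (u k * A k l * a l) + t\<^sup>2 * (a k * A k l * a l))"
      unfolding quad_def by (intro sum.cong refl) (simp add: algebra_simps power2_eq_square)
    also have "\<dots> = quad I A u + t * m + t * m + t\<^sup>2 * quad I A a"
      unfolding sum.distrib sum_distrib_left[symmetric] 1 2 quad_def ..
    finally show ?thesis using 0 by (simp add: mult.commute[of t])
  qed
  from linear_part_zero[OF this] have "m = 0" by simp
  then have "\<forall>k\<in>I. a k * a k = 0"
    unfolding m_def using sum_nonneg_eq_0_iff[OF fin, of "\<lambda>k. a k * a k"] by simp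
  then show ?thesis using i by (simp add: a_def)
qed

text \<open>Columns are compared entrywise: the column of \<open>x\<^sup>\<alpha>\<close> has the entries \<open>y (\<delta> + \<alpha>)\<close>.\<close>

lemma column_combination:
  "(\<Sum>\<gamma>\<in>B. fscale (c \<gamma>) (column_on (expo s) (moment_matrix y) \<gamma>)) \<delta>
     = (if \<delta> \<in> expo s then \<Sum>\<gamma>\<in>B. c \<gamma> * y (\<delta> + \<gamma>) else 0)"
  by (simp add: sum_fun_apply fscale_def column_on_def moment_matrix_def)

lemma column_eq_combination_iff:
  "column_on (expo s) (moment_matrix y) \<alpha> = (\<Sum>\<gamma>\<in>B. fscale (c \<gamma>) (column_on (expo s) (moment_matrix y) \<gamma>))
     \<longleftrightarrow> (\<forall>\<delta>\<in>expo s. y (\<delta> + \<alpha>) = (\<Sum>\<gamma>\<in>B. c \<gamma> * y (\<delta> + \<gamma>)))"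
  unfolding fun_eq_iff column_combination by (auto simp: column_on_def moment_matrix_def)

lemma column_basis_coords:
  fixes y :: "('n::finite \<Rightarrow>\<^sub>0 nat) \<Rightarrow> real"
  assumes B: "column_basis y l s B" and \<alpha>: "\<alpha> \<in> expo s"
  obtains c where "\<And>\<delta>. \<delta> \<in> expo s \<Longrightarrow> y (\<delta> + \<alpha>) = (\<Sum>\<gamma>\<in>B. c \<gamma> * y (\<delta> + \<gamma>))"
proof -
  let ?col = "column_on (expo s) (moment_matrix y)"
  have "finite B" using B finite_subset[OF _ finite_expo] by (auto simp: column_basis_def)
  moreover have "?col \<alpha> \<in> fun_vs.span (?col ` B)"
    using B \<alpha> fun_vs.span_base[of "?col \<alpha>" "?col ` expo s"] by (simp add: column_basis_def)
  ultimately obtain u where "?col \<alpha> = (\<Sum>w\<in>?col ` B. fscale (u w) w)"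
    using fun_vs.span_finite[of "?col ` B"] by auto
  then have "?col \<alpha> = (\<Sum>\<gamma>\<in>B. fscale (u (?col \<gamma>)) (?col \<gamma>))"
    using B by (simp add: column_basis_def sum.reindex)
  then have "\<forall>\<delta>\<in>expo s. y (\<delta> + \<alpha>) = (\<Sum>\<gamma>\<in>B. u (?col \<gamma>) * y (\<delta> + \<gamma>))"
    by (simp only: column_eq_combination_iff)
  then show thesis using that[of "\<lambda>\<gamma>. u (?col \<gamma>)"] by blast
qed

lemma multiplication_matrices_iff:
  "multiplication_matrices y s B N \<longleftrightarrow>
     (\<forall>i. \<forall>\<beta>\<in>B. \<forall>\<delta>\<in>expo s. y (\<delta> + (\<beta> + Poly_Mapping.single i 1)) = (\<Sum>\<gamma>\<in>B. N i \<gamma> \<beta> * y (\<delta> + \<gamma>)))"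
  unfolding multiplication_matrices_def column_eq_combination_iff ..

lemma multiplication_matrices_exist:
  fixes y :: "('n::finite \<Rightarrow>\<^sub>0 nat) \<Rightarrow> real"
  assumes B: "column_basis y l s B" and "l < s"
  shows "\<exists>N. multiplication_matrices y s B N"
proof -
  have "\<exists>c. \<forall>\<delta>\<in>expo s. y (\<delta> + (\<beta> + Poly_Mapping.single i 1)) = (\<Sum>\<gamma>\<in>B. c \<gamma> * y (\<delta> + \<gamma>))"
    if "\<beta> \<in> B" for i \<beta>
  proof -
    have "\<beta> + Poly_Mapping.single i 1 \<in> expo s"
      using that B \<open>l < s\<close> by (auto simp: column_basis_def expo_def mdeg_add subset_iff)
    from column_basis_coords[OF B this] show ?thesis by metis
  qed
  then have "\<forall>i \<beta>. \<exists>c. \<beta> \<in> B \<longrightarrow>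
      (\<forall>\<delta>\<in>expo s. y (\<delta> + (\<beta> + Poly_Mapping.single i 1)) = (\<Sum>\<gamma>\<in>B. c \<gamma> * y (\<delta> + \<gamma>)))"
    by blast
  then obtain C where "\<forall>i \<beta>. \<beta> \<in> B \<longrightarrow>
      (\<forall>\<delta>\<in>expo s. y (\<delta> + (\<beta> + Poly_Mapping.single i 1)) = (\<Sum>\<gamma>\<in>B. C i \<beta> \<gamma> * y (\<delta> + \<gamma>)))"
    unfolding choice_iff by blast
  then have "multiplication_matrices y s B (\<lambda>i \<gamma> \<beta>. C i \<beta> \<gamma>)"
    unfolding multiplication_matrices_iff by blast
  then show ?thesis by blast
qed

lemma card_column_basis:
  assumes "column_basis y l s B"
  shows "card B = rank_on (expo s) (moment_matrix y)"
  using assms fun_vs.dim_eq_card[of "column_on (expo s) (moment_matrix y) ` B"]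
  by (simp add: column_basis_def rank_on_def card_image)

text \<open>Truncating the rows to \<open>expo l\<close> maps the columns of degree at most \<open>l\<close> of the large matrix onto
  those of the small one. So equal ranks force these columns to span all columns of the large
  matrix.\<close>

lemma column_basis_exists:
  fixes y :: "('n::finite \<Rightarrow>\<^sub>0 nat) \<Rightarrow> real"
  assumes "l \<le> s" and rank: "rank_on (expo s) (moment_matrix y) = rank_on (expo l) (moment_matrix y)"
  shows "\<exists>B. column_basis y l s B"
proof -
  let ?col = "column_on (expo s) (moment_matrix y)"
  let ?S = "?col ` expo l" and ?T = "?col ` expo s"
  have sub: "?S \<subseteq> ?T" using expo_mono[OF \<open>l \<le> s\<close>] by blast
  define R where "R h = (\<lambda>i. if i \<in> expo l then h i else 0)" for h :: "('n \<Rightarrow>\<^sub>0 nat) \<Rightarrow> real"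
  have lin: "Vector_Spaces.linear fscale fscale R"
    by unfold_locales (auto simp: R_def fscale_def)
  interpret R: Vector_Spaces.linear fscale fscale R by (rule lin)
  obtain C where C: "C \<subseteq> ?S" "fun_vs.independent C" "?S \<subseteq> fun_vs.span C"
    using fun_vs.maximal_independent_subset by blast
  have finC: "finite C" using C(1) by (rule finite_subset) simp
  have "column_on (expo l) (moment_matrix y) j = R (?col j)" for j
    using expo_mono[OF \<open>l \<le> s\<close>] by (auto simp: R_def column_on_def fun_eq_iff)
  then have "column_on (expo l) (moment_matrix y) ` expo l = R ` ?S"
    by (simp add: image_image)
  moreover have "R ` ?S \<subseteq> fun_vs.span (R ` C)"
    using C(3) by (auto simp: R.span_image)
  ultimately have "rank_on (expo l) (moment_matrix y) \<le> card (R ` C)"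
    unfolding rank_on_def using finC by (simp add: fun_vs.dim_le_card)
  also have "\<dots> \<le> card C" using finC by (rule card_image_le)
  finally have le: "fun_vs.dim ?T \<le> card C" using rank by (simp add: rank_on_def)
  have T: "?T \<subseteq> fun_vs.span C"
  proof
    fix t assume t: "t \<in> ?T"
    show "t \<in> fun_vs.span C"
    proof (rule ccontr)
      assume notin: "t \<notin> fun_vs.span C"
      then have ind: "fun_vs.independent (insert t C)"
        using C(2) by (simp add: fun_vs.independent_insert)
      obtain D where D: "D \<subseteq> ?T" "?T \<subseteq> fun_vs.span D" "card D = fun_vs.dim ?T"
        using fun_vs.basis_exists by metis
      have "finite D" using D(1) by (rule finite_subset) simp
      moreover have "insert t C \<subseteq> fun_vs.span D" using t C(1) sub D(2) by blast
      ultimately have "card (insert t C) \<le> card D"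
        using fun_vs.independent_span_bound ind by blast
      moreover have "t \<notin> C" using notin fun_vs.span_superset by blast
      ultimately show False using le D(3) finC by simp
    qed
  qed
  obtain B where B: "B \<subseteq> expo l" "inj_on ?col B" "C = ?col ` B"
    using C(1) by (auto simp: subset_image_inj)
  have "fun_vs.span C = fun_vs.span ?T"
  proof (rule antisym)
    show "fun_vs.span C \<subseteq> fun_vs.span ?T" using C(1) sub by (intro fun_vs.span_mono) blast
    show "fun_vs.span ?T \<subseteq> fun_vs.span C" using T by (intro fun_vs.span_minimal fun_vs.subspace_span)
  qed
  then have "column_basis y l s B"
    using B C(2) by (simp add: column_basis_def)
  then show ?thesis by blast
qed

text \<open>The points at which all polynomials in the kernel of the moment matrix vanish. They do not depend on
  the choice of a column basis.\<close>

definition kernel_variety :: "(('n::finite \<Rightarrow>\<^sub>0 nat) \<Rightarrow> real) \<Rightarrow> nat \<Rightarrow> (real^'n) set" where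
  "kernel_variety y s = {x. \<forall>c. (\<forall>\<delta>\<in>expo s. (\<Sum>\<alpha>\<in>expo s. c \<alpha> * y (\<delta> + \<alpha>)) = 0)
     \<longrightarrow> (\<Sum>\<alpha>\<in>expo s. c \<alpha> * meval \<alpha> x) = 0}"

text \<open>A functional on monomials that turns multiplication by \<open>x\<^sub>i\<close> into multiplication by a number is an
  evaluation up to a factor.\<close>

lemma multiplicative_on_expo:
  fixes \<phi> :: "('n::finite \<Rightarrow>\<^sub>0 nat) \<Rightarrow> real"
  assumes "\<And>\<alpha> i. \<alpha> + Poly_Mapping.single i 1 \<in> expo s \<Longrightarrow> \<phi> (\<alpha> + Poly_Mapping.single i 1) = x $ i * \<phi> \<alpha>"
    and "\<alpha> \<in> expo s"
  shows "\<phi> \<alpha> = meval \<alpha> x * \<phi> 0"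
  using assms(2)
proof (induction "mdeg \<alpha>" arbitrary: \<alpha>)
  case 0
  then have "\<alpha> = 0" using mdeg_eq_0_iff by metis
  then show ?case by simp
next
  case (Suc m)
  then have "\<alpha> \<noteq> 0" by auto
  then obtain i \<beta> where \<beta>: "\<alpha> = \<beta> + Poly_Mapping.single i 1" "mdeg \<alpha> = Suc (mdeg \<beta>)"
    by (rule expo_peel)
  then have "\<beta> \<in> expo s" using Suc.prems by (simp add: expo_def)
  then have "\<phi> \<beta> = meval \<beta> x * \<phi> 0" using Suc.hyps \<beta>(2) by simp
  then show ?case
    using assms(1)[of \<beta> i] Suc.prems \<beta>(1) meval_add[of \<beta> "Poly_Mapping.single i 1" x] meval_single[of i x]
    by simp
qed

locale flat_moments =
  fixes y :: "('n::finite \<Rightarrow>\<^sub>0 nat) \<Rightarrow> real" and l s :: nat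
    and B :: "('n \<Rightarrow>\<^sub>0 nat) set" and N :: "'n \<Rightarrow> ('n \<Rightarrow>\<^sub>0 nat) \<Rightarrow> ('n \<Rightarrow>\<^sub>0 nat) \<Rightarrow> real"
  assumes psd: "psd_on (expo s) (moment_matrix y)"
    and ls: "l < s"
    and basis: "column_basis y l s B"
    and mult: "multiplication_matrices y s B N"
begin

lemma B_expo: "\<gamma> \<in> B \<Longrightarrow> \<gamma> \<in> expo l" "\<gamma> \<in> B \<Longrightarrow> \<gamma> \<in> expo s"
  and finite_B: "finite B"
proof -
  show "\<gamma> \<in> B \<Longrightarrow> \<gamma> \<in> expo l" for \<gamma> using basis by (auto simp: column_basis_def)
  then show "\<gamma> \<in> B \<Longrightarrow> \<gamma> \<in> expo s" for \<gamma> using expo_mono[of l s] ls by fastforce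
  show "finite B" using basis finite_subset[OF _ finite_expo] by (auto simp: column_basis_def)
qed

lemma columns_independent:
  assumes c: "\<And>\<delta>. \<delta> \<in> expo s \<Longrightarrow> (\<Sum>\<gamma>\<in>B. c \<gamma> * y (\<delta> + \<gamma>)) = 0" and "\<gamma> \<in> B"
  shows "c \<gamma> = 0"
proof -
  let ?col = "column_on (expo s) (moment_matrix y)"
  have inj: "inj_on ?col B" and ind: "fun_vs.independent (?col ` B)"
    using basis by (auto simp: column_basis_def)
  let ?u = "\<lambda>w. c (inv_into B ?col w)"
  have "(\<Sum>w\<in>?col ` B. fscale (?u w) w) = (\<Sum>\<gamma>\<in>B. fscale (c \<gamma>) (?col \<gamma>))"
    using inj by (simp add: sum.reindex)
  also have "\<dots> = 0"
    unfolding fun_eq_iff column_combination using c by simp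
  finally have "?u (?col \<gamma>) = 0"
    using fun_vs.independentD[OF ind, of "?col ` B" ?u "?col \<gamma>"] finite_B \<open>\<gamma> \<in> B\<close> by simp
  then show ?thesis using inj \<open>\<gamma> \<in> B\<close> by simp
qed

lemma gram_extend:
  "quad (expo s) (moment_matrix y) (\<lambda>\<gamma>. if \<gamma> \<in> B then c \<gamma> else 0) = (\<Sum>\<gamma>\<in>B. \<Sum>\<delta>\<in>B. c \<gamma> * y (\<gamma> + \<delta>) * c \<delta>)"
proof -
  have "quad (expo s) (moment_matrix y) (\<lambda>\<gamma>. if \<gamma> \<in> B then c \<gamma> else 0)
      = (\<Sum>\<gamma>\<in>B. \<Sum>\<delta>\<in>expo s. c \<gamma> * y (\<gamma> + \<delta>) * (if \<delta> \<in> B then c \<delta> else 0))"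
    unfolding quad_def moment_matrix_def using B_expo(2)
    by (intro sum.mono_neutral_cong_right) auto
  also have "\<dots> = (\<Sum>\<gamma>\<in>B. \<Sum>\<delta>\<in>B. c \<gamma> * y (\<gamma> + \<delta>) * c \<delta>)"
    using B_expo(2) by (intro sum.cong refl sum.mono_neutral_cong_right) auto
  finally show ?thesis .
qed

sublocale gram_form B "\<lambda>\<gamma> \<delta>. y (\<gamma> + \<delta>)"
proof
  show "finite B" by (rule finite_B)
  show "y (\<gamma> + \<delta>) = y (\<delta> + \<gamma>)" for \<gamma> \<delta> by (simp add: add.commute)
  fix c
  show "0 \<le> (\<Sum>\<gamma>\<in>B. \<Sum>\<delta>\<in>B. c \<gamma> * y (\<gamma> + \<delta>) * c \<delta>)"
    unfolding gram_extend[symmetric] by (rule quad_nonneg[OF psd])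
  fix \<gamma> assume "(\<Sum>\<gamma>\<in>B. \<Sum>\<delta>\<in>B. c \<gamma> * y (\<gamma> + \<delta>) * c \<delta>) = 0" and \<gamma>: "\<gamma> \<in> B"
  then have 0: "quad (expo s) (moment_matrix y) (\<lambda>\<gamma>. if \<gamma> \<in> B then c \<gamma> else 0) = 0"
    by (simp only: gram_extend)
  show "c \<gamma> = 0"
  proof (rule columns_independent[OF _ \<gamma>])
    fix \<delta> :: "'n \<Rightarrow>\<^sub>0 nat" assume "\<delta> \<in> expo s"
    from psd_kernel[OF psd finite_expo 0 this]
    have "(\<Sum>\<gamma>\<in>expo s. y (\<delta> + \<gamma>) * (if \<gamma> \<in> B then c \<gamma> else 0)) = 0"
      by (simp add: moment_matrix_def)
    also have "(\<Sum>\<gamma>\<in>expo s. y (\<delta> + \<gamma>) * (if \<gamma> \<in> B then c \<gamma> else 0)) = (\<Sum>\<gamma>\<in>B. c \<gamma> * y (\<delta> + \<gamma>))"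
      using B_expo(2) by (intro sum.mono_neutral_cong_right) auto
    finally show "(\<Sum>\<gamma>\<in>B. c \<gamma> * y (\<delta> + \<gamma>)) = 0" .
  qed
qed

lemma gram_nondegenerate:
  assumes c: "c \<in> V" and 0: "\<And>\<delta>. \<delta> \<in> B \<Longrightarrow> (\<Sum>\<gamma>\<in>B. c \<gamma> * y (\<delta> + \<gamma>)) = 0"
  shows "c = 0"
proof (rule ip_definite[OF _ c])
  have "ip c c = (\<Sum>\<delta>\<in>B. c \<delta> * (\<Sum>\<gamma>\<in>B. c \<gamma> * y (\<delta> + \<gamma>)))"
    by (simp add: ip_def sum_distrib_left ac_simps)
  then show "ip c c = 0" by (simp add: 0)
qed

lemma vectors_equal:
  assumes "c \<in> V" "d \<in> V" "\<And>\<delta>. \<delta> \<in> B \<Longrightarrow> (\<Sum>\<gamma>\<in>B. c \<gamma> * y (\<delta> + \<gamma>)) = (\<Sum>\<gamma>\<in>B. d \<gamma> * y (\<delta> + \<gamma>))"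
  shows "c = d"
proof -
  have "c - d = 0"
    using assms fun_vs.subspace_diff[OF subspace_V]
    by (intro gram_nondegenerate) (simp_all add: left_diff_distrib sum_subtractf)
  then show ?thesis by simp
qed

lemma coord_exists:
  assumes "\<alpha> \<in> expo s"
  shows "\<exists>c\<in>V. \<forall>\<delta>\<in>expo s. y (\<delta> + \<alpha>) = (\<Sum>\<gamma>\<in>B. c \<gamma> * y (\<delta> + \<gamma>))"
proof -
  obtain c where c: "\<And>\<delta>. \<delta> \<in> expo s \<Longrightarrow> y (\<delta> + \<alpha>) = (\<Sum>\<gamma>\<in>B. c \<gamma> * y (\<delta> + \<gamma>))"
    by (rule column_basis_coords[OF basis assms]) blast
  let ?c = "\<lambda>\<gamma>. if \<gamma> \<in> B then c \<gamma> else 0"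
  show ?thesis
  proof (intro bexI[of _ ?c] ballI)
    fix \<delta> :: "'n \<Rightarrow>\<^sub>0 nat" assume "\<delta> \<in> expo s"
    then show "y (\<delta> + \<alpha>) = (\<Sum>\<gamma>\<in>B. ?c \<gamma> * y (\<delta> + \<gamma>))" using c by simp
  qed (simp add: V_def)
qed

text \<open>The class of the monomial \<open>x\<^sup>\<alpha>\<close> modulo the kernel of the moment matrix.\<close>

definition coord :: "('n \<Rightarrow>\<^sub>0 nat) \<Rightarrow> ('n \<Rightarrow>\<^sub>0 nat) \<Rightarrow> real" where
  "coord \<alpha> = (SOME c. c \<in> V \<and> (\<forall>\<delta>\<in>expo s. y (\<delta> + \<alpha>) = (\<Sum>\<gamma>\<in>B. c \<gamma> * y (\<delta> + \<gamma>))))"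

lemma coord:
  assumes "\<alpha> \<in> expo s"
  shows "coord \<alpha> \<in> V" "\<delta> \<in> expo s \<Longrightarrow> (\<Sum>\<gamma>\<in>B. coord \<alpha> \<gamma> * y (\<delta> + \<gamma>)) = y (\<delta> + \<alpha>)"
proof -
  have "\<exists>c. c \<in> V \<and> (\<forall>\<delta>\<in>expo s. y (\<delta> + \<alpha>) = (\<Sum>\<gamma>\<in>B. c \<gamma> * y (\<delta> + \<gamma>)))"
    using coord_exists[OF assms] by blast
  from someI_ex[OF this] show "coord \<alpha> \<in> V"
    "\<delta> \<in> expo s \<Longrightarrow> (\<Sum>\<gamma>\<in>B. coord \<alpha> \<gamma> * y (\<delta> + \<gamma>)) = y (\<delta> + \<alpha>)"
    unfolding coord_def[symmetric] by auto
qed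

lemma coord_B:
  assumes "\<gamma> \<in> B"
  shows "coord \<gamma> = (\<lambda>\<delta>. if \<delta> = \<gamma> then 1 else 0)"
proof (rule vectors_equal)
  show "coord \<gamma> \<in> V" using assms B_expo coord by blast
  show "(\<lambda>\<delta>. if \<delta> = \<gamma> then 1 else 0) \<in> V" using assms by (auto simp: V_def)
  fix \<delta> assume "\<delta> \<in> B"
  then have "(\<Sum>\<gamma>'\<in>B. coord \<gamma> \<gamma>' * y (\<delta> + \<gamma>')) = y (\<delta> + \<gamma>)"
    using assms B_expo(2) coord(2) by blast
  also have "\<dots> = (\<Sum>\<gamma>'\<in>B. if \<gamma>' = \<gamma> then y (\<delta> + \<gamma>) else 0)"
    using assms finite_B by simp
  also have "\<dots> = (\<Sum>\<gamma>'\<in>B. (if \<gamma>' = \<gamma> then 1 else 0) * y (\<delta> + \<gamma>'))"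
    by (intro sum.cong refl) simp
  finally show "(\<Sum>\<gamma>'\<in>B. coord \<gamma> \<gamma>' * y (\<delta> + \<gamma>')) = (\<Sum>\<gamma>'\<in>B. (if \<gamma>' = \<gamma> then 1 else 0) * y (\<delta> + \<gamma>'))" .
qed

lemma ip_coord:
  assumes "\<alpha> \<in> expo s"
  shows "ip (coord \<alpha>) c = (\<Sum>\<delta>\<in>B. c \<delta> * y (\<delta> + \<alpha>))"
proof -
  have "ip (coord \<alpha>) c = ip c (coord \<alpha>)" by (rule ip_commute)
  also have "\<dots> = (\<Sum>\<delta>\<in>B. c \<delta> * (\<Sum>\<gamma>\<in>B. coord \<alpha> \<gamma> * y (\<delta> + \<gamma>)))"
    by (simp add: ip_def sum_distrib_left ac_simps)
  also have "\<dots> = (\<Sum>\<delta>\<in>B. c \<delta> * y (\<delta> + \<alpha>))"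
    using assms B_expo(2) by (intro sum.cong refl) (simp add: coord(2))
  finally show ?thesis .
qed

lemma ip_coord_coord: "\<alpha> \<in> expo s \<Longrightarrow> \<beta> \<in> expo s \<Longrightarrow> ip (coord \<alpha>) (coord \<beta>) = y (\<alpha> + \<beta>)"
  using coord(2)[of \<beta> \<alpha>] by (simp add: ip_coord add.commute)

lemma zero_if_orthogonal:
  assumes "c \<in> V" "\<And>\<gamma>. \<gamma> \<in> B \<Longrightarrow> ip c (coord \<gamma>) = 0"
  shows "c = 0"
proof (rule gram_nondegenerate[OF assms(1)])
  fix \<delta> assume "\<delta> \<in> B"
  then show "(\<Sum>\<gamma>\<in>B. c \<gamma> * y (\<delta> + \<gamma>)) = 0"
    using assms(2)[of \<delta>] ip_coord[of \<delta> c] B_expo(2)[of \<delta>] by (simp add: ip_commute add.commute)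
qed

text \<open>The matrices \<open>N i\<close> represent multiplication by \<open>x\<^sub>i\<close> on classes of polynomials. That this is
  symmetric and commutative is inherited from the product of polynomials.\<close>

lemma app_moment:
  assumes "\<delta> \<in> expo s"
  shows "(\<Sum>\<gamma>\<in>B. app (N i) c \<gamma> * y (\<delta> + \<gamma>)) = (\<Sum>\<beta>\<in>B. c \<beta> * y (\<delta> + (\<beta> + Poly_Mapping.single i 1)))"
proof -
  have "(\<Sum>\<gamma>\<in>B. app (N i) c \<gamma> * y (\<delta> + \<gamma>)) = (\<Sum>\<gamma>\<in>B. \<Sum>\<beta>\<in>B. c \<beta> * (N i \<gamma> \<beta> * y (\<delta> + \<gamma>)))"
    by (simp add: app_def sum_distrib_left ac_simps)
  also have "\<dots> = (\<Sum>\<beta>\<in>B. c \<beta> * (\<Sum>\<gamma>\<in>B. N i \<gamma> \<beta> * y (\<delta> + \<gamma>)))"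
    by (subst sum.swap) (simp add: sum_distrib_left)
  also have "\<dots> = (\<Sum>\<beta>\<in>B. c \<beta> * y (\<delta> + (\<beta> + Poly_Mapping.single i 1)))"
    using mult assms unfolding multiplication_matrices_iff by (intro sum.cong refl) simp
  finally show ?thesis .
qed

lemma expo_shift: "\<delta> \<in> B \<Longrightarrow> \<delta> + Poly_Mapping.single i 1 \<in> expo s"
  using B_expo(1)[of \<delta>] ls by (auto simp: expo_def mdeg_add)

lemma symmetric_commuting_N: "symmetric_commuting N"
  unfolding symmetric_commuting_def
proof (intro conjI allI ballI)
  fix i c d
  have half: "ip (app (N i) c) d = (\<Sum>\<delta>\<in>B. \<Sum>\<beta>\<in>B. d \<delta> * c \<beta> * y (\<delta> + \<beta> + Poly_Mapping.single i 1))" for c d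
  proof -
    have "ip (app (N i) c) d = ip d (app (N i) c)" by (rule ip_commute)
    also have "\<dots> = (\<Sum>\<delta>\<in>B. d \<delta> * (\<Sum>\<gamma>\<in>B. app (N i) c \<gamma> * y (\<delta> + \<gamma>)))"
      by (simp add: ip_def sum_distrib_left ac_simps)
    also have "\<dots> = (\<Sum>\<delta>\<in>B. d \<delta> * (\<Sum>\<beta>\<in>B. c \<beta> * y (\<delta> + (\<beta> + Poly_Mapping.single i 1))))"
      using B_expo(2) by (intro sum.cong refl) (simp only: app_moment)
    finally show ?thesis by (simp add: sum_distrib_left ac_simps)
  qed
  have "ip (app (N i) c) d = (\<Sum>\<delta>\<in>B. \<Sum>\<beta>\<in>B. d \<delta> * c \<beta> * y (\<delta> + \<beta> + Poly_Mapping.single i 1))"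
    by (rule half)
  also have "\<dots> = (\<Sum>\<beta>\<in>B. \<Sum>\<delta>\<in>B. c \<beta> * d \<delta> * y (\<beta> + \<delta> + Poly_Mapping.single i 1))"
    by (subst sum.swap) (simp add: ac_simps)
  also have "\<dots> = ip (app (N i) d) c" by (rule half[symmetric])
  finally show "ip (app (N i) c) d = ip c (app (N i) d)" by (simp add: ip_commute)
next
  fix i j c
  have "(\<Sum>\<gamma>\<in>B. app (N i) (app (N j) c) \<gamma> * y (\<delta> + \<gamma>))
      = (\<Sum>\<beta>\<in>B. c \<beta> * y (\<delta> + (\<beta> + (Poly_Mapping.single i 1 + Poly_Mapping.single j 1))))"
    if "\<delta> \<in> B" for \<delta> i j
  proof -
    have "(\<Sum>\<gamma>\<in>B. app (N i) (app (N j) c) \<gamma> * y (\<delta> + \<gamma>))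
        = (\<Sum>\<gamma>\<in>B. app (N j) c \<gamma> * y ((\<delta> + Poly_Mapping.single i 1) + \<gamma>))"
      using that B_expo(2) by (subst app_moment) (auto simp: ac_simps)
    also have "\<dots> = (\<Sum>\<beta>\<in>B. c \<beta> * y ((\<delta> + Poly_Mapping.single i 1) + (\<beta> + Poly_Mapping.single j 1)))"
      by (rule app_moment[OF expo_shift[OF that]])
    finally show ?thesis by (simp add: ac_simps)
  qed
  note pair = this
  show "app (N i) (app (N j) c) = app (N j) (app (N i) c)"
  proof (rule vectors_equal)
    fix \<delta> assume \<delta>: "\<delta> \<in> B"
    show "(\<Sum>\<gamma>\<in>B. app (N i) (app (N j) c) \<gamma> * y (\<delta> + \<gamma>)) = (\<Sum>\<gamma>\<in>B. app (N j) (app (N i) c) \<gamma> * y (\<delta> + \<gamma>))"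
      unfolding pair[OF \<delta>]
      by (subst add.commute[of "Poly_Mapping.single i 1" "Poly_Mapping.single j 1"]) (rule refl)
  qed simp_all
qed

lemma app_coord:
  assumes "\<alpha> + Poly_Mapping.single i 1 \<in> expo s"
  shows "app (N i) (coord \<alpha>) = coord (\<alpha> + Poly_Mapping.single i 1)"
proof (rule vectors_equal)
  have \<alpha>: "\<alpha> \<in> expo s" using assms by (simp add: expo_def mdeg_add)
  show "coord (\<alpha> + Poly_Mapping.single i 1) \<in> V" by (rule coord(1)[OF assms])
  fix \<delta> assume \<delta>: "\<delta> \<in> B"
  have "(\<Sum>\<gamma>\<in>B. app (N i) (coord \<alpha>) \<gamma> * y (\<delta> + \<gamma>))
      = (\<Sum>\<gamma>\<in>B. coord \<alpha> \<gamma> * y ((\<delta> + Poly_Mapping.single i 1) + \<gamma>))"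
    using \<delta> B_expo(2) by (subst app_moment) (auto simp: ac_simps)
  also have "\<dots> = y ((\<delta> + Poly_Mapping.single i 1) + \<alpha>)"
    by (rule coord(2)[OF \<alpha> expo_shift[OF \<delta>]])
  also have "\<dots> = (\<Sum>\<gamma>\<in>B. coord (\<alpha> + Poly_Mapping.single i 1) \<gamma> * y (\<delta> + \<gamma>))"
    using coord(2)[OF assms B_expo(2)[OF \<delta>]] by (simp add: ac_simps)
  finally show "(\<Sum>\<gamma>\<in>B. app (N i) (coord \<alpha>) \<gamma> * y (\<delta> + \<gamma>))
      = (\<Sum>\<gamma>\<in>B. coord (\<alpha> + Poly_Mapping.single i 1) \<gamma> * y (\<delta> + \<gamma>))" .
qed simp

end


section \<open>Atoms of a flat moment matrix\<close>

context flat_moments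
begin

definition eigenpair :: "real^'n \<Rightarrow> (('n \<Rightarrow>\<^sub>0 nat) \<Rightarrow> real) \<Rightarrow> bool" where
  "eigenpair \<xi> v \<longleftrightarrow> v \<in> V \<and> (\<forall>i. app (N i) v = fscale (\<xi> $ i) v)"

text \<open>The joint eigenvalues, collected into points. They turn out to be the atoms.\<close>

definition Z :: "(real^'n) set" where
  "Z = {\<xi>. \<exists>v. eigenpair \<xi> v \<and> v \<noteq> 0}"

lemma app_symmetric: "c \<in> V \<Longrightarrow> d \<in> V \<Longrightarrow> ip (app (N i) c) d = ip c (app (N i) d)"
  using symmetric_commuting_N by (simp add: symmetric_commuting_def)

text \<open>An eigenvector is determined by its product with the class of 1, because the monomials are obtained
  from 1 by applying the operators.\<close>

lemma eigenpair_ip_coord: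
  assumes "eigenpair \<xi> v" "\<alpha> \<in> expo s"
  shows "ip v (coord \<alpha>) = meval \<alpha> \<xi> * ip v (coord 0)"
proof (rule multiplicative_on_expo[OF _ assms(2)])
  fix \<alpha> :: "'n \<Rightarrow>\<^sub>0 nat" and i assume \<alpha>: "\<alpha> + Poly_Mapping.single i 1 \<in> expo s"
  then have "coord \<alpha> \<in> V" by (intro coord(1)) (simp add: expo_def mdeg_add)
  then have "ip v (app (N i) (coord \<alpha>)) = ip (app (N i) v) (coord \<alpha>)"
    using assms(1) unfolding eigenpair_def by (intro app_symmetric[symmetric]) auto
  then show "ip v (coord (\<alpha> + Poly_Mapping.single i 1)) = \<xi> $ i * ip v (coord \<alpha>)"
    using assms(1) by (simp only: app_coord[OF \<alpha>] eigenpair_def ip_scale_left)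
qed

lemma eigenpair_unique:
  assumes v: "eigenpair \<xi> v" and u: "eigenpair \<xi> u" and "ip u (coord 0) = 1"
  shows "v = fscale (ip v (coord 0)) u"
proof -
  let ?d = "v - fscale (ip v (coord 0)) u"
  have "?d = 0"
  proof (rule zero_if_orthogonal)
    show "?d \<in> V"
      using v u unfolding eigenpair_def
      by (intro fun_vs.subspace_diff[OF subspace_V] fun_vs.subspace_scale[OF subspace_V]) auto
    fix \<gamma> assume "\<gamma> \<in> B"
    then show "ip ?d (coord \<gamma>) = 0"
      using eigenpair_ip_coord[OF v, of \<gamma>] eigenpair_ip_coord[OF u, of \<gamma>] B_expo(2) assms(3)
      by (simp add: ip_diff_left ip_scale_left)
  qed
  then show ?thesis by simp
qed

lemma normalized_eigenvector_exists:
  assumes "\<xi> \<in> Z" shows "\<exists>u. eigenpair \<xi> u \<and> ip u (coord 0) = 1"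
proof -
  obtain v where v: "eigenpair \<xi> v" "v \<noteq> 0" using assms by (auto simp: Z_def)
  have "ip v (coord 0) \<noteq> 0"
  proof
    assume 0: "ip v (coord 0) = 0"
    have "ip v (coord \<gamma>) = 0" if "\<gamma> \<in> B" for \<gamma>
      using eigenpair_ip_coord[OF v(1), of \<gamma>] B_expo(2)[OF that] 0 by simp
    then have "v = 0"
      using v(1) by (intro zero_if_orthogonal) (simp_all add: eigenpair_def)
    then show False using v(2) by simp
  qed
  moreover have "eigenpair \<xi> (fscale a v)" for a
    unfolding eigenpair_def
  proof (intro conjI allI)
    show "fscale a v \<in> V"
      using v(1) by (intro fun_vs.subspace_scale[OF subspace_V]) (simp add: eigenpair_def)
    fix i
    have "app (N i) v = fscale (\<xi> $ i) v" using v(1) by (simp add: eigenpair_def)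
    then show "app (N i) (fscale a v) = fscale (\<xi> $ i) (fscale a v)"
      by (simp only: app_scale) (rule fun_vs.scale_left_commute)
  qed
  ultimately have "eigenpair \<xi> (fscale (1 / ip v (coord 0)) v) \<and>
      ip (fscale (1 / ip v (coord 0)) v) (coord 0) = 1"
    by (simp add: ip_scale_left)
  then show ?thesis by blast
qed

text \<open>The normalization makes the product with the class of a monomial equal to the value of that monomial
  at \<open>\<xi>\<close>.\<close>

definition u :: "real^'n \<Rightarrow> ('n \<Rightarrow>\<^sub>0 nat) \<Rightarrow> real" where
  "u \<xi> = (SOME u. eigenpair \<xi> u \<and> ip u (coord 0) = 1)"

lemma u:
  assumes "\<xi> \<in> Z"
  shows "eigenpair \<xi> (u \<xi>)" "ip (u \<xi>) (coord 0) = 1" "u \<xi> \<in> V"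
  using someI_ex[OF normalized_eigenvector_exists[OF assms]]
  unfolding u_def[symmetric] by (auto simp: eigenpair_def)

lemma ip_u_coord: "\<xi> \<in> Z \<Longrightarrow> \<alpha> \<in> expo s \<Longrightarrow> ip (u \<xi>) (coord \<alpha>) = meval \<alpha> \<xi>"
  using eigenpair_ip_coord[OF u(1), of \<xi> \<alpha>] u(2) by simp

lemma u_pos: "\<xi> \<in> Z \<Longrightarrow> 0 < ip (u \<xi>) (u \<xi>)"
  using u[of \<xi>] by (intro ip_pos) auto

lemma u_orthogonal:
  assumes "\<xi> \<in> Z" "\<eta> \<in> Z" "\<xi> \<noteq> \<eta>"
  shows "ip (u \<xi>) (u \<eta>) = 0"
proof -
  obtain i where i: "\<xi> $ i \<noteq> \<eta> $ i" using assms(3) by (auto simp: vec_eq_iff)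
  have "ip (app (N i) (u \<xi>)) (u \<eta>) = ip (u \<xi>) (app (N i) (u \<eta>))"
    using u(3) assms by (intro app_symmetric)
  then have "\<xi> $ i * ip (u \<xi>) (u \<eta>) = \<eta> $ i * ip (u \<xi>) (u \<eta>)"
    using u(1) assms by (simp add: eigenpair_def ip_scale_left ip_scale_right)
  then show ?thesis using i by simp
qed

lemma u_inj: "inj_on u Z"
proof (rule inj_onI, rule ccontr)
  fix \<xi> \<eta> assume "\<xi> \<in> Z" "\<eta> \<in> Z" "u \<xi> = u \<eta>" "\<xi> \<noteq> \<eta>"
  then show False using u_orthogonal[of \<xi> \<eta>] u_pos[of \<eta>] by simp
qed

lemma u_independent: "fun_vs.independent (u ` Z)"
  unfolding fun_vs.independent_explicit_finite_subsets
proof (intro allI impI ballI)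
  fix S c w assume S: "S \<subseteq> u ` Z" "finite S" "(\<Sum>v\<in>S. fscale (c v) v) = 0" and w: "w \<in> S"
  have "0 = ip (\<Sum>v\<in>S. fscale (c v) v) w" unfolding S(3) by simp
  also have "\<dots> = (\<Sum>v\<in>S. c v * ip v w)" by (simp only: ip_sum_left ip_scale_left)
  also have "\<dots> = (\<Sum>v\<in>S. if v = w then c w * ip w w else 0)"
  proof (intro sum.cong refl)
    fix v assume "v \<in> S"
    then obtain \<xi> \<eta> where "v = u \<xi>" "w = u \<eta>" "\<xi> \<in> Z" "\<eta> \<in> Z" using S(1) w by blast
    then show "c v * ip v w = (if v = w then c w * ip w w else 0)"
      using u_orthogonal[of \<xi> \<eta>] by (cases "\<xi> = \<eta>") auto
  qed
  also have "\<dots> = c w * ip w w" using S(2) w by simp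
  finally have "c w * ip w w = 0" by simp
  moreover obtain \<eta> where "w = u \<eta>" "\<eta> \<in> Z" using S(1) w by blast
  ultimately show "c w = 0" using u_pos[of \<eta>] by simp
qed

abbreviation unit_vec :: "('n \<Rightarrow>\<^sub>0 nat) \<Rightarrow> ('n \<Rightarrow>\<^sub>0 nat) \<Rightarrow> real" where
  "unit_vec \<gamma> \<equiv> (\<lambda>\<delta>. if \<delta> = \<gamma> then 1 else 0)"

lemma V_span_unit: "V \<subseteq> fun_vs.span (unit_vec ` B)"
proof
  fix c assume c: "c \<in> V"
  have "c = (\<Sum>\<gamma>\<in>B. fscale (c \<gamma>) (unit_vec \<gamma>))"
    using c finite_B by (intro ext) (simp add: sum_fun_apply fscale_def V_def if_distrib cong: if_cong)
  also have "\<dots> \<in> fun_vs.span (unit_vec ` B)"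
    by (intro fun_vs.span_sum fun_vs.span_scale) (auto intro: fun_vs.span_base)
  finally show "c \<in> fun_vs.span (unit_vec ` B)" .
qed

lemma finite_Z: "finite Z" and card_Z_le: "card Z \<le> card B"
proof -
  have "u ` Z \<subseteq> fun_vs.span (unit_vec ` B)" using u(3) V_span_unit by blast
  then have *: "finite (u ` Z) \<and> card (u ` Z) \<le> card (unit_vec ` B)"
    using finite_B by (intro fun_vs.independent_span_bound u_independent) auto
  then show "finite Z" using finite_imageD u_inj by blast
  show "card Z \<le> card B"
    using * card_image[OF u_inj] card_image_le[OF finite_B, of unit_vec] by simp
qed

text \<open>The joint eigenvectors form an orthogonal basis.\<close>

lemma u_expansion:
  assumes c: "c \<in> V"
  shows "c = (\<Sum>\<xi>\<in>Z. fscale (ip c (u \<xi>) / ip (u \<xi>) (u \<xi>)) (u \<xi>))" (is "_ = ?p")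
proof -
  have p: "ip ?p (u \<eta>) = ip c (u \<eta>)" if \<eta>: "\<eta> \<in> Z" for \<eta>
  proof -
    have "ip ?p (u \<eta>) = (\<Sum>\<xi>\<in>Z. ip c (u \<xi>) / ip (u \<xi>) (u \<xi>) * ip (u \<xi>) (u \<eta>))"
      by (simp only: ip_sum_left ip_scale_left)
    also have "\<dots> = (\<Sum>\<xi>\<in>Z. if \<xi> = \<eta> then ip c (u \<eta>) else 0)"
    proof (intro sum.cong refl)
      fix \<xi> assume "\<xi> \<in> Z"
      then show "ip c (u \<xi>) / ip (u \<xi>) (u \<xi>) * ip (u \<xi>) (u \<eta>) = (if \<xi> = \<eta> then ip c (u \<eta>) else 0)"
        using u_orthogonal[of \<xi> \<eta>] u_pos[OF \<eta>] \<eta> by (cases "\<xi> = \<eta>") simp_all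
    qed
    also have "\<dots> = ip c (u \<eta>)" using \<eta> finite_Z by simp
    finally show ?thesis .
  qed
  have "c - ?p = 0"
  proof (rule joint_eigenvectors_complete[OF symmetric_commuting_N])
    show "c - ?p \<in> V"
      using c u(3)
      by (intro fun_vs.subspace_diff[OF subspace_V] fun_vs.subspace_sum[OF subspace_V]
          fun_vs.subspace_scale[OF subspace_V]) auto
    fix v x assume v: "v \<in> V" "\<And>k. app (N k) v = fscale (x k) v"
    then have pair: "eigenpair (\<chi> k. x k) v" by (simp add: eigenpair_def)
    show "ip (c - ?p) v = 0"
    proof (cases "v = 0")
      case True
      show ?thesis unfolding True by (subst ip_commute) (rule ip_zero_left)
    next
      case False
      then have Z: "(\<chi> k. x k) \<in> Z" using pair by (auto simp: Z_def)
      have "v = fscale (ip v (coord 0)) (u (\<chi> k. x k))"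
        by (rule eigenpair_unique[OF pair u(1,2)[OF Z]])
      then have "ip (c - ?p) v = ip (c - ?p) (fscale (ip v (coord 0)) (u (\<chi> k. x k)))"
        by (rule arg_cong)
      also have "\<dots> = ip v (coord 0) * (ip c (u (\<chi> k. x k)) - ip ?p (u (\<chi> k. x k)))"
        by (simp only: ip_scale_right ip_diff_left)
      also have "\<dots> = 0" by (simp only: p[OF Z] diff_self mult_zero_right)
      finally show ?thesis .
    qed
  qed
  then show ?thesis by simp
qed

lemma card_Z: "card Z = card B"
proof (rule antisym[OF card_Z_le])
  have inj: "inj_on unit_vec B" by (rule inj_onI) (metis zero_neq_one)
  have "fun_vs.independent (unit_vec ` B)"
  proof (rule fun_vs.independent_if_scalars_zero)
    show "finite (unit_vec ` B)" using finite_B by simp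
    fix h w assume h: "(\<Sum>v\<in>unit_vec ` B. fscale (h v) v) = 0" and "w \<in> unit_vec ` B"
    then obtain \<gamma> where \<gamma>: "\<gamma> \<in> B" "w = unit_vec \<gamma>" by blast
    have "0 = (\<Sum>\<delta>\<in>B. fscale (h (unit_vec \<delta>)) (unit_vec \<delta>)) \<gamma>"
      using h inj by (simp add: sum.reindex)
    also have "\<dots> = h (unit_vec \<gamma>)"
      using \<gamma>(1) finite_B by (simp add: sum_fun_apply fscale_def if_distrib cong: if_cong)
    finally show "h w = 0" using \<gamma>(2) by simp
  qed
  moreover have "unit_vec ` B \<subseteq> fun_vs.span (u ` Z)"
  proof clarify
    fix \<gamma> assume "\<gamma> \<in> B"
    then have "unit_vec \<gamma> \<in> V" by (auto simp: V_def)
    then have "unit_vec \<gamma> = (\<Sum>\<xi>\<in>Z. fscale (ip (unit_vec \<gamma>) (u \<xi>) / ip (u \<xi>) (u \<xi>)) (u \<xi>))"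
      by (rule u_expansion)
    also have "\<dots> \<in> fun_vs.span (u ` Z)"
      by (intro fun_vs.span_sum fun_vs.span_scale) (auto intro: fun_vs.span_base)
    finally show "unit_vec \<gamma> \<in> fun_vs.span (u ` Z)" .
  qed
  ultimately have "card (unit_vec ` B) \<le> card (u ` Z)"
    using finite_Z fun_vs.independent_span_bound[of "u ` Z" "unit_vec ` B"] by blast
  then show "card B \<le> card Z"
    using card_image[OF inj] card_image_le[OF finite_Z, of u] by simp
qed

definition weight :: "real^'n \<Rightarrow> real" where
  "weight \<xi> = 1 / ip (u \<xi>) (u \<xi>)"

lemma weight_pos: "\<xi> \<in> Z \<Longrightarrow> 0 < weight \<xi>"
  using u_pos by (simp add: weight_def)

text \<open>Parseval's identity in the basis of joint eigenvectors is an atomic representation of the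
  moments.\<close>

lemma atomic_representation:
  assumes "\<gamma> \<in> expo (2 * s)"
  shows "y \<gamma> = (\<Sum>\<xi>\<in>Z. weight \<xi> * meval \<gamma> \<xi>)"
proof -
  obtain \<alpha> \<beta> where \<gamma>: "\<gamma> = \<alpha> + \<beta>" and \<alpha>: "\<alpha> \<in> expo s" and \<beta>: "\<beta> \<in> expo s"
    using assms expo_split[of \<gamma> s s] by (auto simp: mult_2)
  have "y \<gamma> = ip (coord \<alpha>) (coord \<beta>)" using ip_coord_coord[OF \<alpha> \<beta>] \<gamma> by simp
  also have "\<dots> = ip (\<Sum>\<xi>\<in>Z. fscale (ip (coord \<alpha>) (u \<xi>) / ip (u \<xi>) (u \<xi>)) (u \<xi>)) (coord \<beta>)"
    using u_expansion[OF coord(1)[OF \<alpha>]] by (rule arg_cong)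
  also have "\<dots> = (\<Sum>\<xi>\<in>Z. ip (coord \<alpha>) (u \<xi>) / ip (u \<xi>) (u \<xi>) * ip (u \<xi>) (coord \<beta>))"
    by (simp only: ip_sum_left ip_scale_left)
  also have "\<dots> = (\<Sum>\<xi>\<in>Z. weight \<xi> * meval \<gamma> \<xi>)"
    using \<alpha> \<beta> by (intro sum.cong refl)
      (simp add: ip_commute[of "coord \<alpha>"] ip_u_coord weight_def \<gamma> meval_add)
  finally show ?thesis .
qed

text \<open>Read as a polynomial of degree at most \<open>l\<close>, the eigenvector \<open>u \<xi>\<close> vanishes at the other atoms.
  Testing the localizing matrix on it therefore isolates the value of \<open>q\<close> at \<open>\<xi>\<close>.\<close>

lemma localizing_nonneg:
  assumes loc: "psd_on (expo l) (localizing_matrix q y)" and deg: "2 * l + pdeg q \<le> 2 * s"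
    and \<xi>: "\<xi> \<in> Z"
  shows "0 \<le> peval q \<xi>"
proof -
  let ?c = "u \<xi>"
  define P where "P \<eta> = (\<Sum>\<alpha>\<in>expo l. ?c \<alpha> * meval \<alpha> \<eta>)" for \<eta>
  have P: "P \<eta> = ip (u \<eta>) (u \<xi>)" if \<eta>: "\<eta> \<in> Z" for \<eta>
  proof -
    have "P \<eta> = (\<Sum>\<alpha>\<in>B. ?c \<alpha> * meval \<alpha> \<eta>)"
      unfolding P_def using B_expo(1) u(3)[OF \<xi>]
      by (intro sum.mono_neutral_right) (auto simp: V_def)
    also have "\<dots> = (\<Sum>\<alpha>\<in>B. ?c \<alpha> * ip (coord \<alpha>) (u \<eta>))"
      using B_expo(2) \<eta> by (intro sum.cong refl) (simp add: ip_commute[of "coord _"] ip_u_coord)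
    also have "\<dots> = (\<Sum>\<alpha>\<in>B. ?c \<alpha> * (\<Sum>\<delta>\<in>B. u \<eta> \<delta> * y (\<delta> + \<alpha>)))"
      using B_expo(2) by (intro sum.cong refl) (simp add: ip_coord)
    also have "\<dots> = ip (u \<xi>) (u \<eta>)"
      by (simp add: ip_def sum_distrib_left ac_simps)
    finally show ?thesis by (simp add: ip_commute)
  qed
  have entry: "localizing_matrix q y \<alpha> \<beta> = (\<Sum>\<eta>\<in>Z. weight \<eta> * peval q \<eta> * (meval \<alpha> \<eta> * meval \<beta> \<eta>))"
    if "\<alpha> \<in> expo l" "\<beta> \<in> expo l" for \<alpha> \<beta>
  proof -
    have "\<alpha> + \<beta> + \<gamma> \<in> expo (2 * s)" if "\<gamma> \<in> Poly_Mapping.keys q" for \<gamma>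
    proof -
      have "\<gamma> \<in> expo (pdeg q)" using polys_upto_pdeg[of q "pdeg q"] that by (auto simp: polys_upto_iff)
      then show ?thesis
        using \<open>\<alpha> \<in> expo l\<close> \<open>\<beta> \<in> expo l\<close> deg by (auto simp: expo_def mdeg_add)
    qed
    then have "localizing_matrix q y \<alpha> \<beta>
        = (\<Sum>\<gamma>\<in>Poly_Mapping.keys q. \<Sum>\<eta>\<in>Z. weight \<eta> * (lookup q \<gamma> * meval \<gamma> \<eta>) * (meval \<alpha> \<eta> * meval \<beta> \<eta>))"
      unfolding localizing_matrix_def
      by (intro sum.cong refl) (simp add: atomic_representation sum_distrib_left meval_add ac_simps)
    then show ?thesis
      by (subst (asm) sum.swap) (simp add: peval_def sum_distrib_left sum_distrib_right)
  qed
  have "0 \<le> (\<Sum>\<alpha>\<in>expo l. \<Sum>\<beta>\<in>expo l. ?c \<alpha> * localizing_matrix q y \<alpha> \<beta> * ?c \<beta>)"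
    using loc by (simp add: psd_on_def)
  also have "\<dots> = (\<Sum>\<alpha>\<in>expo l. \<Sum>\<beta>\<in>expo l. \<Sum>\<eta>\<in>Z.
      weight \<eta> * peval q \<eta> * ((?c \<alpha> * meval \<alpha> \<eta>) * (?c \<beta> * meval \<beta> \<eta>)))"
    by (intro sum.cong refl) (simp add: entry sum_distrib_left sum_distrib_right ac_simps)
  also have "\<dots> = (\<Sum>\<alpha>\<in>expo l. \<Sum>\<eta>\<in>Z. \<Sum>\<beta>\<in>expo l.
      weight \<eta> * peval q \<eta> * ((?c \<alpha> * meval \<alpha> \<eta>) * (?c \<beta> * meval \<beta> \<eta>)))"
    by (intro sum.cong refl sum.swap)
  also have "\<dots> = (\<Sum>\<eta>\<in>Z. \<Sum>\<alpha>\<in>expo l. \<Sum>\<beta>\<in>expo l.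
      weight \<eta> * peval q \<eta> * ((?c \<alpha> * meval \<alpha> \<eta>) * (?c \<beta> * meval \<beta> \<eta>)))"
    by (rule sum.swap)
  also have "\<dots> = (\<Sum>\<eta>\<in>Z. weight \<eta> * peval q \<eta> * (P \<eta> * P \<eta>))"
    unfolding P_def sum_product by (simp add: sum_distrib_left)
  also have "\<dots> = (\<Sum>\<eta>\<in>Z. if \<eta> = \<xi> then weight \<xi> * peval q \<xi> * (P \<xi> * P \<xi>) else 0)"
    using P u_orthogonal \<xi> by (intro sum.cong refl) auto
  also have "\<dots> = peval q \<xi> * (weight \<xi> * (P \<xi> * P \<xi>))"
    using \<xi> finite_Z by simp
  finally have "0 \<le> peval q \<xi> * (weight \<xi> * (P \<xi> * P \<xi>))" .
  moreover have "0 < weight \<xi> * (P \<xi> * P \<xi>)"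
    using weight_pos[OF \<xi>] P[OF \<xi>] u_pos[OF \<xi>] by simp
  ultimately show ?thesis by (simp add: zero_le_mult_iff)
qed

text \<open>A linear relation between columns is a kernel element, so it also holds between the values of the
  monomials at a point of the kernel variety.\<close>

lemma kernel_variety_relation:
  assumes x: "x \<in> kernel_variety y s" and \<alpha>: "\<alpha> \<in> expo s"
    and rel: "\<And>\<delta>. \<delta> \<in> expo s \<Longrightarrow> y (\<delta> + \<alpha>) = (\<Sum>\<gamma>\<in>B. a \<gamma> * y (\<delta> + \<gamma>))"
  shows "meval \<alpha> x = (\<Sum>\<gamma>\<in>B. a \<gamma> * meval \<gamma> x)"
proof -
  let ?c = "\<lambda>\<beta>. (if \<beta> = \<alpha> then 1 else 0) - (if \<beta> \<in> B then a \<beta> else 0)"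
  have sum: "(\<Sum>\<beta>\<in>expo s. ?c \<beta> * h \<beta>) = h \<alpha> - (\<Sum>\<gamma>\<in>B. a \<gamma> * h \<gamma>)" for h
  proof -
    have "(\<Sum>\<beta>\<in>expo s. ?c \<beta> * h \<beta>)
        = (\<Sum>\<beta>\<in>expo s. if \<beta> = \<alpha> then h \<beta> else 0) - (\<Sum>\<beta>\<in>expo s. if \<beta> \<in> B then a \<beta> * h \<beta> else 0)"
      unfolding sum_subtractf[symmetric] by (intro sum.cong refl) (simp add: left_diff_distrib)
    moreover have "(\<Sum>\<beta>\<in>expo s. if \<beta> \<in> B then a \<beta> * h \<beta> else 0) = (\<Sum>\<gamma>\<in>B. a \<gamma> * h \<gamma>)"
      using B_expo(2) by (intro sum.mono_neutral_cong_right) auto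
    ultimately show ?thesis using \<alpha> by simp
  qed
  have "\<forall>\<delta>\<in>expo s. (\<Sum>\<beta>\<in>expo s. ?c \<beta> * y (\<delta> + \<beta>)) = 0"
    unfolding sum using rel by simp
  with spec[of _ ?c, OF x[unfolded kernel_variety_def mem_Collect_eq]]
  have "(\<Sum>\<beta>\<in>expo s. ?c \<beta> * meval \<beta> x) = 0" by (rule mp)
  then show ?thesis unfolding sum by simp
qed

lemma kernel_variety_basis_nonzero:
  assumes "x \<in> kernel_variety y s"
  shows "\<exists>\<gamma>\<in>B. meval \<gamma> x \<noteq> 0"
proof (rule ccontr)
  assume "\<not> ?thesis"
  moreover have "meval 0 x = (\<Sum>\<gamma>\<in>B. coord 0 \<gamma> * meval \<gamma> x)"
    by (rule kernel_variety_relation[OF assms]) (simp_all add: coord(2)[OF zero_in_expo])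
  ultimately show False by simp
qed

text \<open>Evaluation at a point of the kernel variety is a left eigenvector of the multiplication matrices;
  conversely a left eigenvector extends to a multiplicative functional on all monomials that
  annihilates the kernel.\<close>

lemma joint_eigenvalues_eq: "joint_eigenvalues B N = kernel_variety y s"
proof (intro equalityI subsetI)
  fix x assume x: "x \<in> kernel_variety y s"
  have "(\<Sum>\<gamma>\<in>B. meval \<gamma> x * N i \<gamma> \<beta>) = x $ i * meval \<beta> x" if \<beta>: "\<beta> \<in> B" for i \<beta>
  proof -
    have "meval (\<beta> + Poly_Mapping.single i 1) x = (\<Sum>\<gamma>\<in>B. N i \<gamma> \<beta> * meval \<gamma> x)"
      using mult \<beta> unfolding multiplication_matrices_iff
      by (intro kernel_variety_relation[OF x expo_shift[OF \<beta>]]) blast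
    then show ?thesis
      using meval_single[of i x] by (simp only: meval_add mult.commute)
  qed
  then show "x \<in> joint_eigenvalues B N"
    using kernel_variety_basis_nonzero[OF x] unfolding joint_eigenvalues_def
    by (intro CollectI exI[of _ "\<lambda>\<gamma>. meval \<gamma> x"]) blast
next
  fix x assume "x \<in> joint_eigenvalues B N"
  then obtain w where nz: "\<exists>\<beta>\<in>B. w \<beta> \<noteq> 0"
    and w: "\<And>i \<beta>. \<beta> \<in> B \<Longrightarrow> (\<Sum>\<gamma>\<in>B. w \<gamma> * N i \<gamma> \<beta>) = x $ i * w \<beta>"
    by (auto simp: joint_eigenvalues_def)
  define \<phi> where "\<phi> \<alpha> = (\<Sum>\<gamma>\<in>B. coord \<alpha> \<gamma> * w \<gamma>)" for \<alpha>
  have \<phi>: "\<phi> \<alpha> = meval \<alpha> x * \<phi> 0" if "\<alpha> \<in> expo s" for \<alpha>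
  proof (rule multiplicative_on_expo[OF _ that])
    fix \<alpha> :: "'n \<Rightarrow>\<^sub>0 nat" and i assume \<alpha>: "\<alpha> + Poly_Mapping.single i 1 \<in> expo s"
    have "\<phi> (\<alpha> + Poly_Mapping.single i 1) = (\<Sum>\<gamma>\<in>B. app (N i) (coord \<alpha>) \<gamma> * w \<gamma>)"
      by (simp only: \<phi>_def app_coord[OF \<alpha>])
    also have "\<dots> = (\<Sum>\<gamma>\<in>B. \<Sum>\<beta>\<in>B. coord \<alpha> \<beta> * (w \<gamma> * N i \<gamma> \<beta>))"
      by (simp add: app_def sum_distrib_left ac_simps)
    also have "\<dots> = (\<Sum>\<beta>\<in>B. coord \<alpha> \<beta> * (\<Sum>\<gamma>\<in>B. w \<gamma> * N i \<gamma> \<beta>))"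
      by (subst sum.swap) (simp add: sum_distrib_left)
    also have "\<dots> = x $ i * \<phi> \<alpha>"
      unfolding \<phi>_def sum_distrib_left[of "x $ i"]
      by (intro sum.cong refl) (simp only: w mult.left_commute)
    finally show "\<phi> (\<alpha> + Poly_Mapping.single i 1) = x $ i * \<phi> \<alpha>" .
  qed
  have \<phi>_B: "\<phi> \<gamma> = w \<gamma>" if "\<gamma> \<in> B" for \<gamma>
  proof -
    have "\<phi> \<gamma> = (\<Sum>\<delta>\<in>B. if \<delta> = \<gamma> then w \<gamma> else 0)"
      unfolding \<phi>_def coord_B[OF that] by (intro sum.cong refl) simp
    then show ?thesis using that finite_B by simp
  qed
  obtain \<gamma> where "\<gamma> \<in> B" "w \<gamma> \<noteq> 0" using nz by blast
  then have "\<phi> 0 \<noteq> 0" using \<phi>_B[of \<gamma>] \<phi>[OF B_expo(2), of \<gamma>] by auto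
  show "x \<in> kernel_variety y s"
    unfolding kernel_variety_def
  proof (intro CollectI allI impI)
    fix c assume c: "\<forall>\<delta>\<in>expo s. (\<Sum>\<alpha>\<in>expo s. c \<alpha> * y (\<delta> + \<alpha>)) = 0"
    let ?v = "\<Sum>\<alpha>\<in>expo s. fscale (c \<alpha>) (coord \<alpha>)"
    have "?v = 0"
    proof (rule gram_nondegenerate)
      show "?v \<in> V"
        using coord(1) by (intro fun_vs.subspace_sum[OF subspace_V] fun_vs.subspace_scale[OF subspace_V])
      fix \<delta> assume \<delta>: "\<delta> \<in> B"
      have "(\<Sum>\<gamma>\<in>B. ?v \<gamma> * y (\<delta> + \<gamma>)) = (\<Sum>\<gamma>\<in>B. \<Sum>\<alpha>\<in>expo s. c \<alpha> * (coord \<alpha> \<gamma> * y (\<delta> + \<gamma>)))"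
        by (simp add: sum_fun_apply fscale_def sum_distrib_right mult.assoc)
      also have "\<dots> = (\<Sum>\<alpha>\<in>expo s. c \<alpha> * (\<Sum>\<gamma>\<in>B. coord \<alpha> \<gamma> * y (\<delta> + \<gamma>)))"
        by (subst sum.swap) (simp add: sum_distrib_left)
      also have "\<dots> = (\<Sum>\<alpha>\<in>expo s. c \<alpha> * y (\<delta> + \<alpha>))"
        using B_expo(2)[OF \<delta>] by (intro sum.cong refl) (simp add: coord(2))
      finally show "(\<Sum>\<gamma>\<in>B. ?v \<gamma> * y (\<delta> + \<gamma>)) = 0" using c B_expo(2)[OF \<delta>] by simp
    qed
    then have "(\<Sum>\<gamma>\<in>B. ?v \<gamma> * w \<gamma>) = 0" by simp
    moreover have "(\<Sum>\<gamma>\<in>B. ?v \<gamma> * w \<gamma>) = (\<Sum>\<gamma>\<in>B. \<Sum>\<alpha>\<in>expo s. c \<alpha> * (coord \<alpha> \<gamma> * w \<gamma>))"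
      by (simp add: sum_fun_apply fscale_def sum_distrib_right mult.assoc)
    moreover have "\<dots> = (\<Sum>\<alpha>\<in>expo s. c \<alpha> * \<phi> \<alpha>)"
      by (subst sum.swap) (simp add: sum_distrib_left \<phi>_def)
    moreover have "\<dots> = (\<Sum>\<alpha>\<in>expo s. c \<alpha> * meval \<alpha> x) * \<phi> 0"
      unfolding sum_distrib_right
    proof (intro sum.cong refl)
      fix \<alpha> :: "'n \<Rightarrow>\<^sub>0 nat" assume "\<alpha> \<in> expo s"
      from \<phi>[OF this] show "c \<alpha> * \<phi> \<alpha> = c \<alpha> * meval \<alpha> x * \<phi> 0" by (metis mult.assoc)
    qed
    ultimately show "(\<Sum>\<alpha>\<in>expo s. c \<alpha> * meval \<alpha> x) = 0"
      using \<open>\<phi> 0 \<noteq> 0\<close> by simp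
  qed
qed

lemma Z_eq_kernel_variety: "Z = kernel_variety y s"
proof (intro equalityI subsetI)
  fix \<xi> assume \<xi>: "\<xi> \<in> Z"
  show "\<xi> \<in> kernel_variety y s"
    unfolding kernel_variety_def
  proof (intro CollectI allI impI)
    fix c assume c: "\<forall>\<delta>\<in>expo s. (\<Sum>\<alpha>\<in>expo s. c \<alpha> * y (\<delta> + \<alpha>)) = 0"
    have "(\<Sum>\<alpha>\<in>expo s. c \<alpha> * meval \<alpha> \<xi>) = (\<Sum>\<alpha>\<in>expo s. c \<alpha> * (\<Sum>\<delta>\<in>B. u \<xi> \<delta> * y (\<delta> + \<alpha>)))"
      by (intro sum.cong refl) (simp add: ip_u_coord[OF \<xi>, symmetric] ip_commute[of "u \<xi>"] ip_coord)
    also have "\<dots> = (\<Sum>\<alpha>\<in>expo s. \<Sum>\<delta>\<in>B. u \<xi> \<delta> * (c \<alpha> * y (\<delta> + \<alpha>)))"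
      by (simp add: sum_distrib_left mult.left_commute)
    also have "\<dots> = (\<Sum>\<delta>\<in>B. u \<xi> \<delta> * (\<Sum>\<alpha>\<in>expo s. c \<alpha> * y (\<delta> + \<alpha>)))"
      by (subst sum.swap) (simp add: sum_distrib_left)
    also have "\<dots> = 0" using c B_expo(2) by simp
    finally show "(\<Sum>\<alpha>\<in>expo s. c \<alpha> * meval \<alpha> \<xi>) = 0" .
  qed
next
  fix \<eta> assume \<eta>: "\<eta> \<in> kernel_variety y s"
  show "\<eta> \<in> Z"
  proof (rule ccontr)
    assume notin: "\<eta> \<notin> Z"
    define \<phi> where "\<phi> c = (\<Sum>\<gamma>\<in>B. c \<gamma> * meval \<gamma> \<eta>)" for c
    have app: "\<phi> (app (N i) c) = \<eta> $ i * \<phi> c" for i c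
    proof -
      have "\<phi> (app (N i) c) = (\<Sum>\<gamma>\<in>B. \<Sum>\<beta>\<in>B. c \<beta> * (N i \<gamma> \<beta> * meval \<gamma> \<eta>))"
        by (simp add: \<phi>_def app_def sum_distrib_left ac_simps)
      also have "\<dots> = (\<Sum>\<beta>\<in>B. c \<beta> * (\<Sum>\<gamma>\<in>B. N i \<gamma> \<beta> * meval \<gamma> \<eta>))"
        by (subst sum.swap) (simp add: sum_distrib_left)
      also have "\<dots> = (\<Sum>\<beta>\<in>B. c \<beta> * meval (\<beta> + Poly_Mapping.single i 1) \<eta>)"
      proof (intro sum.cong refl)
        fix \<beta> assume \<beta>: "\<beta> \<in> B"
        have "meval (\<beta> + Poly_Mapping.single i 1) \<eta> = (\<Sum>\<gamma>\<in>B. N i \<gamma> \<beta> * meval \<gamma> \<eta>)"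
          using mult \<beta> unfolding multiplication_matrices_iff
          by (intro kernel_variety_relation[OF \<eta> expo_shift[OF \<beta>]]) blast
        then show "c \<beta> * (\<Sum>\<gamma>\<in>B. N i \<gamma> \<beta> * meval \<gamma> \<eta>) = c \<beta> * meval (\<beta> + Poly_Mapping.single i 1) \<eta>"
          by (simp only:)
      qed
      also have "\<dots> = \<eta> $ i * \<phi> c"
        using meval_single[of i \<eta>] unfolding \<phi>_def sum_distrib_left meval_add
        by (intro sum.cong refl) simp
      finally show ?thesis .
    qed
    have "\<phi> (u \<xi>) = 0" if \<xi>: "\<xi> \<in> Z" for \<xi>
    proof -
      have "\<xi> \<noteq> \<eta>" using \<xi> notin by blast
      then obtain i where i: "\<xi> $ i \<noteq> \<eta> $ i" by (auto simp: vec_eq_iff)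
      have "\<phi> (app (N i) (u \<xi>)) = \<xi> $ i * \<phi> (u \<xi>)"
        using u(1)[OF \<xi>] by (simp add: eigenpair_def \<phi>_def fscale_def sum_distrib_left mult.assoc)
      then show ?thesis using app[of i "u \<xi>"] i by simp
    qed
    note \<phi>_u = this
    have sum0: "\<phi> (\<Sum>\<xi>\<in>Z. fscale (a \<xi>) (u \<xi>)) = 0" for a
    proof -
      have "\<phi> (\<Sum>\<xi>\<in>Z. fscale (a \<xi>) (u \<xi>)) = (\<Sum>\<gamma>\<in>B. \<Sum>\<xi>\<in>Z. a \<xi> * (u \<xi> \<gamma> * meval \<gamma> \<eta>))"
        by (simp add: \<phi>_def sum_fun_apply fscale_def sum_distrib_right mult.assoc)
      also have "\<dots> = (\<Sum>\<xi>\<in>Z. a \<xi> * \<phi> (u \<xi>))"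
        by (subst sum.swap) (simp add: sum_distrib_left \<phi>_def)
      also have "\<dots> = 0" by (simp add: \<phi>_u)
      finally show ?thesis .
    qed
    have "meval 0 \<eta> = \<phi> (coord 0)"
      unfolding \<phi>_def by (rule kernel_variety_relation[OF \<eta>]) (simp_all add: coord(2)[OF zero_in_expo])
    also have "\<dots> = \<phi> (\<Sum>\<xi>\<in>Z. fscale (ip (coord 0) (u \<xi>) / ip (u \<xi>) (u \<xi>)) (u \<xi>))"
      using u_expansion[OF coord(1)[OF zero_in_expo]] by (rule arg_cong)
    also have "\<dots> = 0" by (rule sum0)
    finally show False by simp
  qed
qed

end

text \<open>All column bases lead to the same joint eigenvalues, namely the kernel variety. So one basis may be fixed
  for the construction of the atoms, and the extraction procedure still returns them from any other.\<close>

theorem flat_extension: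
  fixes y :: "('n::finite \<Rightarrow>\<^sub>0 nat) \<Rightarrow> real"
  assumes psd: "psd_on (expo s) (moment_matrix y)" and ls: "l < s"
    and rank: "rank_on (expo s) (moment_matrix y) = rank_on (expo l) (moment_matrix y)"
  obtains Z w where "finite Z" "card Z = rank_on (expo s) (moment_matrix y)"
    "\<And>\<xi>. \<xi> \<in> Z \<Longrightarrow> 0 < w \<xi>"
    "\<And>\<gamma>. \<gamma> \<in> expo (2 * s) \<Longrightarrow> y \<gamma> = (\<Sum>\<xi>\<in>Z. w \<xi> * meval \<gamma> \<xi>)"
    "\<And>q \<xi>. psd_on (expo l) (localizing_matrix q y) \<Longrightarrow> 2 * l + pdeg q \<le> 2 * s \<Longrightarrow> \<xi> \<in> Z \<Longrightarrow> 0 \<le> peval q \<xi>"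
    "extracted_by_linear_algebra y l s Z"
proof -
  obtain B where B: "column_basis y l s B"
    using column_basis_exists[OF _ rank] ls by auto
  obtain N where N: "multiplication_matrices y s B N"
    using multiplication_matrices_exist[OF B ls] by blast
  interpret F: flat_moments y l s B N
    by unfold_locales (fact psd ls B N)+
  have "joint_eigenvalues B' N' = F.Z"
    if "column_basis y l s B'" "multiplication_matrices y s B' N'" for B' N'
  proof -
    interpret F': flat_moments y l s B' N'
      by unfold_locales (fact psd ls that)+
    show ?thesis by (simp add: F'.joint_eigenvalues_eq F.Z_eq_kernel_variety)
  qed
  then have "extracted_by_linear_algebra y l s F.Z"
    unfolding extracted_by_linear_algebra_def
    using B multiplication_matrices_exist[OF _ ls] by blast
  moreover have "card F.Z = rank_on (expo s) (moment_matrix y)"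
    using F.card_Z card_column_basis[OF B] by simp
  ultimately show thesis
    by (intro that[of F.Z F.weight] F.finite_Z F.weight_pos F.atomic_representation F.localizing_nonneg)
qed

section \<open>Optimal solutions and certified minimizers\<close>

theorem lemma1:
  fixes f :: "'n::finite mpoly"
    and g :: "'m::finite \<Rightarrow> 'n mpoly"
    and k :: nat
    and v :: "nat \<Rightarrow> 'n mpoly"
  assumes "compact (feasible_set g)"
    and "interior (feasible_set g) \<noteq> {}"
    and "\<And>j x. x \<in> feasible_set g \<Longrightarrow> peval (g j) x \<le> 1"
    and "generated_algebra (insert 1 (range g)) = UNIV"
    and "\<exists>x0\<in>feasible_set g. \<forall>j. 0 < peval (g j) x0 \<and> peval (g j) x0 < 1"
    and "basis_vec k v"
  shows
    "(\<exists>d0. \<forall>d\<ge>d0.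
        (\<exists>z. A_optimal f g v k d z) \<and>
        (AE X in random_points (npts f g k d). \<exists>z. B_optimal f g v k d X z))
     \<and>
     (\<forall>d\<ge>1. AE X in random_points (npts f g k d).
        \<forall>\<theta>. D_optimal f g v k d X \<theta> \<longrightarrow>
          (let L = npts f g k d;
               y = theta_moments L X \<theta>;
               s = s_order f g;
               r = r_order g
           in
             (rank_on (expo s) (moment_matrix y) = 1 \<longrightarrow>
                D_value f g v k d X = ereal (f_star f g) \<and>
                (\<chi> i. y (Poly_Mapping.single i 1)) = (\<Sum>p<L. \<theta> p *\<^sub>R X p) \<and>
                minimizer f g (\<chi> i. y (Poly_Mapping.single i 1)))
             \<and>
             (psd_on (expo s) (moment_matrix y) \<and>
              (\<forall>j. psd_on (expo (s - r)) (localizing_matrix (g j) y)) \<and>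
              rank_on (expo s) (moment_matrix y) = rank_on (expo (s - r)) (moment_matrix y) \<longrightarrow>
                D_value f g v k d X = ereal (f_star f g) \<and>
                (\<exists>Z. finite Z \<and> card Z = rank_on (expo s) (moment_matrix y) \<and>
                     (\<forall>x\<in>Z. minimizer f g x) \<and>
                     extracted_by_linear_algebra y (s - r) s Z))))"
proof -
  note g1 = assms(3) and alg = assms(4) and v = assms(6)
  obtain x0 where x0: "\<And>j. 0 < peval (g j) x0" "\<And>j. peval (g j) x0 < 1"
    using assms(5) by blast
  let ?cube = "{x :: real^'n. \<forall>i. -1 \<le> x $ i \<and> x $ i \<le> 1}"
  have cube: "?cube = cbox (-1) 1" by (auto simp: mem_box_cart)
  have "ball 0 1 \<subseteq> ?cube"
  proof
    fix x :: "real^'n" assume "x \<in> ball 0 1"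
    then have "\<bar>x $ i\<bar> \<le> 1" for i using component_le_norm_cart[of x i] by simp
    then show "x \<in> ?cube" by (auto simp: abs_le_iff minus_le_iff)
  qed
  then have "emeasure lborel (ball (0 :: real^'n) 1) \<le> emeasure lborel ?cube"
    unfolding cube by (intro emeasure_mono) auto
  then have "emeasure lborel ?cube \<noteq> 0"
    using emeasure_lborel_ball_pos[of 1 "0 :: real^'n"] by auto
  moreover have "emeasure lborel ?cube \<noteq> \<infinity>"
    unfolding cube using emeasure_lborel_cbox_finite[of "-1 :: real^'n" 1] by auto
  ultimately have uni: "AE X in random_points (npts f g k d). unisolvent (tau f g k d) (X :: nat \<Rightarrow> real^'n)" for d
    unfolding random_points_def npts_eq_sdim by (intro AE_unisolvent) (simp_all add: cube)

  obtain d0 where "\<forall>d\<ge>d0. \<exists>z. A_feasible f g v k d z"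
    using A_feasible_eventually[OF alg] by blast
  then have A: "\<forall>d\<ge>d0. \<exists>z. A_optimal f g v k d z"
    using A_optimal_if_feasible[where g = g, OF v x0] by blast
  have "AE X in random_points (npts f g k d). \<exists>z. B_optimal f g v k d X z" if "d0 \<le> d" for d
    using uni[of d] A that
    by (auto elim!: eventually_mono simp: A_optimal_def B_optimal_def B_feasible_iff_A_feasible[OF _ v])
  with A have a: "\<exists>d0. \<forall>d\<ge>d0. (\<exists>z. A_optimal f g v k d z) \<and>
      (AE X in random_points (npts f g k d). \<exists>z. B_optimal f g v k d X z)" by blast

  define s where "s = s_order f g"
  define r where "r = r_order g"
  have r: "1 \<le> r" "r \<le> s"
    unfolding r_def s_def using r_order_pos[OF alg] r_order_bounds(2) by auto
  have degf: "pdeg f \<le> 2 * s" and degg: "\<And>j. pdeg (g j) \<le> 2 * s" "\<And>j. pdeg (g j) \<le> 2 * r"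
    unfolding s_def r_def using s_order_bounds r_order_bounds(1) by auto
  have loc_deg: "2 * (s - r) + pdeg (g j) \<le> 2 * s" for j
    using degg(2)[of j] r by simp

  have b1: "D_value f g v k d X = ereal (f_star f g) \<and>
      (\<chi> i. y (Poly_Mapping.single i 1)) = (\<Sum>p<npts f g k d. \<theta> p *\<^sub>R X p) \<and>
      minimizer f g (\<chi> i. y (Poly_Mapping.single i 1))"
    if d: "1 \<le> d" and X: "unisolvent (tau f g k d) X" and opt: "D_optimal f g v k d X \<theta>"
      and y: "y = theta_moments (npts f g k d) X \<theta>" and rank: "rank_on (expo s) (moment_matrix y) = 1"
    for d X \<theta> y
  proof -
    let ?x = "(\<chi> i. y (Poly_Mapping.single i 1)) :: real^'n"
    have feas: "D_feasible f g v k d X \<theta>" using opt by (simp add: D_optimal_def is_arg_min_def)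
    then have y0: "y 0 = 1" by (simp add: y theta_moments_def D_feasible_def)
    have mom: "theta_moments (npts f g k d) X \<theta> \<alpha> = (\<Sum>\<xi>\<in>{?x}. 1 * meval \<alpha> \<xi>)"
      if "\<alpha> \<in> expo (2 * s)" for \<alpha>
      using rank_one_point_moments[OF rank y0 _ that] r by (simp add: y)
    have "0 \<le> peval (g j) ?x" for j
    proof -
      \<comment> \<open>Among the products \<open>h\<^sub>\<alpha>\<^sub>\<beta>\<close> of degree at most \<open>d\<close> is \<open>g j\<close> itself, as \<open>d \<ge> 1\<close>.\<close>
      let ?e = "\<lambda>i. if i = j then 1 else 0 :: nat"
      have "(?e, \<lambda>_. 0) \<in> expo_pairs d" using d by (auto simp: expo_pairs_def)
      moreover have "hpoly g (?e, \<lambda>_. 0) = g j" by (rule hpoly_single)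
      ultimately have "0 \<le> (\<Sum>p<npts f g k d. \<theta> p * peval (g j) (X p))"
        using feas unfolding D_feasible_def by metis
      also have "\<dots> = peval (g j) ?x"
        using theta_moments_atoms[OF polys_upto_pdeg[OF degg(1)] mom] by simp
      finally show ?thesis .
    qed
    then have x: "{?x} \<subseteq> feasible_set g" by (simp add: feasible_set_def)
    have "?x = (\<Sum>p<npts f g k d. \<theta> p *\<^sub>R X p)"
      by (simp add: vec_eq_iff y theta_moments_def sum_component meval_single[simplified])
    then show ?thesis
      using atoms_are_minimizers[OF X v g1 opt degf _ x, of "\<lambda>_. 1"] mom by simp
  qed

  have b2: "D_value f g v k d X = ereal (f_star f g) \<and>
      (\<exists>Z. finite Z \<and> card Z = rank_on (expo s) (moment_matrix y) \<and>
        (\<forall>x\<in>Z. minimizer f g x) \<and> extracted_by_linear_algebra y (s - r) s Z)"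
    if X: "unisolvent (tau f g k d) X" and opt: "D_optimal f g v k d X \<theta>"
      and y: "y = theta_moments (npts f g k d) X \<theta>"
      and psd: "psd_on (expo s) (moment_matrix y)"
      and loc: "\<forall>j. psd_on (expo (s - r)) (localizing_matrix (g j) y)"
      and rank: "rank_on (expo s) (moment_matrix y) = rank_on (expo (s - r)) (moment_matrix y)"
    for d X \<theta> y
  proof -
    have "s - r < s" using r by simp
    then obtain Z w where Z: "finite Z" "card Z = rank_on (expo s) (moment_matrix y)"
      "\<And>\<xi>. \<xi> \<in> Z \<Longrightarrow> 0 < w \<xi>"
      "\<And>\<gamma>. \<gamma> \<in> expo (2 * s) \<Longrightarrow> y \<gamma> = (\<Sum>\<xi>\<in>Z. w \<xi> * meval \<gamma> \<xi>)"
      "\<And>q \<xi>. psd_on (expo (s - r)) (localizing_matrix q y) \<Longrightarrow> 2 * (s - r) + pdeg q \<le> 2 * s \<Longrightarrow>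
        \<xi> \<in> Z \<Longrightarrow> 0 \<le> peval q \<xi>"
      "extracted_by_linear_algebra y (s - r) s Z"
      by (rule flat_extension[OF psd _ rank]) blast
    have feas: "Z \<subseteq> feasible_set g"
      using Z(5) loc loc_deg by (auto simp: feasible_set_def)
    have mom: "theta_moments (npts f g k d) X \<theta> \<gamma> = (\<Sum>\<xi>\<in>Z. w \<xi> * meval \<gamma> \<xi>)"
      if "\<gamma> \<in> expo (2 * s)" for \<gamma>
      using Z(4)[OF that] unfolding y .
    note min = atoms_are_minimizers[where w = w, OF X v g1 opt degf Z(1) feas Z(3) mom]
    show ?thesis
      by (intro conjI exI[of _ Z] min Z(1,2,6))
  qed

  show ?thesis
    unfolding Let_def s_def[symmetric] r_def[symmetric]
    by (intro conjI[OF a] allI impI eventually_mono[OF uni] conjI[OF impI impI])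
      (use b1[OF _ _ _ refl] b2[OF _ _ refl] in blast)+
qed

end
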